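(* Let $A$ be an invertible, sectorial operator on a Banach space $X$. Then, for every Banach function space $\Phi$ over $\mathbb{R}_+$ with $\min(1,\tfrac1{(\cdot)})\in\Phi$ and such that the Calderón operator $P+Q$ is bounded on $\Phi$, and for every $\phi\in(\phi_A,\pi)$, the part $A_\Phi$ of $A$ in $(X,D_A)_\Phi$ has a bounded $H^\infty(S_\phi)$-functional calculus, that is, there exists a constant $C\ge0$ such that $$|f(A_\Phi)x|_{(X,D_A)_\Phi}\le C\,\|f\|_{H^\infty}\,|x|_{(X,D_A)_\Phi}\qquad(f\in H^\infty(S_\phi),\ x\in D_{f(A_\Phi)}).$$
   Context: Banach function space: $\mathcal{M}$ is the set of complex measurable functions on $\mathbb{R}_+=[0,\infty)$ (topology of convergence in Lebesgue measure). A Banach function space over $\mathbb{R}_+$ is a Banach space $\Phi$ that is a Banach lattice and an order ideal of $\mathcal{M}$: it is a sublattice of $\mathcal{M}$, and $|f|\le|g|$, $g\in\Phi$, $f\in\mathcal{M}$ implies $f\in\Phi$, $\|f\|_\Phi\le\|g\|_\Phi$. $Pf(t)=\frac1t\int_0^tf(s)\,ds$ is the Hardy operator, with maximal domain $L^1_{loc}(\mathbb{R}_+)$, and $Qf(t)=\int_t^\infty f(s)\,\frac{ds}{s}$ is its formal adjoint, defined for all $f$ with $f\chi_{(\tau,\infty)}\in L^1(t^{-1}dt)$ for every $\tau>0$. $P+Q$ bounded on $\Phi$ means that $\Phi$ is contained in the domains of $P$ and $Q$ and $P+Q:\Phi\to\Phi$ is bounded. Interpolation space: $D_A$ is the domain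 of $A$ with the graph norm. For $x\in X$, $t>0$, $K(t,x)=\inf\{|a|_X+t|b|_{D_A}:a\in X,\,b\in D_A,\,a+b=x\}$, and $(X,D_A)_\Phi=\{x\in X:[t\mapsto t^{-1}K(t,x)]\in\Phi\}$ with norm $\|(\cdot)^{-1}K(\cdot,x)\|_\Phi$. The part $A_\Phi$ of $A$ in $(X,D_A)_\Phi$ is $A_\Phi x=Ax$ with domain $\{x\in D_A\cap(X,D_A)_\Phi: Ax\in(X,D_A)_\Phi\}$; it is an injective sectorial operator on $(X,D_A)_\Phi$, sectorial of every angle for which $A$ is. Sectorial operators: for $\phi\in(0,\pi)$, $S_\phi=\{z\in\mathbb{C}:z\ne0,|\arg z|<\phi\}$. A linear, not necessarily densely defined operator $B$ on a Banach space $Z$ is sectorial of angle $\phi\in(0,\pi)$ if $\sigma(B)\subseteq\overline{S_\phi}$ and $\sup_{\lambda\in\mathbb{C}\setminus S_{\phi'}}|\lambda R(\lambda,B)|_{\mathcal{L}(Z)}<\infty$ for every $\phi'\in(\phi,\pi)$, where $R(\lambda,B)=(\lambda-B)^{-1}$; $B$ is sectorial if it is sectorial of some angle in $(0,\pi)$, and $\phi_B$ is the infimum of all $\phi>0$ such that $B$ is sectorial of angle $\phi$. Functional calculus: $H^\infty(S_\phi)$ is the algebra of bounded holomorphic functions on $S_\phi$ with sup norm $\|\cdot\|_{H^\infty}$; $H^\infty_0(S_\phi)=\{f\in H^\infty(S_\phi):\exists C,s>0,\ |f(z)|\le C\min(|z|^s,|z|^{-s})\ (z\in S_\phi)\}$.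 For $B$ sectorial, $\phi\in(\phi_B,\pi)$ and $f\in H^\infty_0(S_\phi)$, $f(B)=\frac1{2\pi i}\int_{\partial S_{\phi'}}f(z)R(z,B)\,dz$ for any $\phi'\in(\phi_B,\phi)$ (positively oriented boundary). If moreover $B$ is injective, put $e(z)=\frac{z}{(1+z)^2}$, so that $e(B)=B(I+B)^{-2}$ is injective; for $f\in H^\infty(S_\phi)$ one has $fe\in H_0^\infty(S_\phi)$, and $f(B)=e(B)^{-1}(fe)(B)$ is a closed operator with its maximal domain $D_{f(B)}=\{x:(fe)(B)x\in\operatorname{Range}(e(B))\}$. *)

theory Defs
  imports "HOL-Analysis.Analysis"
begin

section \<open>Complex Banach spaces\<close>

class complex_vector = real_vector +
  fixes scaleC :: "complex \<Rightarrow> 'a \<Rightarrow> 'a" (infixr "*\<^sub>C" 75)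
  assumes scaleC_add_right: "a *\<^sub>C (x + y) = a *\<^sub>C x + a *\<^sub>C y"
    and scaleC_add_left: "(a + b) *\<^sub>C x = a *\<^sub>C x + b *\<^sub>C x"
    and scaleC_scaleC: "a *\<^sub>C (b *\<^sub>C x) = (a * b) *\<^sub>C x"
    and scaleC_one: "1 *\<^sub>C x = x"
    and scaleR_eq_scaleC: "r *\<^sub>R x = complex_of_real r *\<^sub>C x"

class complex_banach = complex_vector + banach +
  assumes norm_scaleC: "norm (a *\<^sub>C x) = cmod a * norm x"

text \<open>
  An interpolation space is a subspace of the given Banach space that carries a norm of its own,
  and it depends on the operator and on the function space.  Operator-theoretic notions are
  therefore relative to a carrier \<open>V\<close>, a subspace of an ambient complex vector space, and a norm
  \<open>N\<close> on \<open>V\<close>.  The ambient Banach space itself is the case \<open>V = UNIV\<close>, \<open>N = norm\<close>.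
\<close>

definition complete_wrt :: "'a::minus set \<Rightarrow> ('a \<Rightarrow> real) \<Rightarrow> bool" where
  "complete_wrt V N \<longleftrightarrow>
     (\<forall>X::nat \<Rightarrow> 'a. (\<forall>n. X n \<in> V) \<and> (\<forall>e>0. \<exists>M. \<forall>m\<ge>M. \<forall>n\<ge>M. N (X m - X n) < e)
        \<longrightarrow> (\<exists>x\<in>V. (\<lambda>n. N (X n - x)) \<longlonglongrightarrow> 0))"

definition banach_on :: "'a::complex_vector set \<Rightarrow> ('a \<Rightarrow> real) \<Rightarrow> bool" where
  "banach_on V N \<longleftrightarrow>
     module.subspace scaleC V \<and>
     (\<forall>x\<in>V. 0 \<le> N x \<and> (N x = 0 \<longleftrightarrow> x = 0)) \<and>
     (\<forall>x\<in>V. \<forall>y\<in>V. N (x + y) \<le> N x + N y) \<and>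
     (\<forall>c. \<forall>x\<in>V. N (c *\<^sub>C x) = cmod c * N x) \<and>
     complete_wrt V N"


section \<open>Operators, resolvents, sectoriality\<close>

text \<open>An operator in \<open>V\<close> is given by its domain \<open>D\<close> and a function \<open>B\<close>, whose values outside \<open>D\<close>
  are irrelevant.\<close>

definition linear_operator :: "'a::complex_vector set \<Rightarrow> 'a set \<Rightarrow> ('a \<Rightarrow> 'a) \<Rightarrow> bool" where
  "linear_operator V D B \<longleftrightarrow>
     module.subspace scaleC D \<and> D \<subseteq> V \<and> B ` D \<subseteq> V \<and>
     (\<forall>x\<in>D. \<forall>y\<in>D. B (x + y) = B x + B y) \<and>
     (\<forall>c. \<forall>x\<in>D. B (c *\<^sub>C x) = c *\<^sub>C B x)"

definition bounded_operator :: "'a::complex_vector set \<Rightarrow> ('a \<Rightarrow> real) \<Rightarrow> ('a \<Rightarrow> 'a) \<Rightarrow> bool" where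
  "bounded_operator V N T \<longleftrightarrow> linear_operator V V T \<and> (\<exists>C. \<forall>x\<in>V. N (T x) \<le> C * N x)"

definition resolvent :: "'a::complex_vector set \<Rightarrow> ('a \<Rightarrow> 'a) \<Rightarrow> complex \<Rightarrow> 'a \<Rightarrow> 'a" where
  "resolvent D B \<mu> = inv_into D (\<lambda>x. \<mu> *\<^sub>C x - B x)"

definition resolvent_set ::
    "'a::complex_vector set \<Rightarrow> ('a \<Rightarrow> real) \<Rightarrow> 'a set \<Rightarrow> ('a \<Rightarrow> 'a) \<Rightarrow> complex set" where
  "resolvent_set V N D B =
     {\<mu>. bij_betw (\<lambda>x. \<mu> *\<^sub>C x - B x) D V \<and> bounded_operator V N (resolvent D B \<mu>)}"

definition op_spectrum ::
    "'a::complex_vector set \<Rightarrow> ('a \<Rightarrow> real) \<Rightarrow> 'a set \<Rightarrow> ('a \<Rightarrow> 'a) \<Rightarrow> complex set" where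
  "op_spectrum V N D B = - resolvent_set V N D B"

definition invertible_operator ::
    "'a::complex_vector set \<Rightarrow> ('a \<Rightarrow> real) \<Rightarrow> 'a set \<Rightarrow> ('a \<Rightarrow> 'a) \<Rightarrow> bool" where
  "invertible_operator V N D B \<longleftrightarrow> 0 \<in> resolvent_set V N D B"

definition sector :: "real \<Rightarrow> complex set" where
  "sector \<phi> = {z. z \<noteq> 0 \<and> \<bar>Arg z\<bar> < \<phi>}"

text \<open>In the uniform bound, \<open>\<mu> = 0\<close> imposes no condition, as \<open>0 *\<^sub>C _ = 0\<close>; every other
  \<open>\<mu>\<close> outside \<open>sector \<phi>'\<close> lies in the resolvent set.\<close>

definition sectorial_of_angle ::
    "'a::complex_vector set \<Rightarrow> ('a \<Rightarrow> real) \<Rightarrow> 'a set \<Rightarrow> ('a \<Rightarrow> 'a) \<Rightarrow> real \<Rightarrow> bool" where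
  "sectorial_of_angle V N D B \<phi> \<longleftrightarrow>
     banach_on V N \<and> linear_operator V D B \<and> 0 < \<phi> \<and> \<phi> < pi \<and>
     op_spectrum V N D B \<subseteq> closure (sector \<phi>) \<and>
     (\<forall>\<phi>'. \<phi> < \<phi>' \<and> \<phi>' < pi \<longrightarrow>
        (\<exists>C. \<forall>\<mu>. \<mu> \<notin> sector \<phi>' \<longrightarrow> (\<forall>x\<in>V. N (\<mu> *\<^sub>C resolvent D B \<mu> x) \<le> C * N x)))"

definition sectorial ::
    "'a::complex_vector set \<Rightarrow> ('a \<Rightarrow> real) \<Rightarrow> 'a set \<Rightarrow> ('a \<Rightarrow> 'a) \<Rightarrow> bool" where
  "sectorial V N D B \<longleftrightarrow> (\<exists>\<phi>. sectorial_of_angle V N D B \<phi>)"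

definition sectoriality_angle ::
    "'a::complex_vector set \<Rightarrow> ('a \<Rightarrow> real) \<Rightarrow> 'a set \<Rightarrow> ('a \<Rightarrow> 'a) \<Rightarrow> real" where
  "sectoriality_angle V N D B = Inf {\<phi>. sectorial_of_angle V N D B \<phi>}"


section \<open>Functional calculus\<close>

text \<open>
  The integrals of the library need the norm to be that of a type class, so integration with
  respect to \<open>N\<close> is spelled out: Riemann integrals over compact intervals (the integrands of
  interest are continuous in operator norm), and improper integrals over \<open>(0, \<infinity>)\<close>, both
  converging in the operator norm of the bounded operators on \<open>(V, N)\<close>.
\<close>

definition has_operator_integral ::
    "'a::complex_vector set \<Rightarrow> ('a \<Rightarrow> real) \<Rightarrow> (real \<Rightarrow> 'a \<Rightarrow> 'a) \<Rightarrow> ('a \<Rightarrow> 'a) \<Rightarrow> real \<Rightarrow> real \<Rightarrow> bool" where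
  "has_operator_integral V N G T a b \<longleftrightarrow>
     bounded_operator V N T \<and>
     (\<forall>e>0. \<exists>\<delta>>0. \<forall>p. p tagged_division_of {a..b} \<and> (\<lambda>t. ball t \<delta>) fine p \<longrightarrow>
        (\<forall>x\<in>V. N ((\<Sum>(t, k)\<in>p. measure lborel k *\<^sub>R G t x) - T x) \<le> e * N x))"

definition has_improper_operator_integral ::
    "'a::complex_vector set \<Rightarrow> ('a \<Rightarrow> real) \<Rightarrow> (real \<Rightarrow> 'a \<Rightarrow> 'a) \<Rightarrow> ('a \<Rightarrow> 'a) \<Rightarrow> bool" where
  "has_improper_operator_integral V N G T \<longleftrightarrow>
     bounded_operator V N T \<and>
     (\<exists>I. (\<forall>a b. 0 < a \<and> a < b \<longrightarrow> has_operator_integral V N G (I a b) a b) \<and>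
        (\<forall>e>0. \<exists>a0>0. \<exists>b0>a0. \<forall>a b. 0 < a \<and> a \<le> a0 \<and> b0 \<le> b \<longrightarrow>
           (\<forall>x\<in>V. N (I a b x - T x) \<le> e * N x)))"

text \<open>The integral of \<open>f(z) R(z, B)\<close> along the ray \<open>z = r exp(i \<theta>)\<close>, \<open>0 < r < \<infinity>\<close>, directed
  outwards.  The integral determines the operator on \<open>V\<close>.\<close>

definition ray_integral ::
    "'a::complex_vector set \<Rightarrow> ('a \<Rightarrow> real) \<Rightarrow> 'a set \<Rightarrow> ('a \<Rightarrow> 'a) \<Rightarrow> (complex \<Rightarrow> complex) \<Rightarrow> real
       \<Rightarrow> 'a \<Rightarrow> 'a" where
  "ray_integral V N D B f \<theta> =
     (SOME T. has_improper_operator_integral V N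
        (\<lambda>r x. (f (rcis r \<theta>) * cis \<theta>) *\<^sub>C resolvent D B (rcis r \<theta>) x) T)"

text \<open>The operator \<open>f(B)\<close> for \<open>f \<in> H\<^sup>\<infinity>\<^sub>0(S\<^sub>\<phi>)\<close>.  By Cauchy's theorem the contour angle may be
  any \<open>\<psi>\<close> between the angle of \<open>B\<close> and \<open>\<phi>\<close>.  The positively oriented boundary of the sector
  runs outwards along the lower ray and inwards along the upper one.\<close>

definition contour_angle ::
    "'a::complex_vector set \<Rightarrow> ('a \<Rightarrow> real) \<Rightarrow> 'a set \<Rightarrow> ('a \<Rightarrow> 'a) \<Rightarrow> real \<Rightarrow> real" where
  "contour_angle V N D B \<phi> = (SOME \<psi>. sectoriality_angle V N D B < \<psi> \<and> \<psi> < \<phi>)"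

definition dunford ::
    "'a::complex_vector set \<Rightarrow> ('a \<Rightarrow> real) \<Rightarrow> 'a set \<Rightarrow> ('a \<Rightarrow> 'a) \<Rightarrow> real \<Rightarrow> (complex \<Rightarrow> complex)
       \<Rightarrow> 'a \<Rightarrow> 'a" where
  "dunford V N D B \<phi> f x =
     (let \<psi> = contour_angle V N D B \<phi> in
      (1 / (2 * of_real pi * \<i>)) *\<^sub>C
        (ray_integral V N D B f (- \<psi>) x - ray_integral V N D B f \<psi> x))"

definition H_inf :: "real \<Rightarrow> (complex \<Rightarrow> complex) set" where
  "H_inf \<phi> = {f. f holomorphic_on sector \<phi> \<and> bounded (f ` sector \<phi>)}"

definition H_inf_norm :: "real \<Rightarrow> (complex \<Rightarrow> complex) \<Rightarrow> real" where
  "H_inf_norm \<phi> f = (SUP z\<in>sector \<phi>. cmod (f z))"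

definition regularizer :: "complex \<Rightarrow> complex" where
  "regularizer z = z / (1 + z)\<^sup>2"

text \<open>\<open>f(B) = e(B)\<^sup>-\<^sup>1 (f e)(B)\<close> with its maximal domain, for injective sectorial \<open>B\<close> and
  \<open>f \<in> H_inf \<phi>\<close>.\<close>

definition calculus_domain ::
    "'a::complex_vector set \<Rightarrow> ('a \<Rightarrow> real) \<Rightarrow> 'a set \<Rightarrow> ('a \<Rightarrow> 'a) \<Rightarrow> real \<Rightarrow> (complex \<Rightarrow> complex)
       \<Rightarrow> 'a set" where
  "calculus_domain V N D B \<phi> f =
     {x \<in> V. dunford V N D B \<phi> (\<lambda>z. f z * regularizer z) x \<in> dunford V N D B \<phi> regularizer ` V}"

definition calculus ::
    "'a::complex_vector set \<Rightarrow> ('a \<Rightarrow> real) \<Rightarrow> 'a set \<Rightarrow> ('a \<Rightarrow> 'a) \<Rightarrow> real \<Rightarrow> (complex \<Rightarrow> complex)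
       \<Rightarrow> 'a \<Rightarrow> 'a" where
  "calculus V N D B \<phi> f x =
     inv_into V (dunford V N D B \<phi> regularizer)
       (dunford V N D B \<phi> (\<lambda>z. f z * regularizer z) x)"

text \<open>All conjuncts but the last are what the calculus on \<open>S\<^sub>\<phi>\<close> presupposes.\<close>

definition has_bounded_H_inf_calculus ::
    "'a::complex_vector set \<Rightarrow> ('a \<Rightarrow> real) \<Rightarrow> 'a set \<Rightarrow> ('a \<Rightarrow> 'a) \<Rightarrow> real \<Rightarrow> bool" where
  "has_bounded_H_inf_calculus V N D B \<phi> \<longleftrightarrow>
     sectorial V N D B \<and> inj_on B D \<and> sectoriality_angle V N D B < \<phi> \<and> \<phi> < pi \<and>
     (\<exists>C\<ge>0. \<forall>f \<in> H_inf \<phi>. \<forall>x \<in> calculus_domain V N D B \<phi> f.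
        N (calculus V N D B \<phi> f x) \<le> C * H_inf_norm \<phi> f * N x)"


section \<open>Banach function spaces over the half line\<close>

text \<open>
  Elements are represented by functions on the whole real line, of which only the restriction to
  \<open>{0..}\<close> matters, up to null sets; the ideal property makes \<open>\<Phi>\<close> and \<open>N\<close> invariant under
  almost everywhere equality.  It also yields the lattice structure: \<open>\<Phi>\<close> contains \<open>\<bar>f\<bar>\<close> for all
  \<open>f \<in> \<Phi>\<close>, hence maxima and minima of its real-valued members, and \<open>N\<close> is a lattice norm.
\<close>

definition banach_function_space ::
    "(real \<Rightarrow> complex) set \<Rightarrow> ((real \<Rightarrow> complex) \<Rightarrow> real) \<Rightarrow> bool" where
  "banach_function_space \<Phi> N \<longleftrightarrow>
     \<Phi> \<subseteq> borel_measurable (lebesgue_on {0..}) \<and>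
     (\<lambda>t. 0) \<in> \<Phi> \<and>
     (\<forall>f\<in>\<Phi>. \<forall>g\<in>\<Phi>. (\<lambda>t. f t + g t) \<in> \<Phi> \<and> N (\<lambda>t. f t + g t) \<le> N f + N g) \<and>
     (\<forall>c. \<forall>f\<in>\<Phi>. (\<lambda>t. c * f t) \<in> \<Phi> \<and> N (\<lambda>t. c * f t) = cmod c * N f) \<and>
     (\<forall>f\<in>\<Phi>. 0 \<le> N f \<and> (N f = 0 \<longleftrightarrow> (AE t in lebesgue_on {0..}. f t = 0))) \<and>
     (\<forall>f \<in> borel_measurable (lebesgue_on {0..}). \<forall>g\<in>\<Phi>.
        (AE t in lebesgue_on {0..}. cmod (f t) \<le> cmod (g t)) \<longrightarrow> f \<in> \<Phi> \<and> N f \<le> N g) \<and>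
     complete_wrt \<Phi> N"

definition hardy_dom :: "(real \<Rightarrow> complex) set" where
  "hardy_dom = {f. \<forall>\<tau>>0. set_integrable lebesgue {0..\<tau>} f}"

definition hardy :: "(real \<Rightarrow> complex) \<Rightarrow> real \<Rightarrow> complex" where
  "hardy f t = of_real (1 / t) * (LINT s:{0..t}|lebesgue. f s)"

definition hardy_adj_dom :: "(real \<Rightarrow> complex) set" where
  "hardy_adj_dom = {f. \<forall>\<tau>>0. set_integrable lebesgue {\<tau><..} (\<lambda>s. f s / of_real s)}"

definition hardy_adj :: "(real \<Rightarrow> complex) \<Rightarrow> real \<Rightarrow> complex" where
  "hardy_adj f t = (LINT s:{t<..}|lebesgue. f s / of_real s)"

definition calderon_bounded ::
    "(real \<Rightarrow> complex) set \<Rightarrow> ((real \<Rightarrow> complex) \<Rightarrow> real) \<Rightarrow> bool" where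
  "calderon_bounded \<Phi> N \<longleftrightarrow>
     \<Phi> \<subseteq> hardy_dom \<inter> hardy_adj_dom \<and>
     (\<forall>f\<in>\<Phi>. (\<lambda>t. hardy f t + hardy_adj f t) \<in> \<Phi>) \<and>
     (\<exists>C. \<forall>f\<in>\<Phi>. N (\<lambda>t. hardy f t + hardy_adj f t) \<le> C * N f)"


section \<open>Interpolation spaces\<close>

definition K_functional ::
    "'a::complex_banach set \<Rightarrow> ('a \<Rightarrow> 'a) \<Rightarrow> real \<Rightarrow> 'a \<Rightarrow> real" where
  "K_functional D A t x =
     Inf {norm a + t * (norm b + norm (A b)) | a b. b \<in> D \<and> a + b = x}"

definition K_quotient ::
    "'a::complex_banach set \<Rightarrow> ('a \<Rightarrow> 'a) \<Rightarrow> 'a \<Rightarrow> real \<Rightarrow> complex" where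
  "K_quotient D A x = (\<lambda>t. complex_of_real (K_functional D A t x / t))"

definition interp_space ::
    "'a::complex_banach set \<Rightarrow> ('a \<Rightarrow> 'a) \<Rightarrow> (real \<Rightarrow> complex) set \<Rightarrow> 'a set" where
  "interp_space D A \<Phi> = {x. K_quotient D A x \<in> \<Phi>}"

definition interp_norm ::
    "'a::complex_banach set \<Rightarrow> ('a \<Rightarrow> 'a) \<Rightarrow> ((real \<Rightarrow> complex) \<Rightarrow> real) \<Rightarrow> 'a \<Rightarrow> real" where
  "interp_norm D A N x = N (K_quotient D A x)"

text \<open>The part of \<open>A\<close> in the interpolation space acts as \<open>A\<close> on the following domain.\<close>

definition part_domain ::
    "'a::complex_banach set \<Rightarrow> ('a \<Rightarrow> 'a) \<Rightarrow> (real \<Rightarrow> complex) set \<Rightarrow> 'a set" where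
  "part_domain D A \<Phi> = {x \<in> D \<inter> interp_space D A \<Phi>. A x \<in> interp_space D A \<Phi>}"

end

theory Submission
  imports Defs "HOL-Complex_Analysis.Cauchy_Integral_Formula"
begin

text \<open>
  Let \<open>y = f(A\<^sub>\<Phi>) x\<close> and \<open>k\<^sub>x(t) = K(t, x)/t\<close>.  As \<open>A\<close> is invertible, \<open>K(t, y)\<close> is comparable with
  \<open>|t A (1 + tA)\<^sup>-\<^sup>1 y|\<close>.  For the regularised vector \<open>y\<^sub>s = (1 + sA)\<^sup>-\<^sup>1 y\<close> the element
  \<open>A (1 + tA)\<^sup>-\<^sup>1 y\<^sub>s\<close> is \<open>1/(2\<pi>i)\<close> times the integral of \<open>f(z) z / ((1 + tz)(1 + sz)) R(z, A) x\<close> along the contour,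
  and \<open>z R(z, A) x = x + A R(z, A) x\<close>, where \<open>x\<close> contributes nothing by Cauchy's theorem.  Since
  \<open>|A R(z, A) x| \<le> M K(1/|z|, x)\<close>, the integral is bounded by a constant times
  \<open>\<parallel>f\<parallel> \<integral> K(1/r, x)/(1 + tr) dr \<le> \<parallel>f\<parallel> (P + Q) k\<^sub>x(t)\<close>, uniformly in \<open>s\<close>.  Letting \<open>s\<close> tend to \<open>0\<close> gives
  \<open>k\<^sub>y \<le> const \<parallel>f\<parallel> (P + Q) k\<^sub>x\<close>, and the ideal property of \<open>\<Phi>\<close> finishes the proof.

  The contour angle of the calculus of \<open>A\<^sub>\<Phi>\<close> need not exceed the sectoriality angle of \<open>A\<close>.  The resolvent sets
  of \<open>A\<close> and \<open>A\<^sub>\<Phi>\<close> agree, however, so the contour can be moved to an angle at which the estimates for \<open>A\<close> hold.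
\<close>

section \<open>Complex scalars and ray integrals\<close>

text \<open>\<open>D\<close> need not be dense in X, and neither a Fatou property nor order
  continuity of the norm of \<Phi> is assumed, so y_s may fail to approach y in the norm of the
  interpolation space. The limit s -> 0 is therefore taken in X at each fixed t, where K(s, y) -> 0
  suffices. That convergence comes from P being defined on \<Phi>: K(t, y) is at most the integral
  of K(s, y)/s over [0, t]. The same fact replaces density in the contour argument at infinity. The
  factor 1/(1 + sz) is there because f(z) z/(1 + tz) is only bounded, too little decay for a Dunford
  integral. As y is given only by e(B) y = (f e)(B) x with B the part of A, the operator e(B) must
  be identified with A (1 + A)^-2. The calculus rests on integrals in the operator norm of the
  interpolation space, selected by choice, so their existence is itself a claim. Integrals are
  formed in X, and the errors of Riemann sums are transferred by one principle: an operator that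
  commutes with A^-1 and has bound c on X has bound c on the interpolation space.\<close>

interpretation scaleC: module "scaleC :: complex \<Rightarrow> 'a::complex_vector \<Rightarrow> 'a"
  by unfold_locales (simp_all add: scaleC_add_right scaleC_add_left scaleC_scaleC scaleC_one)

lemma scaleC_scaleR_commute: "a *\<^sub>C (r *\<^sub>R x) = r *\<^sub>R (a *\<^sub>C (x::'a::complex_vector))"
  by (simp add: scaleR_eq_scaleC scaleC_scaleC mult.commute)

lemma bounded_bilinear_scaleC: "bounded_bilinear (scaleC :: complex \<Rightarrow> 'a::complex_banach \<Rightarrow> 'a)"
proof
  show "\<exists>K. \<forall>a (b::'a). norm (a *\<^sub>C b) \<le> norm a * norm b * K"
    by (rule exI[of _ 1]) (simp add: norm_scaleC)
qed (simp_all add: scaleC_add_right scaleC_add_left scaleC_scaleR_commute scaleR_conv_of_real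
    scaleR_eq_scaleC scaleC_scaleC mult.commute)

lemmas bounded_linear_scaleC_right = bounded_bilinear.bounded_linear_right[OF bounded_bilinear_scaleC]
lemmas bounded_linear_scaleC_left = bounded_bilinear.bounded_linear_left[OF bounded_bilinear_scaleC]
lemmas continuous_on_scaleC [continuous_intros] =
  bounded_bilinear.continuous_on[OF bounded_bilinear_scaleC]
lemmas tendsto_scaleC [tendsto_intros] = bounded_bilinear.tendsto[OF bounded_bilinear_scaleC]
lemmas has_derivative_scaleC = bounded_bilinear.FDERIV[OF bounded_bilinear_scaleC]

lemma subspace_scaleC_iff:
  "module.subspace scaleC V \<longleftrightarrow>
    (0::'a::complex_vector) \<in> V \<and> (\<forall>x\<in>V. \<forall>y\<in>V. x + y \<in> V) \<and> (\<forall>c. \<forall>x\<in>V. c *\<^sub>C x \<in> V)"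
  by (auto simp: scaleC.subspace_def)

text \<open>The sets in use contain boundary rays, so differentiability is taken within
  \<open>S\<close>. Continuity of the derivative is required because the exchange of integrals in
  \<open>ray_integral_difference\<close> uses it.\<close>

definition vholo :: "(complex \<Rightarrow> 'a::complex_banach) \<Rightarrow> complex set \<Rightarrow> bool" where
  "vholo g S \<longleftrightarrow> (\<exists>g'. continuous_on S g' \<and>
     (\<forall>z\<in>S. (g has_derivative (\<lambda>h. h *\<^sub>C g' z)) (at z within S)))"

lemma vholo_subset: "vholo g S \<Longrightarrow> T \<subseteq> S \<Longrightarrow> vholo g T"
  unfolding vholo_def by (meson continuous_on_subset has_derivative_subset subsetD)

lemma vholo_const: "vholo (\<lambda>z. x) S"
  unfolding vholo_def by (rule exI[of _ "\<lambda>z. 0"]) simp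

lemma vholo_continuous_on: "vholo g S \<Longrightarrow> continuous_on S g"
  unfolding vholo_def continuous_on_eq_continuous_within by (blast intro: has_derivative_continuous)

lemma vholo_diff: "vholo f S \<Longrightarrow> vholo g S \<Longrightarrow> vholo (\<lambda>z. f z - g z) S"
  unfolding vholo_def
proof (elim exE conjE)
  fix f' g'
  assume *: "continuous_on S f'" "continuous_on S g'"
    "\<forall>z\<in>S. (f has_derivative (\<lambda>h. h *\<^sub>C f' z)) (at z within S)"
    "\<forall>z\<in>S. (g has_derivative (\<lambda>h. h *\<^sub>C g' z)) (at z within S)"
  show "\<exists>g'. continuous_on S g' \<and>
      (\<forall>z\<in>S. ((\<lambda>z. f z - g z) has_derivative (\<lambda>h. h *\<^sub>C g' z)) (at z within S))"
    using * by (intro exI[of _ "\<lambda>z. f' z - g' z"] conjI continuous_on_diff ballI)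
      (auto simp: scaleC.scale_right_diff_distrib intro!: has_derivative_diff)
qed

lemma vholo_scaleC:
  assumes "h holomorphic_on U" "open U" "S \<subseteq> U" "vholo g S"
  shows "vholo (\<lambda>z. h z *\<^sub>C g z) S"
proof -
  obtain g' where g': "continuous_on S g'"
    "\<And>z. z \<in> S \<Longrightarrow> (g has_derivative (\<lambda>h. h *\<^sub>C g' z)) (at z within S)"
    using assms(4) unfolding vholo_def by blast
  have ch: "continuous_on S h" "continuous_on S (deriv h)"
    using assms holomorphic_on_imp_continuous_on holomorphic_deriv continuous_on_subset by blast+
  have dh: "(h has_derivative (\<lambda>d. deriv h z * d)) (at z within S)" if "z \<in> S" for z
    using assms that holomorphic_derivI[OF assms(1,2)] has_field_derivative_at_within
    unfolding has_field_derivative_def by (metis subsetD)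
  have "((\<lambda>z. h z *\<^sub>C g z) has_derivative (\<lambda>d. d *\<^sub>C (h z *\<^sub>C g' z + deriv h z *\<^sub>C g z))) (at z within S)"
    if "z \<in> S" for z
    by (rule has_derivative_eq_rhs[OF has_derivative_scaleC[OF dh[OF that] g'(2)[OF that]]])
      (auto simp: scaleC_add_right scaleC_scaleC mult.commute)
  then show ?thesis
    unfolding vholo_def
    by (intro exI[of _ "\<lambda>z. h z *\<^sub>C g' z + deriv h z *\<^sub>C g z"] conjI ballI continuous_on_add
        continuous_on_scaleC ch g'(1) vholo_continuous_on[OF assms(4)])
qed

section \<open>Wedges and complements of sectors\<close>

text \<open>Angles are parameters rather than values of \<open>Arg\<close>, so a wedge can reach the
  negative axis from above or, with \<open>- pi\<close>, from below.\<close>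

definition wedge :: "real \<Rightarrow> real \<Rightarrow> complex set" where
  "wedge \<theta>1 \<theta>2 = {rcis r \<theta> | r \<theta>. 0 < r \<and> \<theta>1 \<le> \<theta> \<and> \<theta> \<le> \<theta>2}"

lemma rcis_in_wedge: "0 < r \<Longrightarrow> \<theta>1 \<le> \<theta> \<Longrightarrow> \<theta> \<le> \<theta>2 \<Longrightarrow> rcis r \<theta> \<in> wedge \<theta>1 \<theta>2"
  unfolding wedge_def by blast

lemma wedge_mono: "\<alpha> \<le> \<theta>1 \<Longrightarrow> \<theta>2 \<le> \<beta> \<Longrightarrow> wedge \<theta>1 \<theta>2 \<subseteq> wedge \<alpha> \<beta>"
  unfolding wedge_def by fastforce

lemma rcis_in_sector: "0 < r \<Longrightarrow> \<bar>\<theta>\<bar> < \<phi> \<Longrightarrow> \<phi> \<le> pi \<Longrightarrow> rcis r \<theta> \<in> sector \<phi>"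
  by (auto simp: sector_def Arg_rcis abs_less_iff)

lemma wedge_subset_sector:
  assumes "- \<phi> < \<theta>1" "\<theta>2 < \<phi>" "\<phi> \<le> pi"
  shows "wedge \<theta>1 \<theta>2 \<subseteq> sector \<phi>"
  using assms by (auto simp: wedge_def sector_def Arg_rcis)

definition far :: "real \<Rightarrow> complex set" where
  "far \<psi> = {z. z \<noteq> 0 \<and> \<psi> \<le> \<bar>Arg z\<bar>}"

lemma rcis_minus_pi: "rcis r (- pi) = rcis r pi"
  by (simp add: rcis_def complex_eq_iff)

lemma cis_minus_pi: "cis (- pi) = cis pi"
  by (simp add: complex_eq_iff)

lemma rcis_in_far:
  assumes "0 < r" "\<psi> \<le> \<bar>\<theta>\<bar>" "\<bar>\<theta>\<bar> \<le> pi"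
  shows "rcis r \<theta> \<in> far \<psi>"
\<comment> \<open>\<open>Arg\<close> takes the value \<open>pi\<close> on the negative axis, so the
  ray of angle \<open>- pi\<close> is treated as the one of angle \<open>pi\<close>.\<close>
proof (cases "\<theta> = - pi")
  case True
  then show ?thesis using assms Arg_rcis[of pi r] by (auto simp: far_def rcis_minus_pi)
next
  case False
  then show ?thesis using assms Arg_rcis[of \<theta> r] by (auto simp: far_def abs_le_iff)
qed

lemma wedge_subset_far:
  assumes "0 \<le> \<psi>" "\<psi> \<le> \<theta>1" "\<theta>2 \<le> pi"
  shows "wedge \<theta>1 \<theta>2 \<subseteq> far \<psi>" "wedge (- \<theta>2) (- \<theta>1) \<subseteq> far \<psi>"
  using assms by (auto simp: wedge_def intro!: rcis_in_far)

section \<open>Truncated ray integrals and Cauchy's theorem between rays\<close>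

abbreviation window :: "nat \<Rightarrow> real set" where "window n \<equiv> {1 / real (Suc n)..real (Suc n)}"

definition ray_part :: "(complex \<Rightarrow> 'a::complex_banach) \<Rightarrow> real \<Rightarrow> nat \<Rightarrow> 'a" where
  "ray_part g \<theta> n = integral (window n) (\<lambda>r. cis \<theta> *\<^sub>C g (rcis r \<theta>))"

lemma Suc_interval: "0 < 1 / real (Suc n)" "1 / real (Suc n) \<le> real (Suc n)"
  by (simp_all add: field_simps)

lemma inverse_Suc_tendsto_0: "(\<lambda>n. 1 / real (Suc n)) \<longlonglongrightarrow> 0"
  using LIMSEQ_inverse_real_of_nat by (simp add: inverse_eq_divide)

lemma continuous_on_rcis_r: "continuous_on S (\<lambda>r. rcis r \<theta>)"
  unfolding rcis_def by (intro continuous_intros)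

lemma continuous_on_ray:
  assumes "continuous_on S g" "\<And>r. r \<in> I \<Longrightarrow> rcis r \<theta> \<in> S"
  shows "continuous_on I (\<lambda>r. g (rcis r \<theta>))"
  using continuous_on_compose2[OF assms(1) continuous_on_rcis_r] assms(2) by blast

text \<open>The left-hand side is \<open>\<integral>\<integral> \<partial>\<^sub>\<theta>(e\<^sup>i\<^sup>\<theta> g)\<close>, the bound comes from \<open>\<integral>\<integral> \<partial>\<^sub>r(i r e\<^sup>i\<^sup>\<theta> g)\<close>, and both integrands agree.\<close>

lemma ray_integral_difference:
  fixes g :: "complex \<Rightarrow> 'a::complex_banach"
  assumes g: "vholo g (wedge \<theta>1 \<theta>2)" and "0 < a" "a \<le> b" "\<theta>1 \<le> \<theta>2"
    and Ba: "\<And>\<theta>. \<theta>1 \<le> \<theta> \<Longrightarrow> \<theta> \<le> \<theta>2 \<Longrightarrow> a * norm (g (rcis a \<theta>)) \<le> Ba"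
    and Bb: "\<And>\<theta>. \<theta>1 \<le> \<theta> \<Longrightarrow> \<theta> \<le> \<theta>2 \<Longrightarrow> b * norm (g (rcis b \<theta>)) \<le> Bb"
  shows "norm (integral {a..b} (\<lambda>r. cis \<theta>2 *\<^sub>C g (rcis r \<theta>2)) - integral {a..b} (\<lambda>r. cis \<theta>1 *\<^sub>C g (rcis r \<theta>1)))
    \<le> (\<theta>2 - \<theta>1) * (Ba + Bb)"
proof -
  let ?W = "wedge \<theta>1 \<theta>2"
  obtain g' where g'c: "continuous_on ?W g'"
    and g': "\<And>z. z \<in> ?W \<Longrightarrow> (g has_derivative (\<lambda>h. h *\<^sub>C g' z)) (at z within ?W)"
    using g unfolding vholo_def by blast
  have gc: "continuous_on ?W g" by (rule vholo_continuous_on[OF g])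
  define F where "F = (\<lambda>r \<theta>. (\<i> * cis \<theta>) *\<^sub>C (g (rcis r \<theta>) + rcis r \<theta> *\<^sub>C g' (rcis r \<theta>)))"
  have W: "rcis r \<theta> \<in> ?W" if "a \<le> r" "\<theta>1 \<le> \<theta>" "\<theta> \<le> \<theta>2" for r \<theta>
    using that \<open>0 < a\<close> by (intro rcis_in_wedge) auto
  have dR: "((\<lambda>r. (\<i> * rcis r \<theta>) *\<^sub>C g (rcis r \<theta>)) has_vector_derivative F r \<theta>) (at r within {a..b})"
    if "r \<in> {a..b}" "\<theta> \<in> {\<theta>1..\<theta>2}" for r \<theta>
  proof -
    have 1: "((\<lambda>r. rcis r \<theta>) has_derivative (\<lambda>h. of_real h * cis \<theta>)) (at r within {a..b})"
      unfolding rcis_def by (auto intro!: derivative_eq_intros)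
    have 2: "((\<lambda>r. g (rcis r \<theta>)) has_derivative (\<lambda>h. (of_real h * cis \<theta>) *\<^sub>C g' (rcis r \<theta>))) (at r within {a..b})"
      using that W by (intro has_derivative_in_compose2[OF g' _ _ 1]) auto
    have 3: "((\<lambda>r. \<i> * rcis r \<theta>) has_derivative (\<lambda>h. \<i> * (of_real h * cis \<theta>))) (at r within {a..b})"
      using 1 by (auto intro!: derivative_eq_intros)
    show ?thesis
      unfolding has_vector_derivative_def
      by (rule has_derivative_eq_rhs[OF has_derivative_scaleC[OF 3 2]])
        (auto simp: F_def scaleC_add_right scaleC_scaleC scaleR_eq_scaleC algebra_simps)
  qed
  have dT: "((\<lambda>\<theta>. cis \<theta> *\<^sub>C g (rcis r \<theta>)) has_vector_derivative F r \<theta>) (at \<theta> within {\<theta>1..\<theta>2})"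
    if "r \<in> {a..b}" "\<theta> \<in> {\<theta>1..\<theta>2}" for r \<theta>
  proof -
    have 0: "(cis has_derivative (\<lambda>h. of_real h * (\<i> * cis \<theta>))) (at \<theta> within {\<theta>1..\<theta>2})"
    proof -
      have "((\<lambda>\<theta>. exp (\<i> * of_real \<theta>)) has_vector_derivative (\<i> * exp (\<i> * of_real \<theta>))) (at \<theta> within {\<theta>1..\<theta>2})"
        by (rule derivative_eq_intros has_vector_derivative_real_field refl | simp)+
      then show ?thesis
        by (simp add: has_vector_derivative_def cis_conv_exp[abs_def] scaleR_conv_of_real)
    qed
    have 1: "((\<lambda>\<theta>. rcis r \<theta>) has_derivative (\<lambda>h. of_real r * (of_real h * (\<i> * cis \<theta>)))) (at \<theta> within {\<theta>1..\<theta>2})"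
      unfolding rcis_def by (rule has_derivative_mult_right[OF 0])
    have 2: "((\<lambda>\<theta>. g (rcis r \<theta>)) has_derivative (\<lambda>h. (of_real r * (of_real h * (\<i> * cis \<theta>))) *\<^sub>C g' (rcis r \<theta>))) (at \<theta> within {\<theta>1..\<theta>2})"
      using that W by (intro has_derivative_in_compose2[OF g' _ _ 1]) auto
    show ?thesis
      unfolding has_vector_derivative_def
      by (rule has_derivative_eq_rhs[OF has_derivative_scaleC[OF 0 2]])
        (auto simp: F_def scaleC_add_right scaleC_scaleC scaleR_eq_scaleC rcis_def algebra_simps)
  qed
  have rc: "continuous_on (cbox (a,\<theta>1) (b,\<theta>2)) (\<lambda>p. rcis (fst p) (snd p))"
    unfolding rcis_def by (intro continuous_intros)
  have Fc: "continuous_on (cbox (a,\<theta>1) (b,\<theta>2)) (\<lambda>(r, \<theta>). F r \<theta>)"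
    unfolding F_def split_beta
    using W by (intro continuous_intros rc continuous_on_compose2[OF gc rc] continuous_on_compose2[OF g'c rc])
       (auto simp: cbox_Pair_eq)
  have rayc: "continuous_on {a..b} (\<lambda>r. cis \<theta> *\<^sub>C g (rcis r \<theta>))" if "\<theta> \<in> {\<theta>1..\<theta>2}" for \<theta>
    using that W by (intro continuous_intros continuous_on_ray[OF gc]) auto
  have "integral {a..b} (\<lambda>r. cis \<theta>2 *\<^sub>C g (rcis r \<theta>2)) - integral {a..b} (\<lambda>r. cis \<theta>1 *\<^sub>C g (rcis r \<theta>1))
      = integral {a..b} (\<lambda>r. cis \<theta>2 *\<^sub>C g (rcis r \<theta>2) - cis \<theta>1 *\<^sub>C g (rcis r \<theta>1))"
    using rayc \<open>\<theta>1 \<le> \<theta>2\<close> by (intro integral_diff[symmetric] integrable_continuous_real) auto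
  also have "\<dots> = integral {a..b} (\<lambda>r. integral {\<theta>1..\<theta>2} (F r))"
    using dT \<open>\<theta>1 \<le> \<theta>2\<close> by (intro integral_cong integral_unique[symmetric] fundamental_theorem_of_calculus) auto
  also have "\<dots> = integral {\<theta>1..\<theta>2} (\<lambda>\<theta>. integral {a..b} (\<lambda>r. F r \<theta>))"
    using integral_swap_continuous[OF Fc] by simp
  also have "\<dots> = integral {\<theta>1..\<theta>2} (\<lambda>\<theta>. (\<i> * rcis b \<theta>) *\<^sub>C g (rcis b \<theta>) - (\<i> * rcis a \<theta>) *\<^sub>C g (rcis a \<theta>))"
    using dR \<open>a \<le> b\<close> by (intro integral_cong integral_unique fundamental_theorem_of_calculus) auto
  also have "norm \<dots> \<le> (Ba + Bb) * (\<theta>2 - \<theta>1)"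
  proof (rule integral_bound[OF \<open>\<theta>1 \<le> \<theta>2\<close>])
    have tc: "continuous_on {\<theta>1..\<theta>2} (rcis r)" for r
      unfolding rcis_def[abs_def] by (intro continuous_intros)
    show "continuous_on {\<theta>1..\<theta>2} (\<lambda>\<theta>. (\<i> * rcis b \<theta>) *\<^sub>C g (rcis b \<theta>) - (\<i> * rcis a \<theta>) *\<^sub>C g (rcis a \<theta>))"
      using W \<open>a \<le> b\<close> by (intro continuous_intros tc continuous_on_compose2[OF gc tc]) auto
    fix \<theta> assume \<theta>: "\<theta> \<in> {\<theta>1..\<theta>2}"
    have "norm ((\<i> * rcis b \<theta>) *\<^sub>C g (rcis b \<theta>) - (\<i> * rcis a \<theta>) *\<^sub>C g (rcis a \<theta>))
       \<le> norm ((\<i> * rcis b \<theta>) *\<^sub>C g (rcis b \<theta>)) + norm ((\<i> * rcis a \<theta>) *\<^sub>C g (rcis a \<theta>))"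
      by (rule norm_triangle_ineq4)
    also have "\<dots> \<le> Bb + Ba"
      using Ba[of \<theta>] Bb[of \<theta>] \<theta> \<open>0 < a\<close> \<open>a \<le> b\<close> by (intro add_mono) (auto simp: norm_scaleC norm_mult)
    finally show "norm ((\<i> * rcis b \<theta>) *\<^sub>C g (rcis b \<theta>) - (\<i> * rcis a \<theta>) *\<^sub>C g (rcis a \<theta>)) \<le> Ba + Bb" by simp
  qed
  finally show ?thesis by (simp add: mult.commute)
qed

text \<open>Outwards along the lower ray and inwards along the upper one, without the factor 1/(2 pi
  i). Both rays are cut at the same radii and only the difference has to converge, which permits
  exact cancellation on the negative axis.\<close>

definition contour_limit :: "(complex \<Rightarrow> 'a::complex_banach) \<Rightarrow> real \<Rightarrow> 'a \<Rightarrow> bool" where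
  "contour_limit g \<psi> v \<longleftrightarrow> (\<lambda>n. ray_part g (- \<psi>) n - ray_part g \<psi> n) \<longlonglongrightarrow> v"

text \<open>An arc of radius |z| has length proportional to |z|, so these bounds make the arcs at
  both ends of \<open>window n\<close> negligible, uniformly in the angle. Only radii that occur as
  cut-offs are tested.\<close>

definition small_ends :: "(complex \<Rightarrow> 'a::real_normed_vector) \<Rightarrow> complex set \<Rightarrow> bool" where
  "small_ends g S \<longleftrightarrow> (\<exists>\<alpha> \<beta>. \<alpha> \<longlonglongrightarrow> (0::real) \<and> \<beta> \<longlonglongrightarrow> (0::real) \<and>
     (\<forall>n z. z \<in> S \<longrightarrow> cmod z = 1 / real (Suc n) \<longrightarrow> cmod z * norm (g z) \<le> \<alpha> n) \<and>
     (\<forall>n z. z \<in> S \<longrightarrow> cmod z = real (Suc n) \<longrightarrow> cmod z * norm (g z) \<le> \<beta> n))"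

lemma small_ends_subset: "small_ends g S \<Longrightarrow> T \<subseteq> S \<Longrightarrow> small_ends g T"
  unfolding small_ends_def by (meson subsetD)

lemma ray_part_shift:
  assumes g: "vholo g (wedge \<theta>1 \<theta>2)" and le: "\<theta>1 \<le> \<theta>2" and s: "small_ends g (wedge \<theta>1 \<theta>2)"
  shows "(\<lambda>n. ray_part g \<theta>2 n - ray_part g \<theta>1 n) \<longlonglongrightarrow> 0"
proof -
  obtain \<alpha> \<beta> where *: "\<alpha> \<longlonglongrightarrow> (0::real)" "\<beta> \<longlonglongrightarrow> (0::real)"
     "\<And>n z. z \<in> wedge \<theta>1 \<theta>2 \<Longrightarrow> cmod z = 1 / real (Suc n) \<Longrightarrow> cmod z * norm (g z) \<le> \<alpha> n"
     "\<And>n z. z \<in> wedge \<theta>1 \<theta>2 \<Longrightarrow> cmod z = real (Suc n) \<Longrightarrow> cmod z * norm (g z) \<le> \<beta> n"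
    using s unfolding small_ends_def by blast
  show ?thesis
  proof (rule Lim_null_comparison)
    show "\<forall>\<^sub>F n in sequentially. norm (ray_part g \<theta>2 n - ray_part g \<theta>1 n) \<le> (\<theta>2 - \<theta>1) * (\<alpha> n + \<beta> n)"
    proof (intro always_eventually allI)
      fix n
      show "norm (ray_part g \<theta>2 n - ray_part g \<theta>1 n) \<le> (\<theta>2 - \<theta>1) * (\<alpha> n + \<beta> n)"
        unfolding ray_part_def
        using *(3)[of "rcis (1 / real (Suc n)) _" n] *(4)[of "rcis (real (Suc n)) _" n]
        by (intro ray_integral_difference[OF g Suc_interval le]) (auto simp: rcis_in_wedge simp del: of_nat_Suc)
    qed
    show "(\<lambda>n. (\<theta>2 - \<theta>1) * (\<alpha> n + \<beta> n)) \<longlonglongrightarrow> 0"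
      using tendsto_mult[OF tendsto_const tendsto_add[OF *(1,2)]] by simp
  qed
qed

text \<open>Cauchy's theorem for both rays at once: the upper ray moves within one wedge, the lower
  ray within its mirror image, and the arcs vanish by \<open>small_ends\<close>.\<close>

lemma contour_limit_shift:
  assumes g: "vholo g S" and s: "small_ends g S" and S: "wedge \<alpha> \<beta> \<subseteq> S" "wedge (- \<beta>) (- \<alpha>) \<subseteq> S"
    and \<psi>: "\<alpha> \<le> \<psi>1" "\<alpha> \<le> \<psi>2" "\<psi>1 \<le> \<beta>" "\<psi>2 \<le> \<beta>" and l: "contour_limit g \<psi>1 v"
  shows "contour_limit g \<psi>2 v"
proof -
  have up: "(\<lambda>n. ray_part g \<theta>2 n - ray_part g \<theta>1 n) \<longlonglongrightarrow> 0"
    "(\<lambda>n. ray_part g (- \<theta>1) n - ray_part g (- \<theta>2) n) \<longlonglongrightarrow> 0"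
    if "\<alpha> \<le> \<theta>1" "\<theta>1 \<le> \<theta>2" "\<theta>2 \<le> \<beta>" for \<theta>1 \<theta>2
  proof -
    have "wedge \<theta>1 \<theta>2 \<subseteq> S" "wedge (- \<theta>2) (- \<theta>1) \<subseteq> S"
      using S wedge_mono[of \<alpha> \<theta>1 \<theta>2 \<beta>] wedge_mono[of "- \<beta>" "- \<theta>2" "- \<theta>1" "- \<alpha>"] that by auto
    then show "(\<lambda>n. ray_part g \<theta>2 n - ray_part g \<theta>1 n) \<longlonglongrightarrow> 0"
      "(\<lambda>n. ray_part g (- \<theta>1) n - ray_part g (- \<theta>2) n) \<longlonglongrightarrow> 0"
      using that by (auto intro!: ray_part_shift vholo_subset[OF g] small_ends_subset[OF s])
  qed
  have "(\<lambda>n. ray_part g \<psi>2 n - ray_part g \<psi>1 n) \<longlonglongrightarrow> 0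
      \<and> (\<lambda>n. ray_part g (- \<psi>2) n - ray_part g (- \<psi>1) n) \<longlonglongrightarrow> 0"
  proof (cases "\<psi>1 \<le> \<psi>2")
    case True
    then show ?thesis using up(1)[of \<psi>1 \<psi>2] tendsto_minus[OF up(2)[of \<psi>1 \<psi>2]] \<psi> by simp
  next
    case False
    then show ?thesis using up(2)[of \<psi>2 \<psi>1] tendsto_minus[OF up(1)[of \<psi>2 \<psi>1]] \<psi> by simp
  qed
  then have "(\<lambda>n. (ray_part g (- \<psi>1) n - ray_part g \<psi>1 n) + ((ray_part g (- \<psi>2) n - ray_part g (- \<psi>1) n)
     - (ray_part g \<psi>2 n - ray_part g \<psi>1 n))) \<longlonglongrightarrow> v + (0 - 0)"
    using l unfolding contour_limit_def by (intro tendsto_intros) auto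
  then show ?thesis unfolding contour_limit_def by (simp add: algebra_simps)
qed

text \<open>Both rays are turned onto the negative axis, where the angles \<open>pi\<close> and
  \<open>- pi\<close> give the same ray and the truncated parts cancel for every n.\<close>

lemma contour_limit_outside:
  assumes g: "vholo g (far \<psi>)" and s: "small_ends g (far \<psi>)" and \<psi>: "0 \<le> \<psi>" "\<psi> \<le> pi"
  shows "contour_limit g \<psi> 0"
proof (rule contour_limit_shift[OF g s wedge_subset_far[OF \<psi>(1), of \<psi> pi]])
  show "contour_limit g pi 0"
    by (simp add: contour_limit_def ray_part_def rcis_minus_pi cis_minus_pi)
qed (use \<psi> in auto)

text \<open>The upper ray is turned through the positive axis onto the lower one, inside the
  sector.\<close>

lemma contour_limit_inside:
  assumes g: "vholo g (sector \<phi>)" and s: "small_ends g (sector \<phi>)"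
    and \<psi>: "0 \<le> \<psi>" "\<psi> < \<phi>" "\<phi> \<le> pi"
  shows "contour_limit g \<psi> 0"
proof -
  have "wedge (- \<psi>) \<psi> \<subseteq> sector \<phi>" using \<psi> by (intro wedge_subset_sector) auto
  then have "(\<lambda>n. - (ray_part g \<psi> n - ray_part g (- \<psi>) n)) \<longlonglongrightarrow> - 0"
    using \<psi> by (intro tendsto_minus ray_part_shift vholo_subset[OF g] small_ends_subset[OF s]) auto
  then show ?thesis by (simp add: contour_limit_def)
qed

lemma ray_part_integrable:
  fixes g :: "complex \<Rightarrow> 'a::complex_banach"
  assumes "continuous_on S g" "\<And>r. 0 < r \<Longrightarrow> rcis r \<theta> \<in> S"
  shows "(\<lambda>r. cis \<theta> *\<^sub>C g (rcis r \<theta>)) integrable_on window n"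
proof (intro integrable_continuous_real continuous_on_scaleC continuous_on_const continuous_on_ray[OF assms(1)])
  fix r assume "r \<in> window n"
  then show "rcis r \<theta> \<in> S" using less_le_trans[OF Suc_interval(1)[of n], of r] by (intro assms(2)) auto
qed

lemma ray_part_cong:
  assumes "\<And>r. 0 < r \<Longrightarrow> f (rcis r \<theta>) = g (rcis r \<theta>)"
  shows "ray_part f \<theta> n = ray_part g \<theta> n"
  unfolding ray_part_def
proof (rule integral_cong)
  fix r assume "r \<in> window n"
  then show "cis \<theta> *\<^sub>C f (rcis r \<theta>) = cis \<theta> *\<^sub>C g (rcis r \<theta>)"
    using less_le_trans[OF Suc_interval(1)[of n], of r] assms by auto
qed

lemma contour_limit_add:
  assumes c: "continuous_on S f" "continuous_on S g" and S: "\<And>r. 0 < r \<Longrightarrow> rcis r \<psi> \<in> S \<and> rcis r (- \<psi>) \<in> S"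
    and l: "contour_limit f \<psi> u" "contour_limit g \<psi> v"
  shows "contour_limit (\<lambda>z. f z + g z) \<psi> (u + v)"
proof -
  have "ray_part (\<lambda>z. f z + g z) \<theta> n = ray_part f \<theta> n + ray_part g \<theta> n" if "\<theta> = \<psi> \<or> \<theta> = - \<psi>" for \<theta> n
    unfolding ray_part_def scaleC_add_right
    using that S by (intro integral_add ray_part_integrable[OF c(1)] ray_part_integrable[OF c(2)]) auto
  then show ?thesis
    using tendsto_add[OF l[unfolded contour_limit_def]] by (simp add: contour_limit_def algebra_simps)
qed

lemma contour_limit_linear:
  assumes c: "continuous_on S g" and S: "\<And>r. 0 < r \<Longrightarrow> rcis r \<psi> \<in> S \<and> rcis r (- \<psi>) \<in> S"
    and L: "bounded_linear L" "\<And>a x. L (a *\<^sub>C x) = a *\<^sub>C L x" and l: "contour_limit g \<psi> v"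
  shows "contour_limit (\<lambda>z. L (g z)) \<psi> (L v)"
proof -
  have "ray_part (\<lambda>z. L (g z)) \<theta> n = L (ray_part g \<theta> n)" if "\<theta> = \<psi> \<or> \<theta> = - \<psi>" for \<theta> n
    unfolding ray_part_def using that S integral_linear[OF ray_part_integrable[OF c] L(1), of \<theta> n]
    by (auto simp: o_def L(2))
  then show ?thesis
    using bounded_linear.tendsto[OF L(1) l[unfolded contour_limit_def]]
    by (simp add: contour_limit_def bounded_linear.linear[OF L(1)] linear_diff)
qed

lemma contour_limit_cong:
  assumes "\<And>z. z \<in> S \<Longrightarrow> f z = g z" and S: "\<And>r. 0 < r \<Longrightarrow> rcis r \<psi> \<in> S \<and> rcis r (- \<psi>) \<in> S"
    and l: "contour_limit f \<psi> v"
  shows "contour_limit g \<psi> v"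
proof -
  have "ray_part f \<theta> n = ray_part g \<theta> n" if "\<theta> = \<psi> \<or> \<theta> = - \<psi>" for \<theta> n
    using that S by (intro ray_part_cong assms(1)) auto
  then show ?thesis using l by (simp add: contour_limit_def)
qed

lemma contour_limit_unique: "contour_limit g \<psi> u \<Longrightarrow> contour_limit g \<psi> v \<Longrightarrow> u = v"
  unfolding contour_limit_def by (rule LIMSEQ_unique)

text \<open>|z|/(1 + |z|)^2 is at most |z| and at most 1/|z|, so quadratic decay handles both
  ends.\<close>

lemma small_endsI:
  assumes "\<And>z. z \<in> S \<Longrightarrow> norm (g z) \<le> M / (1 + cmod z)^2"
  shows "small_ends g S"
  unfolding small_ends_def
proof (intro exI conjI allI impI)
  let ?M = "\<bar>M\<bar>"
  show "(\<lambda>n. ?M * (1 / real (Suc n))) \<longlonglongrightarrow> 0"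
    by (rule tendsto_mult_right_zero[OF inverse_Suc_tendsto_0])
  then show "(\<lambda>n. ?M * (1 / real (Suc n))) \<longlonglongrightarrow> 0" .
  have *: "cmod z * norm (g z) \<le> ?M * cmod z / (1 + cmod z)^2" if "z \<in> S" for z
  proof -
    have "cmod z * norm (g z) \<le> cmod z * (?M / (1 + cmod z)^2)"
      by (rule mult_left_mono[OF order_trans[OF assms[OF that] divide_right_mono]]) auto
    then show ?thesis by (simp add: mult.commute)
  qed
  fix n z assume z: "z \<in> S"
  { assume r: "cmod z = 1 / real (Suc n)"
    have "?M * cmod z / (1 + cmod z)^2 \<le> ?M * cmod z / 1"
      by (rule divide_left_mono) (auto simp: add_nonneg_eq_0_iff)
    then show "cmod z * norm (g z) \<le> ?M * (1 / real (Suc n))" using *[OF z] r by simp }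
  { assume r: "cmod z = real (Suc n)"
    have "cmod z / (1 + cmod z)^2 \<le> 1 / real (Suc n)"
      unfolding r by (simp add: divide_simps power2_eq_square del: of_nat_Suc) (simp add: algebra_simps)
    from mult_left_mono[OF this, of ?M]
    show "cmod z * norm (g z) \<le> ?M * (1 / real (Suc n))" using *[OF z] by simp }
qed

section \<open>Sectors, resolvents and the \<open>K\<close>-functional\<close>

abbreviation pole :: "real \<Rightarrow> complex" where "pole t \<equiv> complex_of_real (- 1 / t)"

lemma Re_eq_cos_Arg: "Re z = cmod z * cos (Arg z)"
  by (cases "z = 0") (simp_all add: cos_Arg)

lemma cos_le_cos_abs_Arg: "\<bar>Arg z\<bar> \<le> \<psi> \<Longrightarrow> \<psi> \<le> pi \<Longrightarrow> cos \<psi> \<le> cos (Arg z)"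
  by (metis abs_ge_zero cos_abs_real cos_monotone_0_pi_le)

lemma cos_abs_Arg_le: "\<psi> \<le> \<bar>Arg z\<bar> \<Longrightarrow> 0 \<le> \<psi> \<Longrightarrow> cos (Arg z) \<le> cos \<psi>"
  using cos_monotone_0_pi_le[of \<psi> "\<bar>Arg z\<bar>"] Arg_bounded[of z] by (auto simp: cos_abs_real abs_le_iff)

text \<open>\<open>Arg\<close> jumps across the negative axis, so the closed set is described by |z|
  cos \<phi> \<le> Re z, which for nonzero z forces |Arg z| \<le> \<phi>.\<close>

lemma closure_sector_subset:
  assumes "0 \<le> \<phi>" "\<phi> < pi"
  shows "closure (sector \<phi>) \<subseteq> {z. z = 0 \<or> \<bar>Arg z\<bar> \<le> \<phi>}"
proof -
  let ?C = "{z. cmod z * cos \<phi> \<le> Re z}"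
  have "closed ?C" by (intro closed_Collect_le continuous_intros)
  moreover have "sector \<phi> \<subseteq> ?C"
    using cos_le_cos_abs_Arg[of _ \<phi>] assms
    by (auto simp: sector_def Re_eq_cos_Arg intro!: mult_left_mono)
  ultimately have "closure (sector \<phi>) \<subseteq> ?C" by (rule closure_minimal[rotated])
  moreover have "\<bar>Arg z\<bar> \<le> \<phi>" if "z \<in> ?C" "z \<noteq> 0" for z
  proof (rule ccontr)
    assume "\<not> \<bar>Arg z\<bar> \<le> \<phi>"
    then have "cos \<bar>Arg z\<bar> < cos \<phi>"
      using assms Arg_bounded[of z] by (intro cos_monotone_0_pi) (auto simp: abs_le_iff)
    then show False using that by (auto simp: Re_eq_cos_Arg cos_abs_real)
  qed
  ultimately show ?thesis by blast
qed

text \<open>Rests on 1 - 2 k r + r^2 = (1 - k)/2 (1 + r)^2 + (1 + k)/2 (1 - r)^2 with r = |w|; the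
  second square is dropped.\<close>

lemma one_plus_lower_aux:
  fixes w :: complex
  assumes "- k * cmod w \<le> Re w" "- 1 \<le> k" "k \<le> 1"
  shows "sqrt ((1 - k) / 2) * (1 + cmod w) \<le> cmod (1 + w)"
proof (rule power2_le_imp_le)
  have "(sqrt ((1 - k) / 2) * (1 + cmod w))\<^sup>2 = (1 - k) / 2 * (1 + cmod w)\<^sup>2"
    using assms by (simp add: power_mult_distrib)
  also have "\<dots> \<le> (1 - k) / 2 * (1 + cmod w)\<^sup>2 + (1 + k) / 2 * (1 - cmod w)\<^sup>2"
    using assms by simp
  also have "\<dots> = 1 + 2 * (- k * cmod w) + (cmod w)\<^sup>2"
    by (simp add: power2_eq_square field_simps)
  also have "\<dots> \<le> 1 + 2 * Re w + (cmod w)\<^sup>2"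
    using assms by (intro add_mono mult_left_mono) auto
  also have "\<dots> = (cmod (1 + w))\<^sup>2"
    unfolding cmod_power2 by (simp add: power2_eq_square algebra_simps)
  finally show "(sqrt ((1 - k) / 2) * (1 + cmod w))\<^sup>2 \<le> (cmod (1 + w))\<^sup>2" .
qed simp

text \<open>The constant is cos(\<phi>/2). It is uniform in t because positive scaling leaves the
  argument unchanged, and this uniformity carries the final estimate.\<close>

lemma one_plus_lower:
  assumes "0 \<le> \<phi>" "\<phi> < pi"
  obtains c where "0 < c" "\<And>z t. z \<in> sector \<phi> \<Longrightarrow> 0 \<le> t \<Longrightarrow> c * (1 + t * cmod z) \<le> cmod (1 + of_real t * z)"
proof
  have "cos pi < cos \<phi>" using assms by (intro cos_monotone_0_pi) auto
  then show "0 < sqrt ((1 - (- cos \<phi>)) / 2)" by simp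
  fix z and t :: real assume z: "z \<in> sector \<phi>" and t: "0 \<le> t"
  have "cos \<phi> \<le> cos (Arg z)" using z assms cos_le_cos_abs_Arg[of z \<phi>] by (simp add: sector_def)
  from mult_left_mono[OF this norm_ge_zero] have "cmod z * cos \<phi> \<le> Re z"
    by (simp only: Re_eq_cos_Arg[of z])
  from mult_left_mono[OF this t] have le: "- (- cos \<phi>) * (t * cmod z) \<le> t * Re z"
    by (simp add: algebra_simps)
  have "cmod (of_real t * z) = t * cmod z" "Re (of_real t * z) = t * Re z"
    using t by (simp_all add: norm_mult)
  then show "sqrt ((1 - (- cos \<phi>)) / 2) * (1 + t * cmod z) \<le> cmod (1 + of_real t * z)"
    using one_plus_lower_aux[of "- cos \<phi>" "of_real t * z"] le by (metis cos_ge_minus_one cos_le_one minus_minus neg_le_iff_le)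
qed

text \<open>The same inequality at w = - z, with the constant sin(\<psi>/2).\<close>

lemma minus_one_lower:
  assumes "0 < \<psi>" "\<psi> \<le> pi"
  obtains c where "0 < c" "\<And>z. z \<in> far \<psi> \<Longrightarrow> c * (1 + cmod z) \<le> cmod (z - 1)"
proof
  have "cos \<psi> < cos 0" using assms by (intro cos_monotone_0_pi) auto
  then show "0 < sqrt ((1 - cos \<psi>) / 2)" by simp
  fix z assume z: "z \<in> far \<psi>"
  have "cos (Arg z) \<le> cos \<psi>" using z assms cos_abs_Arg_le[of \<psi> z] by (simp add: far_def)
  from mult_left_mono[OF this norm_ge_zero] have "Re z \<le> cmod z * cos \<psi>"
    by (simp only: Re_eq_cos_Arg[of z])
  then show "sqrt ((1 - cos \<psi>) / 2) * (1 + cmod z) \<le> cmod (z - 1)"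
    using one_plus_lower_aux[of "cos \<psi>" "- z"] by (simp add: norm_minus_commute[of z 1] algebra_simps)
qed

section \<open>Resolvents and bounded complex-linear operators\<close>

lemma resolvent_in:
  assumes "z \<in> resolvent_set V N D B" "x \<in> V"
  shows "resolvent D B z x \<in> D" "z *\<^sub>C resolvent D B z x - B (resolvent D B z x) = x"
  using assms f_inv_into_f[of x "\<lambda>x. z *\<^sub>C x - B x" D] inv_into_into[of x "\<lambda>x. z *\<^sub>C x - B x" D]
  unfolding resolvent_set_def resolvent_def bij_betw_def by blast+

lemma resolvent_eqI:
  assumes "z \<in> resolvent_set V N D B" "u \<in> D" "z *\<^sub>C u - B u = x"
  shows "resolvent D B z x = u"
  using assms inv_into_f_f[of "\<lambda>x. z *\<^sub>C x - B x" D u]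
  unfolding resolvent_set_def resolvent_def bij_betw_def by blast

text \<open>The bound is carried as an explicit constant because interpolation preserves it, see
  \<open>K_op\<close>.\<close>

definition cbounded :: "('a::complex_banach \<Rightarrow> 'a) \<Rightarrow> real \<Rightarrow> bool" where
  "cbounded T c \<longleftrightarrow> (\<forall>x y. T (x + y) = T x + T y) \<and> (\<forall>a x. T (a *\<^sub>C x) = a *\<^sub>C T x)
    \<and> (\<forall>x. norm (T x) \<le> c * norm x)"

lemma cboundedD:
  assumes "cbounded T c"
  shows "T (x + y) = T x + T y" "T (a *\<^sub>C x) = a *\<^sub>C T x" "norm (T x) \<le> c * norm x"
    "T (x - y) = T x - T y" "T 0 = 0" "T (- x) = - T x"
proof -
  show add: "T (x + y) = T x + T y" and sc: "T (a *\<^sub>C x) = a *\<^sub>C T x" and "norm (T x) \<le> c * norm x" for x y a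
    using assms by (auto simp: cbounded_def)
  show m: "T (- x) = - T x" for x using sc[of "-1" x] by (simp)
  show "T (x - y) = T x - T y" using add[of x "- y"] m by simp
  show "T 0 = 0" using sc[of 0 0] by simp
qed

lemma scaleC_eq_0_iff [simp]: "a *\<^sub>C x = 0 \<longleftrightarrow> a = 0 \<or> x = (0::'a::complex_banach)"
  using norm_scaleC[of a x] by auto

lemma scaleC_cancel: "a *\<^sub>C x = a *\<^sub>C y \<Longrightarrow> a \<noteq> 0 \<Longrightarrow> x = (y::'a::complex_banach)"
proof -
  assume "a *\<^sub>C x = a *\<^sub>C y" "a \<noteq> 0"
  then have "inverse a *\<^sub>C a *\<^sub>C x = inverse a *\<^sub>C a *\<^sub>C y" by simp
  then show "x = y" using \<open>a \<noteq> 0\<close> by (simp add: scaleC_scaleC)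
qed

lemma cbounded_bounded_linear: "cbounded T c \<Longrightarrow> bounded_linear T"
  by (rule bounded_linear_intro[of _ c]) (auto simp: cbounded_def scaleR_eq_scaleC mult.commute)

lemma cbounded_mono: "cbounded T c \<Longrightarrow> c \<le> d \<Longrightarrow> cbounded T d"
  unfolding cbounded_def by (meson mult_right_mono norm_ge_zero order_trans)

lemma cbounded_scaleC: "cbounded T c \<Longrightarrow> cbounded (\<lambda>x. a *\<^sub>C T x) (cmod a * c)"
  unfolding cbounded_def
proof (intro conjI allI)
  fix x
  assume "(\<forall>x y. T (x + y) = T x + T y) \<and> (\<forall>a x. T (a *\<^sub>C x) = a *\<^sub>C T x) \<and> (\<forall>x. norm (T x) \<le> c * norm x)"
  then show "norm (a *\<^sub>C T x) \<le> cmod a * c * norm x"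
    using mult_left_mono[of "norm (T x)" "c * norm x" "cmod a"] by (simp add: norm_scaleC mult.assoc)
qed (auto simp: scaleC_add_right scaleC_scaleC mult.commute)

lemma bounded_operator_UNIV_iff:
  "bounded_operator UNIV norm T \<longleftrightarrow> (\<exists>c. cbounded T c)"
  unfolding bounded_operator_def linear_operator_def cbounded_def by (auto simp: subspace_scaleC_iff)

locale invertible_op =
  fixes D :: "'a::complex_banach set" and A :: "'a \<Rightarrow> 'a"
  assumes lin: "linear_operator UNIV D A" and inv: "0 \<in> resolvent_set UNIV norm D A"
begin

abbreviation "\<rho> \<equiv> resolvent_set UNIV norm D A"
abbreviation "R \<equiv> resolvent D A"
abbreviation "K \<equiv> K_functional D A"

lemma D_closed: "0 \<in> D" "x \<in> D \<Longrightarrow> y \<in> D \<Longrightarrow> x + y \<in> D" "x \<in> D \<Longrightarrow> a *\<^sub>C x \<in> D"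
  "x \<in> D \<Longrightarrow> y \<in> D \<Longrightarrow> x - y \<in> D"
proof -
  show 1: "0 \<in> D" "x \<in> D \<Longrightarrow> y \<in> D \<Longrightarrow> x + y \<in> D" "x \<in> D \<Longrightarrow> a *\<^sub>C x \<in> D" for x y a
    using lin unfolding linear_operator_def subspace_scaleC_iff by blast+
  show "x \<in> D \<Longrightarrow> y \<in> D \<Longrightarrow> x - y \<in> D" using 1(2)[of x "- y"] 1(3)[of y "-1"] by simp
qed

lemma A_linear: "x \<in> D \<Longrightarrow> y \<in> D \<Longrightarrow> A (x + y) = A x + A y" "x \<in> D \<Longrightarrow> A (a *\<^sub>C x) = a *\<^sub>C A x"
  "x \<in> D \<Longrightarrow> y \<in> D \<Longrightarrow> A (x - y) = A x - A y" "A 0 = 0"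
proof -
  show 1: "x \<in> D \<Longrightarrow> y \<in> D \<Longrightarrow> A (x + y) = A x + A y" "x \<in> D \<Longrightarrow> A (a *\<^sub>C x) = a *\<^sub>C A x" for x y a
    using lin unfolding linear_operator_def by blast+
  show "x \<in> D \<Longrightarrow> y \<in> D \<Longrightarrow> A (x - y) = A x - A y"
    using 1(1)[of x "- y"] 1(2)[of y "-1"] D_closed(3)[of y "-1"] by simp
  show "A 0 = 0" using 1(2)[of 0 0] D_closed by simp
qed

lemma R_in: "z \<in> \<rho> \<Longrightarrow> R z x \<in> D"
  and A_R: "z \<in> \<rho> \<Longrightarrow> A (R z x) = z *\<^sub>C R z x - x"
  using resolvent_in[of z UNIV norm D A x] by (auto simp: algebra_simps)

lemma R_left: "z \<in> \<rho> \<Longrightarrow> u \<in> D \<Longrightarrow> R z (z *\<^sub>C u - A u) = u"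
  by (rule resolvent_eqI) auto

lemma R_cbounded: "z \<in> \<rho> \<Longrightarrow> \<exists>c. cbounded (R z) c"
  unfolding resolvent_set_def bounded_operator_UNIV_iff by blast

lemma R_linear:
  assumes "z \<in> \<rho>"
  shows "R z (x + y) = R z x + R z y" "R z (a *\<^sub>C x) = a *\<^sub>C R z x" "R z (x - y) = R z x - R z y"
    "R z (- x) = - R z x" "R z 0 = 0"
  using R_cbounded[OF assms] cboundedD by blast+

lemma R_bounded_linear: "z \<in> \<rho> \<Longrightarrow> bounded_linear (R z)"
  using R_cbounded cbounded_bounded_linear by blast

lemma R_diff:
  assumes "z \<in> \<rho>" "w \<in> \<rho>"
  shows "R z x - R w x = (w - z) *\<^sub>C R z (R w x)"
proof -
  have "x = (w - z) *\<^sub>C R w x + (z *\<^sub>C R w x - A (R w x))"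
    using A_R[OF assms(2), of x] by (simp add: scaleC.scale_left_diff_distrib)
  then have "R z x = R z ((w - z) *\<^sub>C R w x + (z *\<^sub>C R w x - A (R w x)))" by simp
  also have "\<dots> = (w - z) *\<^sub>C R z (R w x) + R w x"
    using assms by (simp only: R_linear(1,2) R_left R_in)
  finally show ?thesis by simp
qed

lemma R_commute:
  assumes "z \<in> \<rho>" "w \<in> \<rho>"
  shows "R z (R w x) = R w (R z x)"
proof (cases "z = w")
  case False
  have "(w - z) *\<^sub>C R z (R w x) = - ((z - w) *\<^sub>C R w (R z x))"
    using R_diff[OF assms, of x] R_diff[OF assms(2,1), of x] by (metis minus_diff_eq)
  then have "(w - z) *\<^sub>C R z (R w x) = (w - z) *\<^sub>C R w (R z x)"
    by (simp flip: scaleC.scale_minus_left)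
  then show ?thesis using False by (auto dest: scaleC_cancel)
qed simp

lemma A_R_commute: "z \<in> \<rho> \<Longrightarrow> b \<in> D \<Longrightarrow> A (R z b) = R z (A b)"
  using R_left[of z b] A_R[of z b] R_linear(2,3)[of z] by (simp add: algebra_simps)

lemma A_R0: "A (R 0 x) = - x"
  using A_R[OF inv, of x] by simp

lemma R0_A: "b \<in> D \<Longrightarrow> R 0 (A b) = - b"
  using A_R_commute[OF inv, of b] A_R0 by simp

text \<open>A bound for \<open>R 0\<close>, which is - A^-1. Through it the graph norm of b is at
  most (c0 + 1) |A b|; this is how invertibility enters the estimates.\<close>

definition c0 :: real where "c0 = (SOME c. 0 \<le> c \<and> cbounded (R 0) c)"

lemma c0: "0 \<le> c0" "norm (R 0 x) \<le> c0 * norm x" "b \<in> D \<Longrightarrow> norm b \<le> c0 * norm (A b)"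
proof -
  have "\<exists>c. 0 \<le> c \<and> cbounded (R 0) c"
    using R_cbounded[OF inv] cbounded_mono[of "R 0"] by (meson max.cobounded1 max.cobounded2)
  from someI_ex[OF this] have "0 \<le> c0 \<and> cbounded (R 0) c0" unfolding c0_def .
  then show "0 \<le> c0" and 1: "norm (R 0 x) \<le> c0 * norm x" for x using cboundedD by auto
  show "b \<in> D \<Longrightarrow> norm b \<le> c0 * norm (A b)" using 1[of "A b"] R0_A[of b] by simp
qed

section \<open>The K-functional\<close>

lemma K_le:
  assumes "0 \<le> t" "b \<in> D" "a + b = x"
  shows "K t x \<le> norm a + t * (norm b + norm (A b))"
  unfolding K_functional_def using assms by (intro cInf_lower bdd_belowI[of _ 0]) auto

lemma K_ge_mult:
  assumes "0 \<le> c" "\<And>a b. b \<in> D \<Longrightarrow> a + b = x \<Longrightarrow> k \<le> c * (norm a + t * (norm b + norm (A b)))"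
  shows "k \<le> c * K t x"
proof (cases "c = 0")
  case True
  then show ?thesis using assms(2)[where a=x and b=0] D_closed(1) by simp
next
  case False
  have "k / c \<le> K t x"
    unfolding K_functional_def
  proof (rule cInf_greatest)
    have "norm x + t * (norm 0 + norm (A 0)) \<in> {norm a + t * (norm b + norm (A b)) |a b. b \<in> D \<and> a + b = x}"
      using D_closed(1) by (intro CollectI exI[of _ x] exI[of _ 0]) auto
    then show "{norm a + t * (norm b + norm (A b)) |a b. b \<in> D \<and> a + b = x} \<noteq> {}" by blast
  qed (use assms False in \<open>auto simp: field_simps\<close>)
  then show ?thesis using assms False by (simp add: field_simps)
qed

lemmas K_ge = K_ge_mult[of 1, simplified]

lemma K_nonneg: "0 \<le> t \<Longrightarrow> 0 \<le> K t x"
  by (rule K_ge) simp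

lemma K_le_norm: "0 \<le> t \<Longrightarrow> K t x \<le> norm x"
  using K_le[of t 0 x x] D_closed(1) A_linear(4) by simp

lemma K_le_graph: "0 \<le> t \<Longrightarrow> x \<in> D \<Longrightarrow> K t x \<le> t * (norm x + norm (A x))"
  using K_le[of t x 0 x] by simp

lemma K_mono: "0 \<le> s \<Longrightarrow> s \<le> t \<Longrightarrow> K s x \<le> K t x"
  by (rule K_ge) (rule order_trans[OF K_le], auto intro!: mult_right_mono)

text \<open>Raising the weight from s to t costs at most the factor t/s in every decomposition.
  Equivalently K(t, x)/t is nonincreasing, which is behind both the continuity in t and
  \<open>K_le_integral\<close>.\<close>

lemma K_slope:
  assumes "0 < s" "s \<le> t"
  shows "K t x \<le> (t / s) * K s x"
proof (rule K_ge_mult)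
  fix a b assume *: "b \<in> D" "a + b = x"
  have "K t x \<le> norm a + t * (norm b + norm (A b))" using * assms by (intro K_le) auto
  also have "\<dots> \<le> t / s * norm a + t * (norm b + norm (A b))"
    using assms mult_right_mono[of 1 "t / s" "norm a"] by simp
  also have "\<dots> = t / s * (norm a + s * (norm b + norm (A b)))"
    using assms by (simp add: field_simps)
  finally show "K t x \<le> t / s * (norm a + s * (norm b + norm (A b)))" .
qed (use assms in auto)

lemma K_add: assumes t: "0 \<le> t" shows "K t (x + y) \<le> K t x + K t y"
proof -
  have "K t (x + y) - K t y \<le> K t x"
  proof (rule K_ge)
    fix a b assume 1: "b \<in> D" "a + b = x"
    have "K t (x + y) - (norm a + t * (norm b + norm (A b))) \<le> K t y"
    proof (rule K_ge)
      fix a' b' assume 2: "b' \<in> D" "a' + b' = y"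
      have "K t (x + y) \<le> norm (a + a') + t * (norm (b + b') + norm (A (b + b')))"
        using 1 2 t by (intro K_le D_closed) (auto simp: algebra_simps)
      also have "\<dots> \<le> (norm a + norm a') + t * ((norm b + norm b') + (norm (A b) + norm (A b')))"
        using 1 2 t A_linear(1)[of b b'] by (intro add_mono mult_left_mono norm_triangle_ineq) (auto intro: norm_triangle_ineq)
      finally show "K t (x + y) - (norm a + t * (norm b + norm (A b))) \<le> norm a' + t * (norm b' + norm (A b'))"
        by (simp add: algebra_simps)
    qed
    then show "K t (x + y) - K t y \<le> norm a + t * (norm b + norm (A b))" by simp
  qed
  then show ?thesis by simp
qed

lemma K_lower: assumes "0 \<le> t" shows "min 1 t * norm x \<le> K t x"
proof (rule K_ge)
  fix a b assume *: "b \<in> D" "a + b = x"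
  have "min 1 t * norm x \<le> min 1 t * norm a + min 1 t * norm b"
    using * assms norm_triangle_ineq[of a b] by (simp flip: distrib_left add: mult_left_mono)
  also have "\<dots> \<le> 1 * norm a + t * (norm b + norm (A b))"
    using assms by (intro add_mono mult_mono) auto
  finally show "min 1 t * norm x \<le> norm a + t * (norm b + norm (A b))" by simp
qed

text \<open>An operator commuting with A^-1 maps \<open>D\<close> into itself and commutes with A
  there, as T b = A^-1 T A b. Applied to both summands of a decomposition it costs a single factor
  c. This is the transfer principle from X to the interpolation space.\<close>

lemma K_op:
  assumes t: "0 \<le> t" and c: "0 \<le> c" and T: "cbounded T c" and comm: "\<And>x. T (R 0 x) = R 0 (T x)"
  shows "K t (T x) \<le> c * K t x"
proof (rule K_ge_mult[OF c])
  fix a b assume *: "b \<in> D" "a + b = x"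
  have "- T b = R 0 (T (A b))"
    using comm[of "A b"] R0_A[OF *(1)] cboundedD(6)[OF T, of b] by simp
  then have b: "T b = - R 0 (T (A b))" by (metis minus_minus)
  then have "T b \<in> D" "A (T b) = T (A b)"
    using R_in[OF inv, of "T (A b)"] D_closed(3)[of "R 0 (T (A b))" "-1"] A_linear(2)[of "R 0 (T (A b))" "-1"]
      A_R0[of "T (A b)"] by auto
  then have "K t (T x) \<le> norm (T a) + t * (norm (T b) + norm (T (A b)))"
    using K_le[OF t, of "T b" "T a" "T x"] cboundedD(1)[OF T, of a b] * by simp
  also have "\<dots> \<le> c * norm a + t * (c * norm b + c * norm (A b))"
    using t by (intro add_mono mult_left_mono cboundedD(3)[OF T]) auto
  finally show "K t (T x) \<le> c * (norm a + t * (norm b + norm (A b)))"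
    by (simp add: algebra_simps)
qed

lemma K_R:
  assumes "0 \<le> t" "z \<in> \<rho>" "0 \<le> c" "\<And>x. norm (R z x) \<le> c * norm x"
  shows "K t (R z x) \<le> c * K t x"
  using assms R_linear[OF assms(2)] by (intro K_op) (auto simp: cbounded_def intro: R_commute[OF assms(2) inv])

lemma K_scaleC_le: "0 \<le> t \<Longrightarrow> K t (a *\<^sub>C x) \<le> cmod a * K t x"
  by (rule K_op) (auto simp: cbounded_def scaleC_add_right scaleC_scaleC mult.commute norm_scaleC R_linear[OF inv])

lemma K_scaleC: assumes "0 \<le> t" shows "K t (a *\<^sub>C x) = cmod a * K t x"
proof (cases "a = 0")
  case True
  then show ?thesis using K_scaleC_le[OF assms, of a x] K_nonneg[OF assms, of "a *\<^sub>C x"] by simp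
next
  case False
  have "cmod a * K t x \<le> cmod a * (cmod (inverse a) * K t (a *\<^sub>C x))"
    using K_scaleC_le[OF assms, of "inverse a" "a *\<^sub>C x"] False
    by (intro mult_left_mono) (simp_all add: scaleC_scaleC)
  also have "\<dots> = K t (a *\<^sub>C x)" using False by (simp add: norm_inverse)
  finally show ?thesis using K_scaleC_le[OF assms, of a x] by simp
qed

lemma K_zero: "0 \<le> t \<Longrightarrow> K t 0 = 0"
  using K_scaleC[of t 0 0] by simp

lemma K_sum: "0 \<le> t \<Longrightarrow> K t (\<Sum>i\<in>I. f i) \<le> (\<Sum>i\<in>I. K t (f i))"
  by (induction I rule: infinite_finite_induct) (auto simp: K_zero intro: order_trans[OF K_add])

lemma K_diff_le: "0 \<le> t \<Longrightarrow> \<bar>K t x - K t y\<bar> \<le> norm (x - y)"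
  using K_add[of t "x - y" y] K_add[of t "y - x" x] K_le_norm[of t "x - y"] K_le_norm[of t "y - x"]
  by (simp add: norm_minus_commute abs_le_iff)

lemma tendsto_K: "0 \<le> t \<Longrightarrow> f \<longlonglongrightarrow> x \<Longrightarrow> (\<lambda>n. K t (f n)) \<longlonglongrightarrow> K t x"
proof -
  assume t: "0 \<le> t" and "f \<longlonglongrightarrow> x"
  then have "(\<lambda>n. norm (f n - x)) \<longlonglongrightarrow> 0" by (simp add: LIM_zero tendsto_norm_zero)
  then have "(\<lambda>n. K t (f n) - K t x) \<longlonglongrightarrow> 0"
    by (rule Lim_null_comparison[rotated]) (simp add: K_diff_le[OF t])
  then show ?thesis by (rule LIM_zero_cancel)
qed

text \<open>For s \<le> t, monotonicity and \<open>K_slope\<close> place K(t, x) - K(s, x) between 0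
  and (t/s - 1) |x|.\<close>

lemma K_continuous_on: "continuous_on {0<..} (\<lambda>t. K t x)"
proof -
  have *: "\<bar>K t x - K s x\<bar> \<le> (\<bar>t - s\<bar> / min s t) * norm x" if "0 < s" "0 < t" for s t
  proof -
    have "\<bar>K t x - K s x\<bar> \<le> (\<bar>t - s\<bar> / min s t) * norm x" if "0 < s" "s \<le> t" for s t
    proof -
      have "K t x - K s x \<le> (t / s - 1) * K s x"
        using K_slope[OF that, of x] by (simp add: algebra_simps)
      also have "\<dots> \<le> (t / s - 1) * norm x"
        using that K_le_norm[of s x] by (intro mult_left_mono) auto
      finally show ?thesis using that K_mono[of s t x] by (simp add: field_simps)
    qed
    then show ?thesis using that
      by (metis abs_minus_commute min.commute nle_le)
  qed
  show ?thesis
    unfolding continuous_on_def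
  proof
    fix s :: real assume s: "s \<in> {0<..}"
    have "((\<lambda>t. (\<bar>t - s\<bar> / min s t) * norm x) \<longlongrightarrow> (\<bar>s - s\<bar> / min s s) * norm x) (at s within {0<..})"
      using s by (intro tendsto_intros) auto
    then have l: "((\<lambda>t. (\<bar>t - s\<bar> / min s t) * norm x) \<longlongrightarrow> 0) (at s within {0<..})" by simp
    have "((\<lambda>t. K t x - K s x) \<longlongrightarrow> 0) (at s within {0<..})"
      by (rule Lim_null_comparison[OF _ l])
        (use s * in \<open>auto simp: eventually_at_filter intro!: always_eventually\<close>)
    then show "((\<lambda>t. K t x) \<longlongrightarrow> K s x) (at s within {0<..})"
      by (rule LIM_zero_cancel)
  qed
qed

lemma K_quotient_measurable: "K_quotient D A x \<in> borel_measurable (lebesgue_on {0..})"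
proof -
  \<comment> \<open>The infimum is meaningful only for nonnegative t. Extending it by its value at 0
    gives a monotone, hence Borel, function on the whole line.\<close>
  have "mono (\<lambda>t. K (max 0 t) x)"
    by (auto intro!: monoI K_mono)
  then have "(\<lambda>t. complex_of_real (K (max 0 t) x / t)) \<in> borel_measurable borel"
    using borel_measurable_mono by measurable
  then have "(\<lambda>t. complex_of_real (K (max 0 t) x / t)) \<in> borel_measurable (lebesgue_on {0..})"
    by (intro measurable_restrict_space1 measurable_completion) (simp add: measurable_lborel1)
  then show ?thesis
    by (rule measurable_cong[THEN iffD1, rotated])
      (auto simp: K_quotient_def max_def)
qed

text \<open>A R(z) acts on the summand in X as z R(z) - 1, with bound M + 1, and on the summand in
  \<open>D\<close> as R(z) A, which gains the factor 1/|z|. Hence the parameter 1/|z| of the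
  K-functional.\<close>

lemma A_R_le_K:
  assumes z: "z \<in> \<rho>" "z \<noteq> 0" and M: "0 \<le> M" "\<And>x. norm (z *\<^sub>C R z x) \<le> M * norm x"
  shows "norm (A (R z x)) \<le> (M + 1) * K (1 / cmod z) x"
proof (rule K_ge_mult)
  fix a b assume *: "b \<in> D" "a + b = x"
  have "A (R z x) = A (R z a) + R z (A b)"
    using * R_linear(1)[OF z(1), of a b] A_linear(1)[of "R z a" "R z b"] R_in[OF z(1)] A_R_commute[OF z(1)] by auto
  then have "norm (A (R z x)) \<le> norm (A (R z a)) + norm (R z (A b))"
    by (simp add: norm_triangle_ineq)
  moreover have "norm (A (R z a)) \<le> (M + 1) * norm a"
    unfolding A_R[OF z(1)] using M(2)[of a] norm_triangle_ineq4[of "z *\<^sub>C R z a" a] by (simp add: distrib_right)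
  moreover have "norm (R z (A b)) \<le> (M + 1) * (1 / cmod z * (norm b + norm (A b)))"
  proof -
    have "cmod z * norm (R z (A b)) \<le> M * norm (A b)" using M(2)[of "A b"] by (simp add: norm_scaleC)
    also have "\<dots> \<le> (M + 1) * (norm b + norm (A b))" using M by (intro mult_mono) auto
    finally show ?thesis using z by (simp add: field_simps)
  qed
  ultimately show "norm (A (R z x)) \<le> (M + 1) * (norm a + 1 / cmod z * (norm b + norm (A b)))"
    by (simp add: algebra_simps)
qed (use M in auto)

section \<open>Resolvents on the negative axis\<close>

text \<open>This is (1 + tA)^-1, since w R(w) = (1 - A/w)^-1 and w = \<open>pole t\<close> is -
  1/t.\<close>

definition J :: "real \<Rightarrow> 'a \<Rightarrow> 'a" where
  "J t x = pole t *\<^sub>C R (pole t) x"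

lemma J_facts:
  assumes t: "0 < t" "pole t \<in> \<rho>"
  shows J_in: "J t x \<in> D" and A_J: "A (J t x) = of_real (1 / t) *\<^sub>C (x - J t x)"
    and J_bounded_linear: "bounded_linear (J t)" and J_scaleC: "J t (a *\<^sub>C x) = a *\<^sub>C J t x"
    and J_inj: "J t x = 0 \<Longrightarrow> x = 0"
proof -
  show D: "J t x \<in> D" for x unfolding J_def by (intro D_closed R_in t)
  show AJ: "A (J t x) = of_real (1 / t) *\<^sub>C (x - J t x)" for x
  proof -
    define w where "w = pole t"
    have w: "J t x = w *\<^sub>C R w x" "w \<in> \<rho>" "complex_of_real (1 / t) = - w"
      using t by (simp_all add: J_def w_def)
    show ?thesis unfolding w by (simp add: A_linear(2) R_in A_R w(2) flip: scaleC.scale_minus_right)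
  qed
  show "bounded_linear (J t)"
    unfolding J_def by (intro bounded_linear_compose[OF bounded_linear_scaleC_right R_bounded_linear] t)
  show "J t (a *\<^sub>C x) = a *\<^sub>C J t x"
    unfolding J_def using t by (simp add: R_linear scaleC_scaleC mult.commute)
  show "J t x = 0 \<Longrightarrow> x = 0" using AJ[of x] t(1) A_linear(4) by simp
qed

text \<open>Decompose y as (y - J t y) + J t y. Here t |A J t y| = |y - J t y|, and
  \<open>c0\<close> absorbs |J t y|, whence the constant 2 + c0.\<close>

lemma K_le_J:
  assumes t: "0 < t" "pole t \<in> \<rho>"
  shows "K t y \<le> (2 + c0) * norm (y - J t y)"
proof -
  have "t * norm (A (J t y)) = norm (y - J t y)"
    using A_J[OF t] t(1) by (simp add: norm_scaleC norm_divide)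
  moreover have "t * norm (J t y) \<le> c0 * (t * norm (A (J t y)))"
    using c0(3)[OF J_in[OF t], of y] t(1) by (simp add: mult.left_commute)
  moreover have "K t y \<le> norm (y - J t y) + t * (norm (J t y) + norm (A (J t y)))"
    using t J_in[OF t] by (intro K_le) auto
  ultimately show ?thesis by (simp add: algebra_simps)
qed

text \<open>The resolvent identity solved for J t R(z). Under a contour integral the first term is
  the multiplier 1/(1 + tz), and the second is a scalar function times a fixed vector, which
  Cauchy's theorem removes.\<close>

lemma J_R:
  assumes t: "0 < t" "pole t \<in> \<rho>" and z: "z \<in> \<rho>" "1 + of_real t * z \<noteq> 0"
  shows "J t (R z x) = (1 / (1 + of_real t * z)) *\<^sub>C R z x + (of_real t / (1 + of_real t * z)) *\<^sub>C J t x"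
proof -
  define w where "w = pole t"
  have w: "J t x = w *\<^sub>C R w x" "w \<in> \<rho>" for x using t by (simp_all add: J_def w_def)
  have tw: "of_real t * w = -1" using t by (simp add: w_def)
  have e: "(1 + of_real t * z) * w = w - z"
    using arg_cong[OF tw, of "\<lambda>u. w + z * u"] by (simp add: algebra_simps)
  have "R z x + of_real t *\<^sub>C J t x = R z x - R w x" using tw by (simp add: w(1) scaleC_scaleC)
  also have "\<dots> = (w - z) *\<^sub>C R w (R z x)" using R_diff[OF z(1) w(2)] R_commute[OF z(1) w(2)] by simp
  also have "\<dots> = (1 + of_real t * z) *\<^sub>C J t (R z x)" by (simp add: w(1) scaleC_scaleC e)
  finally have "(1 / (1 + of_real t * z)) *\<^sub>C (R z x + of_real t *\<^sub>C J t x) = J t (R z x)"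
    using z by (simp add: scaleC_scaleC)
  then show ?thesis by (simp add: scaleC_add_right scaleC_scaleC)
qed

lemma J_commute:
  assumes "pole t \<in> \<rho>" "pole s \<in> \<rho>"
  shows "J t (J s x) = J s (J t x)"
  unfolding J_def using assms R_commute[OF assms, of x] by (simp add: R_linear scaleC_scaleC mult.commute)

end

section \<open>The interpolation space and the part of \<open>A\<close>\<close>

lemma AE_halfline_pos: "AE t in lebesgue_on {0..}. 0 < (t::real)"
proof -
  have "AE t in lebesgue. t \<noteq> (0::real)"
    using AE_lborel_singleton by (rule AE_completion)
  then show ?thesis by (auto simp: AE_restrict_space_iff)
qed

lemma AE_halfline_ex:
  assumes "AE t in lebesgue_on {0..}. P t"
  obtains t :: real where "0 < t" "P t"
proof -
  have ae: "AE t in lebesgue. t \<in> {0..} \<longrightarrow> P t"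
    using assms by (auto simp: AE_restrict_space_iff)
  have "AE t in lebesgue. t \<notin> {0<..<1::real}" if "\<not> (\<exists>t\<in>{0<..<1}. P t)"
    by (rule eventually_mono[OF ae]) (use that in auto)
  moreover have "\<not> (AE t in lebesgue. t \<notin> {0<..<1::real})"
    using AE_iff_null_sets[of "{0<..<1::real}" lebesgue] by (auto simp: null_sets_def)
  ultimately have "\<exists>t\<in>{0<..<1}. P t" by blast
  then show ?thesis using that by auto
qed

lemma sectorial_of_angle_far:
  assumes s: "sectorial_of_angle V N D B \<theta>" and \<psi>: "\<theta> < \<psi>" "\<psi> < pi"
  shows "far \<psi> \<subseteq> resolvent_set V N D B"
    and "\<exists>C. \<forall>z\<in>far \<psi>. \<forall>x\<in>V. N (z *\<^sub>C resolvent D B z x) \<le> C * N x"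
proof -
  have \<theta>: "0 < \<theta>" "\<theta> < pi" "op_spectrum V N D B \<subseteq> closure (sector \<theta>)"
    "\<And>\<phi>'. \<theta> < \<phi>' \<Longrightarrow> \<phi>' < pi \<Longrightarrow> \<exists>C. \<forall>\<mu>. \<mu> \<notin> sector \<phi>' \<longrightarrow> (\<forall>x\<in>V. N (\<mu> *\<^sub>C resolvent D B \<mu> x) \<le> C * N x)"
    using s unfolding sectorial_of_angle_def by auto
  have "far \<psi> \<inter> closure (sector \<theta>) = {}"
    using closure_sector_subset[of \<theta>] \<theta>(1,2) \<psi> by (auto simp: far_def)
  then show "far \<psi> \<subseteq> resolvent_set V N D B" using \<theta>(3) by (auto simp: op_spectrum_def)
  obtain C where "\<forall>\<mu>. \<mu> \<notin> sector \<psi> \<longrightarrow> (\<forall>x\<in>V. N (\<mu> *\<^sub>C resolvent D B \<mu> x) \<le> C * N x)"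
    using \<theta>(4)[OF \<psi>] by blast
  moreover have "z \<notin> sector \<psi>" if "z \<in> far \<psi>" for z using that by (auto simp: far_def sector_def)
  ultimately show "\<exists>C. \<forall>z\<in>far \<psi>. \<forall>x\<in>V. N (z *\<^sub>C resolvent D B z x) \<le> C * N x" by blast
qed

section \<open>Banach function spaces\<close>

locale function_space =
  fixes \<Phi> :: "(real \<Rightarrow> complex) set" and N :: "(real \<Rightarrow> complex) \<Rightarrow> real"
  assumes bfs: "banach_function_space \<Phi> N"
begin

lemma \<Phi>_measurable: "f \<in> \<Phi> \<Longrightarrow> f \<in> borel_measurable (lebesgue_on {0..})"
  using bfs unfolding banach_function_space_def by blast

lemma \<Phi>_zero: "(\<lambda>t. 0) \<in> \<Phi>"
  using bfs unfolding banach_function_space_def by blast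

lemma \<Phi>_add: "f \<in> \<Phi> \<Longrightarrow> g \<in> \<Phi> \<Longrightarrow> (\<lambda>t. f t + g t) \<in> \<Phi>"
  and N_add: "f \<in> \<Phi> \<Longrightarrow> g \<in> \<Phi> \<Longrightarrow> N (\<lambda>t. f t + g t) \<le> N f + N g"
  using bfs unfolding banach_function_space_def by blast+

lemma \<Phi>_cmult: "f \<in> \<Phi> \<Longrightarrow> (\<lambda>t. c * f t) \<in> \<Phi>"
  and N_cmult: "f \<in> \<Phi> \<Longrightarrow> N (\<lambda>t. c * f t) = cmod c * N f"
  using bfs unfolding banach_function_space_def by blast+

lemma N_nonneg: "f \<in> \<Phi> \<Longrightarrow> 0 \<le> N f"
  and N_eq_0_iff: "f \<in> \<Phi> \<Longrightarrow> N f = 0 \<longleftrightarrow> (AE t in lebesgue_on {0..}. f t = 0)"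
  using bfs unfolding banach_function_space_def by blast+

lemma \<Phi>_ideal_AE:
  assumes "f \<in> borel_measurable (lebesgue_on {0..})" "g \<in> \<Phi>"
    "AE t in lebesgue_on {0..}. cmod (f t) \<le> cmod (g t)"
  shows "f \<in> \<Phi>" "N f \<le> N g"
  using bfs assms unfolding banach_function_space_def by blast+

lemma \<Phi>_ideal:
  assumes "f \<in> borel_measurable (lebesgue_on {0..})" "g \<in> \<Phi>"
    "\<And>t. 0 < t \<Longrightarrow> cmod (f t) \<le> cmod (g t)"
  shows "f \<in> \<Phi>" "N f \<le> N g"
proof -
  have "AE t in lebesgue_on {0..}. cmod (f t) \<le> cmod (g t)"
    using AE_halfline_pos by (rule eventually_mono) (rule assms(3))
  then show "f \<in> \<Phi>" "N f \<le> N g" by (rule \<Phi>_ideal_AE[OF assms(1,2)])+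
qed

lemma N_zero: "N (\<lambda>t. 0) = 0"
  using N_eq_0_iff[OF \<Phi>_zero] by simp

lemma \<Phi>_diff: "f \<in> \<Phi> \<Longrightarrow> g \<in> \<Phi> \<Longrightarrow> (\<lambda>t. f t - g t) \<in> \<Phi>"
  using \<Phi>_add[of f "\<lambda>t. - 1 * g t"] \<Phi>_cmult[of g "-1"] by simp

lemma \<Phi>_sum:
  assumes "\<And>i. i \<in> I \<Longrightarrow> f i \<in> \<Phi>"
  shows "(\<lambda>t. \<Sum>i\<in>I. f i t) \<in> \<Phi> \<and> N (\<lambda>t. \<Sum>i\<in>I. f i t) \<le> (\<Sum>i\<in>I. N (f i))"
  using assms
proof (induction I rule: infinite_finite_induct)
  case (insert i I)
  then show ?case
    using \<Phi>_add[of "f i" "\<lambda>t. \<Sum>i\<in>I. f i t"] N_add[of "f i" "\<lambda>t. \<Sum>i\<in>I. f i t"] by auto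
qed (auto simp: \<Phi>_zero N_zero)

text \<open>The negative part of \<open>|g| - P l\<close> is dominated by \<open>|P m - g|\<close> for all \<open>m \<ge> l\<close>.\<close>

lemma increasing_limit_dominates:
  assumes P: "\<And>l. P l \<in> \<Phi>" "\<And>l t. 0 < t \<Longrightarrow> P l t = of_real (Re (P l t))"
    and incr: "\<And>l m t. 0 < t \<Longrightarrow> l \<le> m \<Longrightarrow> Re (P l t) \<le> Re (P m t)"
    and g: "g \<in> \<Phi>" "(\<lambda>l. N (\<lambda>t. P l t - g t)) \<longlonglongrightarrow> 0"
  shows "AE t in lebesgue_on {0..}. \<forall>l. Re (P l t) \<le> cmod (g t)"
proof (subst AE_all_countable, rule allI)
  fix l
  define q where "q = (\<lambda>t. complex_of_real (max 0 (Re (P l t) - cmod (g t))))"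
  have qm: "q \<in> borel_measurable (lebesgue_on {0..})"
    unfolding q_def using \<Phi>_measurable[OF P(1)] \<Phi>_measurable[OF g(1)] by measurable
  have le: "cmod (q t) \<le> cmod (P m t - g t)" if "0 < t" "l \<le> m" for m t
  proof -
    have "Re (P l t) - cmod (g t) \<le> cmod (P m t) - cmod (g t)"
      using incr[OF that] complex_Re_le_cmod[of "P m t"] by simp
    also have "\<dots> \<le> cmod (P m t - g t)" by (rule norm_triangle_ineq2)
    finally show ?thesis by (simp add: q_def max_def)
  qed
  have q: "q \<in> \<Phi>" "N q \<le> N (\<lambda>t. P m t - g t)" if "l \<le> m" for m
    using \<Phi>_ideal[OF qm \<Phi>_diff[OF P(1) g(1)] le] that by auto
  have "N q \<le> 0"
    by (rule LIMSEQ_le_const[OF g(2)]) (use q in auto)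
  then have "AE t in lebesgue_on {0..}. q t = 0"
    using N_nonneg N_eq_0_iff q by (metis order_antisym order_refl)
  then show "AE t in lebesgue_on {0..}. Re (P l t) \<le> cmod (g t)"
    by (rule eventually_mono) (auto simp: q_def max_def split: if_splits)
qed

end

section \<open>Norm and completeness of the interpolation space\<close>

locale interp_op = invertible_op D A + function_space \<Phi> N
  for D :: "'a::complex_banach set" and A and \<Phi> and N +
  assumes min_in: "(\<lambda>t. complex_of_real (min 1 (1 / t))) \<in> \<Phi>"
begin

abbreviation "V \<equiv> interp_space D A \<Phi>"
abbreviation "NV \<equiv> interp_norm D A N"
abbreviation "DV \<equiv> part_domain D A \<Phi>"
abbreviation "kq \<equiv> K_quotient D A"

text \<open>One constant for two embeddings: K(t, x)/t lies above |x| min(1, 1/t) for every x and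
  below the graph norm of x times min(1, 1/t) for x in \<open>D\<close>.\<close>

definition \<kappa> :: real where "\<kappa> = N (\<lambda>t. complex_of_real (min 1 (1 / t)))"

lemma \<kappa>_pos: "0 < \<kappa>"
proof -
  have "\<not> (AE t in lebesgue_on {0..}. complex_of_real (min 1 (1 / t)) = 0)"
  proof
    assume "AE t in lebesgue_on {0..}. complex_of_real (min 1 (1 / t)) = 0"
    then obtain t :: real where "0 < t" "complex_of_real (min 1 (1 / t)) = 0"
      by (rule AE_halfline_ex)
    then show False by (auto simp: min_def split: if_splits)
  qed
  then show ?thesis
    using N_nonneg[OF min_in] N_eq_0_iff[OF min_in] unfolding \<kappa>_def by auto
qed

lemma cmod_kq: "0 < t \<Longrightarrow> cmod (kq x t) = K t x / t"
  using K_nonneg[of t x] by (simp add: K_quotient_def norm_divide)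

lemma V_iff: "x \<in> V \<longleftrightarrow> kq x \<in> \<Phi>"
  and NV_eq: "NV x = N (kq x)"
  by (simp_all add: interp_space_def interp_norm_def)

lemma V_dom_AE:
  assumes "g \<in> \<Phi>" "AE t in lebesgue_on {0..}. 0 < t \<longrightarrow> K t x / t \<le> cmod (g t)"
  shows "x \<in> V" "NV x \<le> N g"
proof -
  have "AE t in lebesgue_on {0..}. cmod (kq x t) \<le> cmod (g t)"
    using AE_halfline_pos assms(2) by eventually_elim (auto simp: cmod_kq)
  from \<Phi>_ideal_AE[OF K_quotient_measurable assms(1) this] show "x \<in> V" "NV x \<le> N g"
    by (auto simp: V_iff NV_eq)
qed

lemma V_dom:
  assumes "g \<in> \<Phi>" "\<And>t. 0 < t \<Longrightarrow> K t x / t \<le> cmod (g t)"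
  shows "x \<in> V" "NV x \<le> N g"
  using V_dom_AE[OF assms(1)] assms(2) by auto

lemma norm_le_NV:
  assumes "x \<in> V"
  shows "\<kappa> * norm x \<le> NV x"
proof -
  have f: "(\<lambda>t. of_real (norm x) * complex_of_real (min 1 (1 / t))) \<in> \<Phi>"
    using \<Phi>_cmult[OF min_in] .
  have "N (\<lambda>t. of_real (norm x) * complex_of_real (min 1 (1 / t))) \<le> N (kq x)"
  proof (rule \<Phi>_ideal(2)[OF \<Phi>_measurable[OF f]])
    fix t :: real assume t: "0 < t"
    have "norm x * min 1 (1 / t) = min 1 t * norm x / t"
      using t by (auto simp: min_def field_simps)
    also have "\<dots> \<le> K t x / t"
      using K_lower[of t x] t by (intro divide_right_mono) auto
    finally show "cmod (of_real (norm x) * complex_of_real (min 1 (1 / t))) \<le> cmod (kq x t)"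
      using t by (simp add: cmod_kq norm_mult)
  qed (use assms in \<open>simp add: V_iff\<close>)
  then show ?thesis
    unfolding NV_eq \<kappa>_def using N_cmult[OF min_in, of "of_real (norm x)"] by (simp add: mult.commute)
qed

lemma D_subset_V:
  assumes "x \<in> D"
  shows "x \<in> V" "NV x \<le> \<kappa> * (norm x + norm (A x))"
proof -
  let ?c = "norm x + norm (A x)"
  have g: "(\<lambda>t. of_real ?c * complex_of_real (min 1 (1 / t))) \<in> \<Phi>"
    using \<Phi>_cmult[OF min_in] .
  have "K t x / t \<le> cmod (of_real ?c * complex_of_real (min 1 (1 / t)))" if "0 < t" for t
  proof -
    have "K t x \<le> ?c" using K_le_norm[of t x] norm_ge_zero[of "A x"] that by linarith
    then have "K t x / t \<le> ?c * min 1 (1 / t)"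
      using K_le_graph[of t x] assms that by (auto simp: min_def field_simps)
    then show ?thesis using that by (simp add: norm_mult del: of_real_add)
  qed
  from V_dom[OF g this] show "x \<in> V" "NV x \<le> \<kappa> * ?c"
    using N_cmult[OF min_in, of "of_real ?c"] by (auto simp: \<kappa>_def mult.commute simp del: of_real_add)
qed

lemma NV_nonneg: "x \<in> V \<Longrightarrow> 0 \<le> NV x"
  using N_nonneg by (simp add: V_iff NV_eq)

lemma V_K_bound:
  assumes "x \<in> V" "0 \<le> c" "\<And>t. 0 < t \<Longrightarrow> K t y \<le> c * K t x"
  shows "y \<in> V" "NV y \<le> c * NV x"
proof -
  have g: "(\<lambda>t. of_real c * kq x t) \<in> \<Phi>" using assms \<Phi>_cmult by (auto simp: V_iff)
  have "K t y / t \<le> cmod (of_real c * kq x t)" if "0 < t" for t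
    using assms(2,3) that divide_right_mono[OF assms(3)[OF that], of t] by (simp add: norm_mult cmod_kq)
  from V_dom[OF g this] show "y \<in> V" "NV y \<le> c * NV x"
    using assms N_cmult[of "kq x" "of_real c"] by (auto simp: V_iff NV_eq)
qed

lemma V_op:
  assumes "x \<in> V" "0 \<le> c" "cbounded T c" "\<And>x. T (R 0 x) = R 0 (T x)"
  shows "T x \<in> V" "NV (T x) \<le> c * NV x"
  using V_K_bound[OF assms(1,2) K_op[OF _ assms(2-4)]] by auto

lemma V_R:
  assumes "x \<in> V" "z \<in> \<rho>" "0 \<le> c" "\<And>x. norm (R z x) \<le> c * norm x"
  shows "R z x \<in> V" "NV (R z x) \<le> c * NV x"
  using V_K_bound[OF assms(1,3) K_R[OF _ assms(2-4)]] by auto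

lemma V_add:
  assumes "x \<in> V" "y \<in> V"
  shows "x + y \<in> V" "NV (x + y) \<le> NV x + NV y"
proof -
  have g: "(\<lambda>t. kq x t + kq y t) \<in> \<Phi>" using assms \<Phi>_add by (auto simp: V_iff)
  have "K t (x + y) / t \<le> cmod (kq x t + kq y t)" if "0 < t" for t
  proof -
    have "K t (x + y) / t \<le> (K t x + K t y) / t"
      using K_add[of t x y] that by (intro divide_right_mono) auto
    also have "\<dots> = cmod (complex_of_real ((K t x + K t y) / t))"
      using that K_nonneg[of t] by (simp only: norm_of_real) simp
    also have "complex_of_real ((K t x + K t y) / t) = kq x t + kq y t"
      by (simp add: K_quotient_def add_divide_distrib)
    finally show ?thesis .
  qed
  from V_dom[OF g this] show "x + y \<in> V" "NV (x + y) \<le> NV x + NV y"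
    using N_add[of "kq x" "kq y"] assms by (auto simp: V_iff NV_eq)
qed

lemma V_scaleC:
  assumes "x \<in> V"
  shows "a *\<^sub>C x \<in> V" "NV (a *\<^sub>C x) = cmod a * NV x"
proof -
  have le: "a *\<^sub>C x \<in> V" "NV (a *\<^sub>C x) \<le> cmod a * NV x" if "x \<in> V" for a x
    using V_K_bound[OF that, of "cmod a" "a *\<^sub>C x"] K_scaleC[of _ a x] by auto
  show 1: "a *\<^sub>C x \<in> V" by (rule le[OF assms])
  have "cmod a * NV x \<le> NV (a *\<^sub>C x)"
  proof (cases "a = 0")
    case False
    then have "NV x \<le> cmod (inverse a) * NV (a *\<^sub>C x)"
      using le(2)[OF 1, of "inverse a"] by (simp add: scaleC_scaleC)
    then have "cmod a * NV x \<le> cmod a * (cmod (inverse a) * NV (a *\<^sub>C x))"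
      by (intro mult_left_mono) auto
    also have "\<dots> = NV (a *\<^sub>C x)" using False by (simp add: norm_inverse)
    finally show ?thesis .
  qed (use NV_nonneg[OF 1] in simp)
  then show "NV (a *\<^sub>C x) = cmod a * NV x" using le(2)[OF assms, of a] by simp
qed

lemma V_zero: "0 \<in> V" "NV 0 = 0"
  using D_subset_V[OF D_closed(1)] NV_nonneg[of 0] A_linear(4) by auto

lemma V_diff:
  assumes "x \<in> V" "y \<in> V"
  shows "x - y \<in> V" "NV (x - y) \<le> NV x + NV y"
  using V_add[OF assms(1) V_scaleC(1)[OF assms(2), of "-1"]] V_scaleC(2)[OF assms(2), of "-1"] by auto

lemma NV_minus_commute: "x \<in> V \<Longrightarrow> y \<in> V \<Longrightarrow> NV (x - y) = NV (y - x)"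
  using V_scaleC(2)[OF V_diff(1), of x y "-1"] by simp

lemma V_sum:
  assumes "\<And>i. i \<in> I \<Longrightarrow> f i \<in> V"
  shows "(\<Sum>i\<in>I. f i) \<in> V" "NV (\<Sum>i\<in>I. f i) \<le> (\<Sum>i\<in>I. NV (f i))"
proof -
  have "(\<Sum>i\<in>I. f i) \<in> V \<and> NV (\<Sum>i\<in>I. f i) \<le> (\<Sum>i\<in>I. NV (f i))"
    using assms
  proof (induction I rule: infinite_finite_induct)
    case (insert i I)
    then show ?case using V_add[of "f i" "\<Sum>i\<in>I. f i"] by auto
  qed (auto simp: V_zero)
  then show "(\<Sum>i\<in>I. f i) \<in> V" "NV (\<Sum>i\<in>I. f i) \<le> (\<Sum>i\<in>I. NV (f i))" by auto
qed

text \<open>The partial sums of the functions K(t, d j)/t converge in \<Phi> and increase, so their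
  limit g dominates all of them almost everywhere. Continuity of K(t, .) on X then puts K(t, x)/t
  below |g|. Completeness of \<Phi> thus does the work of a Fatou property; the factor 2 sums the
  geometric series.\<close>

lemma V_series:
  fixes d :: "nat \<Rightarrow> 'a"
  assumes d: "\<And>j. d j \<in> V" "\<And>j. NV (d j) \<le> c * (1/2)^j" and s: "d sums x"
  shows "x \<in> V" "NV x \<le> 2 * c"
proof -
  define P where "P l t = (\<Sum>j<l. kq (d j) t)" for l t
  have P: "P l \<in> \<Phi>" for l unfolding P_def[abs_def] using \<Phi>_sum[of "{..<l}" "\<lambda>j. kq (d j)"] d(1) by (auto simp: V_iff)
  have c: "0 \<le> c" using NV_nonneg[OF d(1)[of 0]] d(2)[of 0] by simp
  have geo: "(\<Sum>j\<in>{l..<m}. c * (1/2)^j) \<le> 2 * c * (1/2)^l" for l m :: nat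
  proof (cases "l \<le> m")
    case True
    have "(\<Sum>j\<in>{l..<m}. (1/2::real)^j) = 2 * (1/2)^l - 2 * (1/2)^m"
      using True by (induction m rule: dec_induct) simp_all
    then have "(\<Sum>j\<in>{l..<m}. (1/2::real)^j) \<le> 2 * (1/2)^l" by simp
    from mult_left_mono[OF this c] show ?thesis by (simp add: sum_distrib_left)
  qed (use c in simp)
  have NP: "N (\<lambda>t. P m t - P l t) \<le> 2 * c * (1/2)^l" if "l \<le> m" for l m
  proof -
    have "(\<lambda>t. P m t - P l t) = (\<lambda>t. \<Sum>j\<in>{l..<m}. kq (d j) t)"
      unfolding P_def using that by (auto simp: lessThan_atLeast0 sum_diff_nat_ivl)
    then have "N (\<lambda>t. P m t - P l t) \<le> (\<Sum>j\<in>{l..<m}. NV (d j))"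
      using \<Phi>_sum[of "{l..<m}" "\<lambda>j. kq (d j)"] d(1) by (auto simp: V_iff NV_eq)
    also have "\<dots> \<le> (\<Sum>j\<in>{l..<m}. c * (1/2)^j)" by (intro sum_mono d)
    finally show ?thesis using geo[of l m] by simp
  qed
  have sym: "N (\<lambda>t. P m t - P l t) = N (\<lambda>t. P l t - P m t)" for l m
    using N_cmult[OF \<Phi>_diff[OF P[of m] P[of l]], of "-1"] by simp
  have lim: "(\<lambda>l. 2 * c * (1/2::real)^l) \<longlonglongrightarrow> 0"
    using tendsto_mult[OF tendsto_const LIMSEQ_power_zero[of "1/2::real"], of "2 * c"] by simp
  have Cauchy: "\<exists>M. \<forall>m\<ge>M. \<forall>n\<ge>M. N (P m - P n) < e" if "e > 0" for e
  proof -
    from order_tendstoD(2)[OF lim that] obtain M where M: "\<And>l. l \<ge> M \<Longrightarrow> 2 * c * (1/2::real)^l < e"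
      by (auto simp: eventually_sequentially)
    have "N (P m - P n) < e" if "M \<le> m" "M \<le> n" for m n
    proof (cases "n \<le> m")
      case True
      then show ?thesis using NP[OF True] M[OF that(2)] by (simp add: fun_diff_def)
    next
      case False
      then show ?thesis using NP[of m n] M[OF that(1)] sym[of m n] by (simp add: fun_diff_def)
    qed
    then show ?thesis by blast
  qed
  obtain g where g: "g \<in> \<Phi>" "(\<lambda>l. N (P l - g)) \<longlonglongrightarrow> 0"
  proof -
    have "complete_wrt \<Phi> N" using bfs by (simp add: banach_function_space_def)
    then have "(\<forall>n. P n \<in> \<Phi>) \<and> (\<forall>e>0. \<exists>M. \<forall>m\<ge>M. \<forall>n\<ge>M. N (P m - P n) < e)
        \<longrightarrow> (\<exists>x\<in>\<Phi>. (\<lambda>n. N (P n - x)) \<longlonglongrightarrow> 0)"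
      unfolding complete_wrt_def by (rule spec)
    with Cauchy P that show ?thesis by blast
  qed
  then have g2: "(\<lambda>l. N (\<lambda>t. P l t - g t)) \<longlonglongrightarrow> 0" by (simp add: fun_diff_def)
  have Re: "Re (P l t) = (\<Sum>j<l. K t (d j) / t)" for l t
    by (simp add: P_def K_quotient_def)
  have "AE t in lebesgue_on {0..}. \<forall>l. Re (P l t) \<le> cmod (g t)"
  proof (rule increasing_limit_dominates[OF P _ _ g(1) g2])
    show "P l t = of_real (Re (P l t))" for l t
      by (simp add: Re) (simp add: P_def K_quotient_def)
    show "Re (P l t) \<le> Re (P m t)" if "0 < t" "l \<le> m" for l m t
      unfolding Re using that K_nonneg by (intro sum_mono2) auto
  qed
  then have "AE t in lebesgue_on {0..}. 0 < t \<longrightarrow> K t x / t \<le> cmod (g t)"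
  proof (rule eventually_mono, intro impI)
    fix t :: real assume *: "\<forall>l. Re (P l t) \<le> cmod (g t)" and t: "0 < t"
    have "(\<lambda>l. K t (\<Sum>j<l. d j) / t) \<longlonglongrightarrow> K t x / t"
      using t s unfolding sums_def by (intro tendsto_divide tendsto_K) auto
    then show "K t x / t \<le> cmod (g t)"
    proof (rule LIMSEQ_le_const2, intro exI allI impI)
      fix l
      have "K t (\<Sum>j<l. d j) / t \<le> Re (P l t)"
        unfolding Re sum_divide_distrib[symmetric] using t K_sum[of t d "{..<l}"] by (intro divide_right_mono) auto
      then show "K t (\<Sum>j<l. d j) / t \<le> cmod (g t)" using * by (meson order_trans)
    qed
  qed
  from V_dom_AE[OF g(1) this] have x: "x \<in> V" "NV x \<le> N g" .
  show "x \<in> V" by fact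
  have "N g \<le> 2 * c + N (\<lambda>t. P l t - g t)" for l
  proof -
    have "N (P l) \<le> 2 * c" using NP[of 0 l] by (simp add: P_def[of 0])
    moreover have "N g \<le> N (P l) + N (\<lambda>t. (-1) * (P l t - g t))"
      using N_add[OF P[of l] \<Phi>_cmult[OF \<Phi>_diff[OF P[of l] g(1)], of "-1"]] by simp
    ultimately show ?thesis
      using N_cmult[OF \<Phi>_diff[OF P[of l] g(1)], of "-1"] by simp
  qed
  moreover have "(\<lambda>l. 2 * c + N (\<lambda>t. P l t - g t)) \<longlonglongrightarrow> 2 * c + 0"
    by (intro tendsto_add tendsto_const g2)
  ultimately have "N g \<le> 2 * c + 0" by (intro LIMSEQ_le_const) auto
  then show "NV x \<le> 2 * c" using x by simp
qed

lemma V_complete: "complete_wrt V NV"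
  unfolding complete_wrt_def
proof (intro allI impI, elim conjE)
  fix X :: "nat \<Rightarrow> 'a"
  assume XV: "\<forall>n. X n \<in> V" and C: "\<forall>e>0. \<exists>M. \<forall>m\<ge>M. \<forall>n\<ge>M. NV (X m - X n) < e"
  have "\<forall>k. \<exists>M. \<forall>m\<ge>M. \<forall>n\<ge>M. NV (X m - X n) < (1/2)^k" using C by simp
  then obtain M where M: "\<And>k m n. m \<ge> M k \<Longrightarrow> n \<ge> M k \<Longrightarrow> NV (X m - X n) < (1/2)^k" by metis
  \<comment> \<open>\<open>r k\<close> is at least \<open>M k\<close>, and so is
    \<open>r (Suc k)\<close>, hence the telescoping differences \<open>d k\<close> are smaller than
    (1/2)^k.\<close>
  define r where "r k = (\<Sum>j\<le>k. M j)" for k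
  have rM: "M k \<le> r k" "M k \<le> r (Suc k)" for k unfolding r_def by (simp_all add: member_le_sum trans_le_add1)
  define d where "d k = X (r (Suc k)) - X (r k)" for k
  have d: "d k \<in> V" "NV (d k) < (1/2)^k" for k
    unfolding d_def using XV V_diff(1) M[OF rM(2) rM(1)] by auto
  \<comment> \<open>Summability in X only supplies the candidate limit; closeness in
    \<open>NV\<close> comes from \<open>V_series\<close> applied to the tails.\<close>
  have nd: "norm (d k) \<le> 1 / \<kappa> * (1/2)^k" for k
  proof -
    have "\<kappa> * norm (d k) \<le> (1/2)^k" using norm_le_NV[OF d(1)[of k]] d(2)[of k] by linarith
    then show ?thesis using pos_le_divide_eq[OF \<kappa>_pos, of "norm (d k)" "(1/2)^k"] by (simp add: mult.commute)
  qed
  have "summable (\<lambda>k. 1 / \<kappa> * (1/2::real)^k)" by (intro summable_mult summable_geometric) auto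
  then have "summable d" by (rule summable_comparison_test'[where N = 0]) (rule nd)
  define x where "x = X (r 0) + suminf d"
  have tel: "(\<Sum>j<k. d j) = X (r k) - X (r 0)" for k
    unfolding d_def by (rule sum_lessThan_telescope)
  have tail: "(\<lambda>j. d (j + k)) sums (x - X (r k))" for k
    using sums_split_initial_segment[OF summable_sums[OF \<open>summable d\<close>], of k] tel[of k] by (simp add: x_def algebra_simps)
  have xr: "x - X (r k) \<in> V" "NV (x - X (r k)) \<le> 2 * (1/2)^k" for k
  proof -
    have "NV (d (j + k)) \<le> (1/2)^k * (1/2)^j" for j
      using d(2)[of "j + k"] by (simp add: power_add mult.commute)
    from V_series[of "\<lambda>j. d (j + k)", OF d(1) this tail]
    show "x - X (r k) \<in> V" "NV (x - X (r k)) \<le> 2 * (1/2)^k" .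
  qed
  have "x \<in> V" using V_add(1)[OF xr(1)[of 0] XV[rule_format, of "r 0"]] by simp
  moreover have "(\<lambda>n. NV (X n - x)) \<longlonglongrightarrow> 0"
  proof (rule LIMSEQ_I)
    fix e :: real assume "0 < e"
    moreover have "(\<lambda>k. 3 * (1/2::real)^k) \<longlonglongrightarrow> 0"
      using tendsto_mult[OF tendsto_const LIMSEQ_power_zero[of "1/2::real"], of 3] by simp
    ultimately obtain k where k: "3 * (1/2::real)^k < e"
      using order_tendstoD(2)[of "\<lambda>k. 3 * (1/2::real)^k" 0 sequentially e] by (auto simp: eventually_sequentially)
    have "norm (NV (X n - x) - 0) < e" if n: "n \<ge> M k" for n
    proof -
      have "NV (X n - x) = NV ((X n - X (r k)) - (x - X (r k)))" by simp
      also have "\<dots> \<le> NV (X n - X (r k)) + NV (x - X (r k))"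
        by (intro V_diff(2) V_diff(1) xr(1) XV[rule_format])
      also have "\<dots> < (1/2)^k + 2 * (1/2)^k"
        using M[OF n rM(1)] xr(2)[of k] by (intro add_less_le_mono)
      finally show ?thesis using k NV_nonneg[OF V_diff(1)] XV \<open>x \<in> V\<close> by simp
    qed
    then show "\<exists>no. \<forall>n\<ge>no. norm (NV (X n - x) - 0) < e" by blast
  qed
  ultimately show "\<exists>x\<in>V. (\<lambda>n. NV (X n - x)) \<longlonglongrightarrow> 0" by blast
qed

lemma V_banach: "banach_on V NV"
proof -
  have "NV x = 0 \<longleftrightarrow> x = 0" if "x \<in> V" for x
  proof
    assume "NV x = 0"
    then show "x = 0" using norm_le_NV[OF that] \<kappa>_pos by (simp add: mult_le_0_iff)
  qed (simp add: V_zero)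
  then show ?thesis
    unfolding banach_on_def subspace_scaleC_iff using V_complete by (auto simp: V_zero V_add V_scaleC NV_nonneg)
qed

section \<open>The part of A and its resolvent\<close>

lemma DV_iff: "x \<in> DV \<longleftrightarrow> x \<in> D \<and> A x \<in> V"
  unfolding part_domain_def using D_subset_V(1) by auto

lemma V_linear_operator: "linear_operator V DV A"
  unfolding linear_operator_def subspace_scaleC_iff
  by (auto simp: DV_iff D_closed A_linear V_add V_scaleC V_zero D_subset_V)

text \<open>R(z) maps \<open>V\<close> into itself by \<open>K_R\<close>, and A R(z) x = z R(z) x -
  x stays in \<open>V\<close>, so the restriction of R(z) inverts z minus the part.\<close>

lemma part_resolvent:
  assumes z: "z \<in> \<rho>"
  shows "z \<in> resolvent_set V NV DV A" "x \<in> V \<Longrightarrow> resolvent DV A z x = R z x"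
proof -
  obtain c where c: "0 \<le> c" "\<And>x. norm (R z x) \<le> c * norm x"
    using R_cbounded[OF z] cbounded_mono cboundedD(3) by (metis max.cobounded1 max.cobounded2)
  have in_DV: "R z x \<in> DV" if "x \<in> V" for x
    using that R_in[OF z] A_R[OF z] V_diff V_scaleC V_R(1)[OF that z c] by (simp add: DV_iff)
  have bij: "bij_betw (\<lambda>x. z *\<^sub>C x - A x) DV V"
  proof (rule bij_betw_byWitness[where f' = "R z"])
    show "\<forall>u\<in>DV. R z (z *\<^sub>C u - A u) = u" using R_left[OF z] by (auto simp: DV_iff)
    show "\<forall>x\<in>V. z *\<^sub>C R z x - A (R z x) = x" using A_R[OF z] by simp
    show "(\<lambda>x. z *\<^sub>C x - A x) ` DV \<subseteq> V" using V_diff V_scaleC D_subset_V by (auto simp: DV_iff)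
    show "R z ` V \<subseteq> DV" using in_DV by auto
  qed
  have eq: "resolvent DV A z x = R z x" if "x \<in> V" for x
    unfolding resolvent_def[of DV]
    by (rule inv_into_f_eq) (use bij in_DV[OF that] A_R[OF z] in \<open>auto simp: bij_betw_def\<close>)
  then show "x \<in> V \<Longrightarrow> resolvent DV A z x = R z x" .
  have "bounded_operator V NV (resolvent DV A z)"
    unfolding bounded_operator_def linear_operator_def subspace_scaleC_iff
    using V_R[OF _ z c] by (auto simp: eq V_zero V_add V_scaleC R_linear[OF z])
  with bij show "z \<in> resolvent_set V NV DV A" unfolding resolvent_set_def by simp
qed

text \<open>Since \<open>R(z, A) = A R(z, A) A\<^sup>-\<^sup>1\<close> and \<open>D \<subseteq> V\<close>, resolvent points of the part are resolvent points of \<open>A\<close>.\<close>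

lemma part_resolvent_converse:
  assumes z: "z \<in> resolvent_set V NV DV A"
    and C: "0 \<le> C" "\<And>x. x \<in> V \<Longrightarrow> NV (z *\<^sub>C resolvent DV A z x) \<le> C * NV x"
  shows "z \<in> \<rho>" "norm (R z x) \<le> (C * (c0 + 1) + c0) * norm x"
proof -
  define S where "S x = A (resolvent DV A z (- R 0 x))" for x
  have w: "- R 0 x \<in> D" "A (- R 0 x) = x" "norm (- R 0 x) \<le> c0 * norm x" for x
    using R_in[OF inv, of x] D_closed(3)[of "R 0 x" "-1"] A_linear(2)[of "R 0 x" "-1"] A_R0[of x] c0(2)[of x]
    by auto
  have S: "S x \<in> D" "z *\<^sub>C S x - A (S x) = x" "norm (S x) \<le> (C * (c0 + 1) + c0) * norm x" for x
  proof -
    define u where "u = resolvent DV A z (- R 0 x)"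
    have wV: "- R 0 x \<in> V" using D_subset_V(1)[OF w(1)] .
    have u: "u \<in> D" "A u \<in> V" "z *\<^sub>C u - A u = - R 0 x"
      using resolvent_in[OF z wV] by (auto simp: u_def DV_iff)
    have Au: "A u = z *\<^sub>C u - (- R 0 x)" using u(3) by (simp add: algebra_simps)
    have Su: "S x = A u" by (simp add: S_def u_def)
    show "S x \<in> D" unfolding Su Au by (intro D_closed u w)
    have "A (S x) = z *\<^sub>C A u - x"
      unfolding Su by (subst Au) (simp only: A_linear D_closed u w)
    then show "z *\<^sub>C S x - A (S x) = x" by (simp add: Su)
    \<comment> \<open>X is reached from \<open>V\<close> by \<open>norm_le_NV\<close>, and
      \<open>V\<close> from the graph norm of A^-1 x by \<open>D_subset_V\<close>. Both carry
      \<kappa>, so it cancels and only \<open>c0\<close> and \<open>C\<close> remain.\<close>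
    have "\<kappa> * norm (z *\<^sub>C u) \<le> NV (z *\<^sub>C u)"
      using D_subset_V(1)[OF u(1)] by (intro norm_le_NV V_scaleC)
    also have "\<dots> \<le> C * NV (- R 0 x)" unfolding u_def by (rule C(2)[OF wV])
    also have "\<dots> \<le> C * (\<kappa> * (norm (- R 0 x) + norm x))"
      using D_subset_V(2)[OF w(1), of x] w(2)[of x] C(1) by (intro mult_left_mono) auto
    also have "\<dots> \<le> C * (\<kappa> * (c0 * norm x + norm x))"
      using w(3)[of x] C(1) \<kappa>_pos by (intro mult_left_mono add_right_mono) auto
    also have "\<dots> = \<kappa> * (C * (c0 + 1) * norm x)" by (simp add: algebra_simps)
    finally have "norm (z *\<^sub>C u) \<le> C * (c0 + 1) * norm x" using \<kappa>_pos by simp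
    then show "norm (S x) \<le> (C * (c0 + 1) + c0) * norm x"
      unfolding Su Au using norm_triangle_ineq4[of "z *\<^sub>C u" "- R 0 x"] w(3)[of x] by (simp add: algebra_simps)
  qed
  have Vinj: "inj_on (\<lambda>x. z *\<^sub>C x - A x) DV" using z by (simp add: resolvent_set_def bij_betw_def)
  have inj: "inj_on (\<lambda>x. z *\<^sub>C x - A x) D"
  proof (rule inj_onI)
    fix u v assume uv: "u \<in> D" "v \<in> D" "z *\<^sub>C u - A u = z *\<^sub>C v - A v"
    then have 0: "z *\<^sub>C (u - v) - A (u - v) = 0"
      by (simp add: A_linear scaleC.scale_right_diff_distrib algebra_simps)
    have "u - v \<in> D" using uv D_closed by auto
    moreover have "A (u - v) \<in> V" using 0 V_scaleC(1)[OF D_subset_V(1)[OF \<open>u - v \<in> D\<close>], of z] by simp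
    ultimately have "u - v \<in> DV" "0 \<in> DV" using D_closed(1) A_linear(4) V_zero by (auto simp: DV_iff)
    from inj_onD[OF Vinj _ this] 0 A_linear(4) show "u = v" by simp
  qed
  have "x \<in> (\<lambda>x. z *\<^sub>C x - A x) ` D" for x
    by (rule image_eqI[of _ _ "S x"]) (simp_all add: S(1,2))
  then have bij: "bij_betw (\<lambda>x. z *\<^sub>C x - A x) D UNIV"
    unfolding bij_betw_def using inj by blast
  have eq: "R z x = S x" for x
    unfolding resolvent_def by (rule inv_into_f_eq[OF inj S(1) S(2)])
  have lin: "S (x + y) = S x + S y" "S (a *\<^sub>C x) = a *\<^sub>C S x" for x y a
  proof -
    have "z *\<^sub>C (S x + S y) - A (S x + S y) = z *\<^sub>C S (x + y) - A (S (x + y))"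
      using S(2)[of x] S(2)[of y] S(2)[of "x + y"] by (simp add: A_linear S(1) scaleC_add_right algebra_simps)
    from inj_onD[OF inj this] show "S (x + y) = S x + S y" by (simp add: S(1) D_closed)
    have "z *\<^sub>C (a *\<^sub>C S x) - A (a *\<^sub>C S x) = a *\<^sub>C (z *\<^sub>C S x - A (S x))"
      by (simp add: A_linear S(1) scaleC.scale_right_diff_distrib scaleC_scaleC mult.commute)
    then have "z *\<^sub>C (a *\<^sub>C S x) - A (a *\<^sub>C S x) = z *\<^sub>C S (a *\<^sub>C x) - A (S (a *\<^sub>C x))"
      unfolding S(2) .
    from inj_onD[OF inj this] show "S (a *\<^sub>C x) = a *\<^sub>C S x" by (simp add: S(1) D_closed)
  qed
  have "cbounded (R z) (C * (c0 + 1) + c0)" unfolding cbounded_def eq using lin S(3) by blast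
  then show "z \<in> \<rho>" "norm (R z x) \<le> (C * (c0 + 1) + c0) * norm x"
    using bij cboundedD(3) by (auto simp: resolvent_set_def bounded_operator_UNIV_iff)
qed

text \<open>The resolvent of the part is a restriction of R(z), and interpolation keeps its bound;
  so every angle of A is an angle of the part, with the same constants up to
  \<open>max 0\<close>.\<close>

lemma part_sectorial:
  assumes "sectorial_of_angle UNIV norm D A \<theta>"
  shows "sectorial_of_angle V NV DV A \<theta>"
proof -
  have s: "0 < \<theta>" "\<theta> < pi" "op_spectrum UNIV norm D A \<subseteq> closure (sector \<theta>)"
    using assms unfolding sectorial_of_angle_def by auto
  have sp: "op_spectrum V NV DV A \<subseteq> closure (sector \<theta>)"
    using s(3) part_resolvent(1) unfolding op_spectrum_def by blast
  have "\<exists>C. \<forall>\<mu>. \<mu> \<notin> sector \<phi>' \<longrightarrow> (\<forall>x\<in>V. NV (\<mu> *\<^sub>C resolvent DV A \<mu> x) \<le> C * NV x)"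
    if \<phi>': "\<theta> < \<phi>'" "\<phi>' < pi" for \<phi>'
  proof -
    obtain C where C: "\<And>\<mu> x. \<mu> \<in> far \<phi>' \<Longrightarrow> norm (\<mu> *\<^sub>C R \<mu> x) \<le> C * norm x"
      using sectorial_of_angle_far(2)[OF assms \<phi>'] by auto
    have "NV (\<mu> *\<^sub>C resolvent DV A \<mu> x) \<le> max 0 C * NV x" if \<mu>: "\<mu> \<notin> sector \<phi>'" and x: "x \<in> V" for \<mu> x
    proof (cases "\<mu> = 0")
      case True
      then show ?thesis using NV_nonneg[OF x] V_zero by simp
    next
      case False
      then have far: "\<mu> \<in> far \<phi>'" using \<mu> by (auto simp: far_def sector_def)
      then have \<rho>: "\<mu> \<in> \<rho>" using sectorial_of_angle_far(1)[OF assms \<phi>'] by blast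
      have "norm (R \<mu> y) \<le> max 0 C / cmod \<mu> * norm y" for y
        using C[OF far, of y] mult_right_mono[of C "max 0 C" "norm y"] False by (simp add: norm_scaleC field_simps)
      from V_R[OF x \<rho> _ this] have "R \<mu> x \<in> V" "NV (R \<mu> x) \<le> max 0 C / cmod \<mu> * NV x" by auto
      then show ?thesis
        using False by (simp add: part_resolvent(2)[OF \<rho> x] V_scaleC(2) field_simps)
    qed
    then show ?thesis by blast
  qed
  then show ?thesis
    unfolding sectorial_of_angle_def using s(1,2) sp V_banach V_linear_operator by blast
qed

end

section \<open>Operator integrals along rays\<close>

abbreviation riemann_sum :: "(real \<times> real set) set \<Rightarrow> (real \<Rightarrow> 'b::real_vector) \<Rightarrow> 'b" where
  "riemann_sum p g \<equiv> \<Sum>(t, k)\<in>p. measure lborel k *\<^sub>R g t"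

text \<open>On each cell the sample value differs from the integrand by at most w, and the cells
  have total length b - a. With w proportional to |x| this yields convergence in operator
  norm.\<close>

lemma riemann_sum_error:
  fixes g :: "real \<Rightarrow> 'b::banach"
  assumes g: "continuous_on {a..b} g" and "a \<le> b" and p: "p tagged_division_of {a..b}"
    and fine: "(\<lambda>t. ball t \<delta>) fine p"
    and w: "\<And>s t. s \<in> {a..b} \<Longrightarrow> t \<in> {a..b} \<Longrightarrow> \<bar>s - t\<bar> < \<delta> \<Longrightarrow> norm (g s - g t) \<le> w" "0 \<le> w"
  shows "norm (riemann_sum p g - integral {a..b} g) \<le> w * (b - a)"
proof -
  have p': "p tagged_division_of cbox a b" using p by simp
  have int: "g integrable_on cbox a b" using g integrable_continuous_real by simp
  have "norm (riemann_sum p g - integral {a..b} g)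
      = norm (\<Sum>(t, k)\<in>p. measure lborel k *\<^sub>R g t - integral k g)"
    using integral_combine_tagged_division_topdown[OF int p'] by (simp add: sum_subtractf split_beta)
  also have "\<dots> \<le> (\<Sum>(t, k)\<in>p. w * measure lborel k)"
    unfolding split_beta
  proof (rule sum_norm_le)
    fix x assume x: "x \<in> p"
    obtain t k where xtk: "x = (t, k)" by force
    have tk: "t \<in> k" "k \<subseteq> {a..b}" "k \<subseteq> ball t \<delta>"
      using tagged_division_ofD(2,3)[OF p] fineD[OF fine] x xtk by simp_all
    obtain c d where k: "k = cbox c d" using tagged_division_ofD(4)[OF p] x unfolding xtk by blast
    have ik: "g integrable_on k" using integrable_on_subcbox[OF int] tk(2) k by simp
    have "((\<lambda>s. g t - g s) has_integral (measure lborel k *\<^sub>R g t - integral k g)) (cbox c d)"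
      using has_integral_diff[OF has_integral_const[of "g t" c d] integrable_integral[OF ik[unfolded k]]] k by simp
    moreover have "norm (g t - g s) \<le> w" if "s \<in> cbox c d" for s
      using that tk k by (intro w(1)) (auto simp: dist_real_def)
    ultimately have "norm (measure lborel k *\<^sub>R g t - integral k g) \<le> w * measure lborel k"
      using has_integral_bound[OF w(2)] k by metis
    then show "norm (measure lborel (snd x) *\<^sub>R g (fst x) - integral (snd x) g) \<le> w * measure lborel (snd x)"
      by (simp add: xtk)
  qed
  also have "\<dots> = w * (b - a)"
    using additive_content_tagged_division[OF p'] \<open>a \<le> b\<close> by (simp add: split_beta flip: sum_distrib_left)
  finally show ?thesis .
qed

lemma has_operator_integralD:
  assumes "has_operator_integral V N G T a b" "0 < e"
  obtains \<delta> where "0 < \<delta>" "\<And>p x. p tagged_division_of {a..b} \<Longrightarrow> (\<lambda>t. ball t \<delta>) fine p \<Longrightarrow> x \<in> V \<Longrightarrow>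
    N (riemann_sum p (\<lambda>t. G t x) - T x) \<le> e * N x"
proof -
  from assms(1)[unfolded has_operator_integral_def, THEN conjunct2, THEN spec, THEN mp, OF assms(2)]
  obtain \<delta> where "0 < \<delta>" "\<forall>p. p tagged_division_of {a..b} \<and> (\<lambda>t. ball t \<delta>) fine p \<longrightarrow>
      (\<forall>x\<in>V. N (riemann_sum p (\<lambda>t. G t x) - T x) \<le> e * N x)"
    by (elim exE conjE)
  then show thesis by (intro that[of \<delta>]) (simp_all)
qed

section \<open>Continuity and differentiability of the resolvent\<close>

context invertible_op
begin

lemma R_lipschitz:
  assumes "z \<in> \<rho>" "w \<in> \<rho>" "0 \<le> B" "\<And>x. norm (R z x) \<le> B * norm x" "\<And>x. norm (R w x) \<le> B * norm x"
  shows "norm (R z x - R w x) \<le> cmod (w - z) * (B * B) * norm x"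
proof -
  have "norm (R z (R w x)) \<le> B * (B * norm x)"
    using assms(4)[of "R w x"] mult_left_mono[OF assms(5)[of x] assms(3)] by linarith
  from mult_left_mono[OF this norm_ge_zero[of "w - z"]] show ?thesis
    by (simp add: R_diff[OF assms(1,2)] norm_scaleC mult.assoc)
qed

lemma R_continuous_on:
  assumes "Z \<subseteq> \<rho>" "0 \<le> B" "\<And>z x. z \<in> Z \<Longrightarrow> norm (R z x) \<le> B * norm x"
  shows "continuous_on Z (\<lambda>z. R z x)"
  unfolding continuous_on_def
proof
  fix w assume w: "w \<in> Z"
  have "((\<lambda>z. cmod (w - z) * (B * B) * norm x) \<longlongrightarrow> cmod (w - w) * (B * B) * norm x) (at w within Z)"
    by (intro tendsto_intros)
  then have l: "((\<lambda>z. cmod (w - z) * (B * B) * norm x) \<longlongrightarrow> 0) (at w within Z)" by simp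
  have "((\<lambda>z. R z x - R w x) \<longlongrightarrow> 0) (at w within Z)"
  proof (rule Lim_null_comparison[OF _ l])
    show "\<forall>\<^sub>F z in at w within Z. norm (R z x - R w x) \<le> cmod (w - z) * (B * B) * norm x"
      unfolding eventually_at_filter
      by (intro always_eventually allI impI R_lipschitz) (use assms w in auto)
  qed
  then show "((\<lambda>z. R z x) \<longlongrightarrow> R w x) (at w within Z)" by (rule LIM_zero_cancel)
qed

lemma R_vholo:
  assumes "Z \<subseteq> \<rho>" "0 \<le> B" "\<And>z x. z \<in> Z \<Longrightarrow> norm (R z x) \<le> B * norm x"
  shows "vholo (\<lambda>z. R z x) Z"
  unfolding vholo_def
proof (intro exI conjI ballI)
  have c: "continuous_on Z (\<lambda>z. R z y)" for y using assms by (rule R_continuous_on)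
  show "continuous_on Z (\<lambda>z. - R z (R z x))"
  proof (rule continuous_on_minus)
    \<comment> \<open>Both occurrences of z vary, so R(z) R(z) x is split into R(z) (R(z) x - R(w)
      x) + R(z) R(w) x; the uniform bound \<open>B\<close> controls the first term.\<close>
    show "continuous_on Z (\<lambda>z. R z (R z x))"
      unfolding continuous_on_def
    proof
      fix w assume w: "w \<in> Z"
      have "((\<lambda>z. R z x - R w x) \<longlongrightarrow> 0) (at w within Z)"
        using c[of x] w unfolding continuous_on_def by (auto intro: LIM_zero)
      then have "((\<lambda>z. B * norm (R z x - R w x)) \<longlongrightarrow> 0) (at w within Z)"
        using tendsto_mult_right_zero tendsto_norm_zero by blast
      then have "((\<lambda>z. R z (R z x - R w x)) \<longlongrightarrow> 0) (at w within Z)"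
        by (rule Lim_null_comparison[rotated]) (use assms in \<open>auto simp: eventually_at_filter\<close>)
      moreover have "((\<lambda>z. R z (R w x)) \<longlongrightarrow> R w (R w x)) (at w within Z)"
        using c[of "R w x"] w unfolding continuous_on_def by auto
      ultimately have "((\<lambda>z. R z (R z x - R w x) + R z (R w x)) \<longlongrightarrow> 0 + R w (R w x)) (at w within Z)"
        by (rule tendsto_add)
      then have "((\<lambda>z. R z (R z x - R w x) + R z (R w x)) \<longlongrightarrow> R w (R w x)) (at w within Z)" by simp
      then show "((\<lambda>z. R z (R z x)) \<longlongrightarrow> R w (R w x)) (at w within Z)"
        by (rule Lim_transform_eventually)
          (use assms(1) in \<open>auto simp: eventually_at_filter R_linear(3)[OF subsetD[OF assms(1)]]\<close>)
    qed
  qed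
  fix w assume w: "w \<in> Z"
  show "((\<lambda>z. R z x) has_derivative (\<lambda>h. h *\<^sub>C - R w (R w x))) (at w within Z)"
    unfolding has_derivative_within
  proof (intro conjI bounded_linear_scaleC_left)
    have "((\<lambda>z. R z (R w x) - R w (R w x)) \<longlongrightarrow> 0) (at w within Z)"
      using c[of "R w x"] w unfolding continuous_on_def by (auto intro: LIM_zero)
    then show "((\<lambda>y. (1 / norm (y - w)) *\<^sub>R (R y x - (R w x + (y - w) *\<^sub>C - R w (R w x)))) \<longlongrightarrow> 0) (at w within Z)"
    proof (rule Lim_null_comparison[rotated, OF tendsto_norm_zero])
      have "norm ((1 / norm (y - w)) *\<^sub>R (R y x - (R w x + (y - w) *\<^sub>C - R w (R w x)))) \<le> norm (R y (R w x) - R w (R w x))"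
        if y: "y \<in> Z" for y
      proof -
        have "R y x - (R w x + (y - w) *\<^sub>C - R w (R w x)) = (w - y) *\<^sub>C R y (R w x) - (w - y) *\<^sub>C R w (R w x)"
          using R_diff[of y w x] y w assms(1) by (auto simp: algebra_simps scaleC.scale_left_diff_distrib)
        also have "\<dots> = (w - y) *\<^sub>C (R y (R w x) - R w (R w x))"
          by (simp add: scaleC.scale_right_diff_distrib)
        finally show ?thesis by (simp add: norm_scaleC norm_minus_commute)
      qed
      then show "\<forall>\<^sub>F y in at w within Z. norm ((1 / norm (y - w)) *\<^sub>R (R y x - (R w x + (y - w) *\<^sub>C - R w (R w x))))
          \<le> norm (R y (R w x) - R w (R w x))"
        by (simp add: eventually_at_filter)
    qed
  qed
qed

end

section \<open>From operator integrals on \<open>V\<close> to integrals in X\<close>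

context interp_op
begin

text \<open>\<kappa> converts an error in \<open>NV\<close> into one in X; the denominator NV x + 1
  of the witness admits x = 0.\<close>

lemma NV_tolerance:
  assumes "x \<in> V" "0 < e"
  obtains e' where "0 < e'" "e' * NV x < e * \<kappa>"
proof
  have n: "0 \<le> NV x" using NV_nonneg[OF assms(1)] .
  show "0 < e * \<kappa> / (2 * (NV x + 1))" using assms(2) \<kappa>_pos n by simp
  have "e * \<kappa> / (2 * (NV x + 1)) * NV x \<le> e * \<kappa> / 2" using assms(2) \<kappa>_pos n by (simp add: field_simps)
  also have "\<dots> < e * \<kappa>" using assms(2) \<kappa>_pos by simp
  finally show "e * \<kappa> / (2 * (NV x + 1)) * NV x < e * \<kappa>" .
qed

text \<open>\<open>NV\<close> dominates \<kappa> times the norm of X, so convergence of Riemann sums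
  in \<open>NV\<close> implies convergence in X; balls of constant radius form a gauge.\<close>

lemma has_operator_integral_imp_integral:
  assumes "has_operator_integral V NV G T a b" "x \<in> V" "\<And>t. t \<in> {a..b} \<Longrightarrow> G t x \<in> V"
  shows "((\<lambda>t. G t x) has_integral T x) {a..b}"
  unfolding has_integral_real
proof (intro allI impI)
  fix e :: real assume e: "e > 0"
  have TV: "T x \<in> V"
    using assms(1,2) unfolding has_operator_integral_def bounded_operator_def linear_operator_def by auto
  obtain e' where e': "0 < e'" "e' * NV x < e * \<kappa>" using NV_tolerance[OF assms(2) e] .
  obtain \<delta> where \<delta>: "\<delta> > 0" "\<And>p x. p tagged_division_of {a..b} \<Longrightarrow> (\<lambda>t. ball t \<delta>) fine p \<Longrightarrow> x \<in> V \<Longrightarrow>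
      NV (riemann_sum p (\<lambda>t. G t x) - T x) \<le> e' * NV x"
    by (rule has_operator_integralD[OF assms(1) e'(1)], rule that; blast)
  have "norm (riemann_sum p (\<lambda>t. G t x) - T x) < e"
    if p: "p tagged_division_of {a..b}" "(\<lambda>t. ball t \<delta>) fine p" for p
  proof -
    have "riemann_sum p (\<lambda>t. G t x) \<in> V"
      unfolding split_beta scaleR_eq_scaleC
      using tag_in_interval[OF p(1)] by (intro V_sum V_scaleC assms(3)) auto
    then have "\<kappa> * norm (riemann_sum p (\<lambda>t. G t x) - T x) \<le> e' * NV x"
      using norm_le_NV[OF V_diff(1)[OF _ TV]] \<delta>(2)[OF p assms(2)] by (meson order_trans)
    also have "\<dots> < e * \<kappa>" by (rule e'(2))
    finally show ?thesis using \<kappa>_pos by (simp add: mult.commute)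
  qed
  then show "\<exists>\<gamma>. gauge \<gamma> \<and> (\<forall>\<D>. \<D> tagged_division_of {a..b} \<and> \<gamma> fine \<D> \<longrightarrow>
      norm ((\<Sum>(x', k)\<in>\<D>. measure lborel k *\<^sub>R G x' x) - T x) < e)"
    using \<delta>(1) by (intro exI[of _ "\<lambda>t. ball t \<delta>"]) (auto simp: gauge_def)
qed

text \<open>Whatever operator the choice in \<open>ray_integral\<close> selects, its values on
  \<open>V\<close> are pinned down as limits of integrals in X.\<close>

lemma has_improper_imp_lim:
  assumes "has_improper_operator_integral V NV G T" "x \<in> V" "\<And>t. 0 < t \<Longrightarrow> G t x \<in> V"
  shows "(\<lambda>n. integral (window n) (\<lambda>t. G t x)) \<longlonglongrightarrow> T x"
proof (rule LIMSEQ_I)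
  fix e :: real assume e: "e > 0"
  obtain I where I: "\<And>a b. 0 < a \<Longrightarrow> a < b \<Longrightarrow> has_operator_integral V NV G (I a b) a b"
    and lim: "\<And>e. e > 0 \<Longrightarrow> \<exists>a0>0. \<exists>b0>a0. \<forall>a b. 0 < a \<and> a \<le> a0 \<and> b0 \<le> b \<longrightarrow>
           (\<forall>x\<in>V. NV (I a b x - T x) \<le> e * NV x)"
    and TV: "T x \<in> V"
    using assms(1,2) unfolding has_improper_operator_integral_def bounded_operator_def linear_operator_def by blast
  obtain e' where e': "0 < e'" "e' * NV x < e * \<kappa>" using NV_tolerance[OF assms(2) e] .
  obtain a0 b0 where a0: "0 < a0" "a0 < b0"
    and ab: "\<And>a b. 0 < a \<Longrightarrow> a \<le> a0 \<Longrightarrow> b0 \<le> b \<Longrightarrow> NV (I a b x - T x) \<le> e' * NV x"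
    using lim[OF e'(1)] assms(2) by blast
  obtain n1 where n1: "1 / a0 < real n1" using reals_Archimedean2 by blast
  obtain n2 where n2: "b0 < real n2" using reals_Archimedean2 by blast
  show "\<exists>no. \<forall>n\<ge>no. norm (integral (window n) (\<lambda>t. G t x) - T x) < e"
  proof (intro exI allI impI)
    fix m assume m: "max n1 n2 \<le> m"
    let ?a = "1 / real (Suc m)" and ?b = "real (Suc m)"
    have "1 / a0 < ?b" using n1 m by (simp add: max_def split: if_splits)
    then have a: "0 < ?a" "?a \<le> a0" using a0 by (simp_all add: field_simps del: of_nat_Suc)
    have b: "b0 \<le> ?b" using n2 m by (simp add: max_def split: if_splits)
    have lt: "?a < ?b" using a b a0 by linarith
    have int: "((\<lambda>t. G t x) has_integral I ?a ?b x) {?a..?b}"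
      by (rule has_operator_integral_imp_integral[OF I[OF a(1) lt] assms(2)], rule assms(3))
        (use less_le_trans[OF a(1)] in \<open>simp del: of_nat_Suc\<close>)
    have IV: "I ?a ?b x \<in> V"
      using I[OF a(1) lt] assms(2) unfolding has_operator_integral_def bounded_operator_def linear_operator_def by auto
    have "\<kappa> * norm (I ?a ?b x - T x) \<le> e' * NV x"
      using norm_le_NV[OF V_diff(1)[OF IV TV]] ab[OF a b] by linarith
    also have "\<dots> < e * \<kappa>" by (rule e'(2))
    finally have "norm (I ?a ?b x - T x) < e" using \<kappa>_pos by (simp add: mult.commute)
    then show "norm (integral {?a..?b} (\<lambda>t. G t x) - T x) < e" using integral_unique[OF int] by simp
  qed
qed

end

section \<open>Existence of the ray integrals\<close>

text \<open>The two bounds serve different ends: \<open>B\<close> gives continuity in X on compact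
  intervals, whereas \<open>M\<close> bounds the integrand in \<open>NV\<close> by an integrable
  function on the whole ray. The weight \<open>c\<close> is meant to include the direction of the
  ray.\<close>

locale contour_ray = interp_op +
  fixes Z :: "complex set" and B C :: real and \<theta> :: real and c :: "real \<Rightarrow> complex" and M :: real
  assumes Z: "Z \<subseteq> \<rho>" and B: "0 \<le> B" "\<And>z x. z \<in> Z \<Longrightarrow> norm (R z x) \<le> B * norm x"
    and ray: "\<And>r. 0 < r \<Longrightarrow> rcis r \<theta> \<in> Z"
    and c: "continuous_on {0<..} c"
    and M: "0 \<le> M" "\<And>r x. 0 < r \<Longrightarrow> x \<in> V \<Longrightarrow> NV (c r *\<^sub>C R (rcis r \<theta>) x) \<le> M / (1 + r)\<^sup>2 * NV x"
begin

abbreviation "RV \<equiv> \<lambda>r x. c r *\<^sub>C resolvent DV A (rcis r \<theta>) x"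

text \<open>Defined on all of X, where the integral \<open>I\<close> can be formed; on
  \<open>V\<close> it agrees with \<open>RV\<close>.\<close>

definition G :: "real \<Rightarrow> 'a \<Rightarrow> 'a" where "G r x = c r *\<^sub>C R (rcis r \<theta>) x"
definition I :: "real \<Rightarrow> real \<Rightarrow> 'a \<Rightarrow> 'a" where "I a b x = integral {a..b} (\<lambda>r. G r x)"

lemma G_V: "0 < r \<Longrightarrow> x \<in> V \<Longrightarrow> G r x \<in> V"
  unfolding G_def using V_R(1)[OF _ _ B(1)] Z ray B V_scaleC by (metis subsetD)

lemma G_eq: "0 < r \<Longrightarrow> x \<in> V \<Longrightarrow> RV r x = G r x"
  unfolding G_def using part_resolvent(2) Z ray by (metis subsetD)

lemma G_continuous: "continuous_on {0<..} (\<lambda>r. G r x)"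
  unfolding G_def
  by (intro continuous_on_scaleC c continuous_on_ray[OF R_continuous_on[OF Z B]]) (auto intro: ray)

lemma G_integrable: "0 < a \<Longrightarrow> (\<lambda>r. G r x) integrable_on {a..b}"
  by (rule integrable_continuous_real[OF continuous_on_subset[OF G_continuous]]) auto

lemma G_cbounded: "0 < r \<Longrightarrow> cbounded (G r) (cmod (c r) * B)"
  unfolding G_def using Z ray[of r] B
  by (intro cbounded_scaleC) (auto simp: cbounded_def R_linear[OF subsetD[OF Z ray]])

lemma G_R0: "0 < r \<Longrightarrow> G r (R 0 x) = R 0 (G r x)"
  unfolding G_def using R_commute[OF subsetD[OF Z ray] inv] by (simp add: R_linear[OF inv])

lemma I_linear:
  assumes "0 < a"
  shows "I a b (x + y) = I a b x + I a b y" "I a b (k *\<^sub>C x) = k *\<^sub>C I a b x"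
    "I a b (R 0 x) = R 0 (I a b x)"
proof -
  have pos: "0 < r" if "r \<in> {a..b}" for r using that assms by auto
  have "I a b (x + y) = integral {a..b} (\<lambda>r. G r x + G r y)"
    unfolding I_def using cboundedD(1)[OF G_cbounded[OF pos]] by (intro integral_cong) auto
  also have "\<dots> = I a b x + I a b y"
    unfolding I_def by (intro integral_add G_integrable assms)
  finally show "I a b (x + y) = I a b x + I a b y" .
  have "I a b (k *\<^sub>C x) = integral {a..b} ((\<lambda>v. k *\<^sub>C v) \<circ> (\<lambda>r. G r x))"
    unfolding I_def using cboundedD(2)[OF G_cbounded[OF pos]] by (intro integral_cong) auto
  also have "\<dots> = k *\<^sub>C I a b x"
    unfolding I_def by (intro integral_linear G_integrable assms bounded_linear_scaleC_right)
  finally show "I a b (k *\<^sub>C x) = k *\<^sub>C I a b x" .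
  have "I a b (R 0 x) = integral {a..b} (R 0 \<circ> (\<lambda>r. G r x))"
    unfolding I_def using G_R0[OF pos] by (intro integral_cong) auto
  also have "\<dots> = R 0 (I a b x)"
    unfolding I_def by (intro integral_linear G_integrable assms R_bounded_linear inv)
  finally show "I a b (R 0 x) = R 0 (I a b x)" .
qed

lemma G_uniform:
  assumes a: "0 < a" "a \<le> b" and e: "0 < e"
  obtains \<delta> where "0 < \<delta>"
    "\<And>r s x. r \<in> {a..b} \<Longrightarrow> s \<in> {a..b} \<Longrightarrow> \<bar>r - s\<bar> < \<delta> \<Longrightarrow> norm (G r x - G s x) \<le> e * norm x"
proof -
  have cc: "continuous_on {a..b} c" using a by (intro continuous_on_subset[OF c]) auto
  have "uniformly_continuous_on {a..b} c" by (rule compact_uniformly_continuous[OF cc]) auto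
  moreover have "0 < e / (2 * (B + 1))" using e B(1) by simp
  ultimately obtain \<delta>1 where \<delta>1: "0 < \<delta>1"
    "\<And>r s. r \<in> {a..b} \<Longrightarrow> s \<in> {a..b} \<Longrightarrow> dist s r < \<delta>1 \<Longrightarrow> dist (c s) (c r) < e / (2 * (B + 1))"
    unfolding uniformly_continuous_on_def by metis
  have "bounded (c ` {a..b})" by (intro compact_imp_bounded compact_continuous_image cc) auto
  then obtain L where L: "0 < L" "\<And>r. r \<in> {a..b} \<Longrightarrow> cmod (c r) \<le> L"
    unfolding bounded_pos by auto
  \<comment> \<open>One half of e pays for the change of \<open>c\<close>, the other for the change
    of the resolvent. The added 1 in each denominator avoids division by 0.\<close>
  define \<delta> where "\<delta> = min \<delta>1 (e / (2 * (L * (B * B) + 1)))"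
  show ?thesis
  proof
    show "0 < \<delta>" using \<delta>1(1) e L(1) B(1) by (simp add: \<delta>_def add_nonneg_pos)
    fix r s x assume rs: "r \<in> {a..b}" "s \<in> {a..b}" "\<bar>r - s\<bar> < \<delta>"
    let ?R = "\<lambda>r. R (rcis r \<theta>) x"
    have "G r x - G s x = (c r - c s) *\<^sub>C ?R r + c s *\<^sub>C (?R r - ?R s)"
      by (simp add: G_def scaleC.scale_left_diff_distrib scaleC.scale_right_diff_distrib)
    then have "norm (G r x - G s x) \<le> cmod (c r - c s) * norm (?R r) + cmod (c s) * norm (?R r - ?R s)"
      using norm_triangle_ineq[of "(c r - c s) *\<^sub>C ?R r" "c s *\<^sub>C (?R r - ?R s)"] by (simp add: norm_scaleC)
    also have "\<dots> \<le> e / 2 * norm x + e / 2 * norm x"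
    proof (rule add_mono)
      have "cmod (c r - c s) * norm (?R r) \<le> e / (2 * (B + 1)) * (B * norm x)"
        using \<delta>1(2)[of s r] rs a ray e B(1) by (intro mult_mono B(2)) (auto simp: dist_norm \<delta>_def)
      also have "\<dots> \<le> e / 2 * norm x"
        using e B(1) by (simp add: field_simps)
      finally show "cmod (c r - c s) * norm (?R r) \<le> e / 2 * norm x" .
      have "norm (?R r - ?R s) \<le> cmod (rcis s \<theta> - rcis r \<theta>) * (B * B) * norm x"
        using rs a Z ray B by (intro R_lipschitz) auto
      also have "cmod (rcis s \<theta> - rcis r \<theta>) = \<bar>r - s\<bar>"
        by (simp add: rcis_def norm_mult abs_minus_commute flip: left_diff_distrib of_real_diff)
      finally have "cmod (c s) * norm (?R r - ?R s) \<le> L * (\<bar>r - s\<bar> * (B * B) * norm x)"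
        using L rs by (intro mult_mono) auto
      also have "\<dots> = \<bar>r - s\<bar> * (L * (B * B)) * norm x" by (simp add: algebra_simps)
      also have "\<dots> \<le> e / (2 * (L * (B * B) + 1)) * (L * (B * B)) * norm x"
        using rs L(1) by (intro mult_right_mono) (auto simp: \<delta>_def)
      also have "\<dots> \<le> e / 2 * norm x"
      proof (rule mult_right_mono)
        have "0 \<le> L * (B * B)" using L(1) by simp
        then show "e / (2 * (L * (B * B) + 1)) * (L * (B * B)) \<le> e / 2" using e by (simp add: field_simps)
      qed simp
      finally show "cmod (c s) * norm (?R r - ?R s) \<le> e / 2 * norm x" .
    qed
    finally show "norm (G r x - G s x) \<le> e * norm x" by simp
  qed
qed

lemma I_cbounded:
  assumes a: "0 < a" "a \<le> b"
  shows "\<exists>k\<ge>0. cbounded (I a b) k"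
proof -
  have "bounded (c ` {a..b})"
    using a by (intro compact_imp_bounded compact_continuous_image continuous_on_subset[OF c]) auto
  then obtain L where L: "0 < L" "\<And>r. r \<in> {a..b} \<Longrightarrow> cmod (c r) \<le> L"
    unfolding bounded_pos by auto
  have "norm (I a b x) \<le> (L * B * (b - a)) * norm x" for x
  proof -
    have "norm (I a b x) \<le> (L * B * norm x) * (b - a)"
      unfolding I_def
    proof (rule integral_bound[OF a(2)])
      show "continuous_on {a..b} (\<lambda>r. G r x)" using a by (intro continuous_on_subset[OF G_continuous]) auto
      fix r assume r: "r \<in> {a..b}"
      have "norm (G r x) \<le> cmod (c r) * B * norm x" using cboundedD(3)[OF G_cbounded] r a by auto
      also have "\<dots> \<le> L * B * norm x" using L(2)[OF r] B(1) by (intro mult_right_mono) auto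
      finally show "norm (G r x) \<le> L * B * norm x" .
    qed
    then show ?thesis by (simp add: algebra_simps)
  qed
  then have "cbounded (I a b) (L * B * (b - a))"
    unfolding cbounded_def using I_linear[OF a(1)] by auto
  then show ?thesis using L(1) B(1) a by (intro exI[of _ "L * B * (b - a)"]) auto
qed

lemma I_V: "0 < a \<Longrightarrow> a \<le> b \<Longrightarrow> x \<in> V \<Longrightarrow> I a b x \<in> V"
  using I_cbounded[of a b] V_op(1)[of x _ "I a b"] I_linear(3)[of a b] by blast

text \<open>The error of a Riemann sum is an operator that commutes with A^-1 and has bound e on X,
  so \<open>V_op\<close> gives the same bound in \<open>NV\<close>.\<close>

lemma operator_integral:
  assumes a: "0 < a" "a < b"
  shows "has_operator_integral V NV RV (I a b) a b"
  unfolding has_operator_integral_def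
proof (intro conjI allI impI)
  obtain k where k: "0 \<le> k" "cbounded (I a b) k" using I_cbounded a by (meson less_imp_le)
  show "bounded_operator V NV (I a b)"
    unfolding bounded_operator_def linear_operator_def subspace_scaleC_iff
    using V_op[OF _ k I_linear(3)[OF a(1)]] I_linear(1,2)[OF a(1)] by (auto simp: V_zero V_add V_scaleC)
  fix e :: real assume e: "0 < e"
  then have "0 < e / (b - a)" using a by simp
  then obtain \<delta> where \<delta>: "0 < \<delta>"
    "\<And>r s x. r \<in> {a..b} \<Longrightarrow> s \<in> {a..b} \<Longrightarrow> \<bar>r - s\<bar> < \<delta> \<Longrightarrow> norm (G r x - G s x) \<le> e / (b - a) * norm x"
    using G_uniform[of a b "e / (b - a)"] a by (metis less_imp_le)
  have "NV (riemann_sum p (\<lambda>t. RV t x) - I a b x) \<le> e * NV x"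
    if p: "p tagged_division_of {a..b}" "(\<lambda>t. ball t \<delta>) fine p" and x: "x \<in> V" for p x
  proof -
    have tag: "0 < t" if "(t, k) \<in> p" for t k
      using tag_in_interval[OF p(1) that] a by auto
    have fin: "finite p" using tagged_division_of_finite[OF p(1)] .
    define E where "E y = riemann_sum p (\<lambda>t. G t y) - I a b y" for y
    have "cbounded E e"
      unfolding cbounded_def
    proof (intro conjI allI)
      fix y z and w
      show "E (y + z) = E y + E z"
        using tag cboundedD(1)[OF G_cbounded]
        by (simp add: E_def I_linear[OF a(1)] split_beta scaleR_add_right sum.distrib[symmetric] cong: sum.cong)
           (auto intro!: sum.cong simp: scaleR_add_right sum.distrib[symmetric])
      show "E (w *\<^sub>C y) = w *\<^sub>C E y"
        using tag cboundedD(2)[OF G_cbounded]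
        by (simp add: E_def I_linear[OF a(1)] split_beta scaleC.scale_right_diff_distrib scaleC.scale_sum_right)
           (auto intro!: sum.cong simp: scaleC_scaleR_commute)
      have "norm (E y) \<le> (e / (b - a) * norm y) * (b - a)"
        unfolding E_def I_def
        using a e by (intro riemann_sum_error[OF _ _ p] \<delta>(2) continuous_on_subset[OF G_continuous]) auto
      then show "norm (E y) \<le> e * norm y" using a by simp
    qed
    moreover have "E (R 0 y) = R 0 (E y)" for y
    proof -
      interpret R0: bounded_linear "R 0" by (rule R_bounded_linear[OF inv])
      show ?thesis
        using tag G_R0
        by (simp add: E_def I_linear[OF a(1)] split_beta R0.diff R0.sum)
           (auto intro!: sum.cong simp: R0.scaleR)
    qed
    ultimately have "NV (E x) \<le> e * NV x" using V_op(2)[OF x, of e E] e by simp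
    moreover have "riemann_sum p (\<lambda>t. RV t x) = riemann_sum p (\<lambda>t. G t x)"
      using tag G_eq x by (auto intro!: sum.cong)
    ultimately show ?thesis by (simp add: E_def)
  qed
  then show "\<exists>\<delta>>0. \<forall>p. p tagged_division_of {a..b} \<and> (\<lambda>t. ball t \<delta>) fine p \<longrightarrow>
      (\<forall>x\<in>V. NV (riemann_sum p (\<lambda>t. RV t x) - I a b x) \<le> e * NV x)"
    using \<delta>(1) by blast
qed

lemma weight_integral:
  assumes "0 < a" "a \<le> b"
  shows "((\<lambda>r. M / (1 + r)\<^sup>2) has_integral (M / (1 + a) - M / (1 + b))) {a..b}"
proof -
  have "((\<lambda>r. M / (1 + r)\<^sup>2) has_integral (- M / (1 + b) - (- M / (1 + a)))) {a..b}"
  proof (rule fundamental_theorem_of_calculus[OF assms(2)])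
    fix r assume "r \<in> {a..b}"
    then have "1 + r \<noteq> 0" using assms by auto
    then show "((\<lambda>r. - M / (1 + r)) has_vector_derivative M / (1 + r)\<^sup>2) (at r within {a..b})"
      by (auto intro!: derivative_eq_intros simp: power2_eq_square simp flip: has_real_derivative_iff_has_vector_derivative)
  qed
  then show ?thesis by simp
qed

text \<open>\<open>NV\<close> is brought under the integral through Riemann sums: a single tagged
  division is fine for the operator integral and for the integral of the scalar majorant at
  once.\<close>

lemma NV_I_le:
  assumes a: "0 < a" "a \<le> b" and x: "x \<in> V"
  shows "NV (I a b x) \<le> (M / (1 + a) - M / (1 + b)) * NV x"
proof (cases "a = b")
  case True
  then show ?thesis by (simp add: I_def V_zero)
next
  case False
  with a have ab: "a < b" by simp
  let ?J = "M / (1 + a) - M / (1 + b)"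
  have n: "0 \<le> NV x" using NV_nonneg x .
  show ?thesis
  proof (rule field_le_epsilon)
    fix \<epsilon> :: real assume \<epsilon>: "0 < \<epsilon>"
    define e where "e = \<epsilon> / (2 * (NV x + 1))"
    have e: "0 < e" using \<epsilon> n by (simp add: e_def)
    obtain \<delta> where \<delta>: "0 < \<delta>" "\<And>p x. p tagged_division_of {a..b} \<Longrightarrow> (\<lambda>t. ball t \<delta>) fine p \<Longrightarrow> x \<in> V \<Longrightarrow>
      NV (riemann_sum p (\<lambda>t. RV t x) - I a b x) \<le> e * NV x"
      by (rule has_operator_integralD[OF operator_integral[OF a(1) ab] e], rule that; blast)
    obtain \<gamma> where \<gamma>: "gauge \<gamma>" "\<And>p. p tagged_division_of {a..b} \<Longrightarrow> \<gamma> fine p \<Longrightarrow>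
      norm (riemann_sum p (\<lambda>t. M / (1 + t)\<^sup>2) - ?J) < e"
      using weight_integral[OF a] e unfolding has_integral_real by meson
    have "gauge (\<lambda>t. ball t \<delta> \<inter> \<gamma> t)" using \<delta>(1) \<gamma>(1) by (auto simp: gauge_def)
    then obtain p where p: "p tagged_division_of {a..b}" "(\<lambda>t. ball t \<delta> \<inter> \<gamma> t) fine p"
      using fine_division_exists_real by blast
    have fine: "(\<lambda>t. ball t \<delta>) fine p" "\<gamma> fine p" using p(2) by (auto simp: fine_Int)
    have tag: "0 < t" if "(t, k) \<in> p" for t k
      using tag_in_interval[OF p(1) that] a by auto
    let ?S = "riemann_sum p (\<lambda>t. G t x)"
    have S: "riemann_sum p (\<lambda>t. RV t x) = ?S"
      using tag G_eq x by (auto intro!: sum.cong)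
    have GV: "G (fst q) x \<in> V" if "q \<in> p" for q using tag[of "fst q" "snd q"] that G_V x by simp
    have SV: "?S \<in> V" unfolding split_beta scaleR_eq_scaleC by (intro V_sum V_scaleC GV)
    have "NV (I a b x) = NV (?S - (?S - I a b x))" by simp
    also have "\<dots> \<le> NV ?S + NV (?S - I a b x)"
      using SV I_V[OF a x] by (intro V_diff)
    also have "NV (?S - I a b x) \<le> e * NV x" using \<delta>(2)[OF p(1) fine(1) x] S by simp
    also have "NV ?S \<le> (?J + e) * NV x"
    proof -
      have "NV ?S \<le> (\<Sum>q\<in>p. NV (of_real (measure lborel (snd q)) *\<^sub>C G (fst q) x))"
        unfolding split_beta scaleR_eq_scaleC by (intro V_sum V_scaleC GV)
      also have "\<dots> \<le> (\<Sum>q\<in>p. measure lborel (snd q) * (M / (1 + fst q)\<^sup>2) * NV x)"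
      proof (rule sum_mono)
        fix q assume q: "q \<in> p"
        have "NV (G (fst q) x) \<le> M / (1 + fst q)\<^sup>2 * NV x"
          using M(2)[of "fst q" x] tag[of "fst q" "snd q"] q x by (simp add: G_def)
        then show "NV (of_real (measure lborel (snd q)) *\<^sub>C G (fst q) x) \<le> measure lborel (snd q) * (M / (1 + fst q)\<^sup>2) * NV x"
          using V_scaleC(2)[OF GV[OF q]] mult_left_mono[of "NV (G (fst q) x)" "M / (1 + fst q)\<^sup>2 * NV x" "measure lborel (snd q)"]
          by (simp add: mult.assoc)
      qed
      also have "\<dots> = riemann_sum p (\<lambda>t. M / (1 + t)\<^sup>2) * NV x"
        by (simp add: sum_distrib_right split_beta)
      also have "\<dots> \<le> (?J + e) * NV x"
        using \<gamma>(2)[OF p(1) fine(2)] n by (intro mult_right_mono) (auto simp: abs_le_iff)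
      finally show ?thesis .
    qed
    finally have "NV (I a b x) \<le> ?J * NV x + 2 * e * NV x" by (simp add: algebra_simps)
    also have "2 * e * NV x \<le> \<epsilon>" using \<epsilon> n by (simp add: e_def field_simps)
    finally show "NV (I a b x) \<le> ?J * NV x + \<epsilon>" by simp
  qed
qed

text \<open>M a bounds the integral of the majorant over [a', a], and M/(1 + b) the one over
  [b, b']. Neither depends on a' or b'.\<close>

lemma I_nested:
  assumes "0 < a'" "a' \<le> a" "a \<le> b" "b \<le> b'" and x: "x \<in> V"
  shows "NV (I a' b' x - I a b x) \<le> M * (a + 1 / (1 + b)) * NV x"
proof -
  have "I a' a x + I a b' x = I a' b' x" "I a b x + I b b' x = I a b' x"
    unfolding I_def using assms
    by (auto intro!: Henstock_Kurzweil_Integration.integral_combine G_integrable)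
  then have "I a' b' x = I a' a x + I a b x + I b b' x" by (metis add.assoc)
  then have "NV (I a' b' x - I a b x) = NV (I a' a x + I b b' x)" by simp
  also have "\<dots> \<le> NV (I a' a x) + NV (I b b' x)"
    using assms by (intro V_add I_V) auto
  also have "\<dots> \<le> (M / (1 + a') - M / (1 + a)) * NV x + (M / (1 + b) - M / (1 + b')) * NV x"
    using assms by (intro add_mono NV_I_le) auto
  also have "\<dots> = ((M / (1 + a') - M / (1 + a)) + (M / (1 + b) - M / (1 + b'))) * NV x" by (simp add: algebra_simps)
  also have "\<dots> \<le> (M * a + M * (1 / (1 + b))) * NV x"
  proof (intro mult_right_mono add_mono NV_nonneg x)
    have "M / (1 + a') \<le> M / 1" using assms M by (intro divide_left_mono) auto
    moreover have "M - M * a \<le> M / (1 + a)"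
    proof -
      have "(M - M * a) * (1 + a) \<le> M" using M by (simp add: algebra_simps)
      then show ?thesis using assms by (simp add: pos_le_divide_eq)
    qed
    ultimately show "M / (1 + a') - M / (1 + a) \<le> M * a" by simp
    show "M / (1 + b) - M / (1 + b') \<le> M * (1 / (1 + b))" using assms M by simp
  qed
  finally show ?thesis by (simp add: algebra_simps)
qed

text \<open>Limits along the windows exist pointwise by completeness of \<open>V\<close>. Letting n
  grow in \<open>I_nested\<close> yields the rate M (a + 1/(1 + b)), uniform in x, which convergence
  in operator norm asks for.\<close>

lemma exists_improper:
  "\<exists>T. has_improper_operator_integral V NV RV T"
proof -
  define In where "In n x = I (1 / real (Suc n)) (real (Suc n)) x" for n x
  define T where "T x = lim (\<lambda>n. In n x)" for x
  have InV: "In n x \<in> V" if "x \<in> V" for n x unfolding In_def by (rule I_V[OF Suc_interval that])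
  have conv: "\<exists>v\<in>V. (\<lambda>n. NV (In n x - v)) \<longlonglongrightarrow> 0" if x: "x \<in> V" for x
  proof -
    have n0: "0 \<le> NV x" by (rule NV_nonneg[OF x])
    have step: "NV (In n x - In m x) \<le> 2 * M * NV x / real (Suc m)" if "m \<le> n" for m n
    proof -
      have "NV (In n x - In m x) \<le> M * (1 / real (Suc m) + 1 / (1 + real (Suc m))) * NV x"
        unfolding In_def using that Suc_interval[of n] Suc_interval[of m]
        by (intro I_nested x) (auto simp: frac_le)
      also have "\<dots> \<le> M * (1 / real (Suc m) + 1 / real (Suc m)) * NV x"
        using M(1) n0 by (intro mult_right_mono mult_left_mono add_left_mono frac_le) auto
      finally show ?thesis by (simp add: field_simps)
    qed
    have "\<exists>k. \<forall>m\<ge>k. \<forall>n\<ge>k. NV (In m x - In n x) < e" if e: "e > 0" for e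
    proof -
      obtain k where k: "2 * M * NV x / e < real k" using reals_Archimedean2 by blast
      have small: "2 * M * NV x / real (Suc m) < e" if "k \<le> m" for m
      proof -
        have "2 * M * NV x < real (Suc m) * e"
          using k e that by (simp add: divide_less_eq) (smt (verit, best) mult_right_mono of_nat_le_iff)
        then show ?thesis by (simp add: divide_less_eq mult.commute)
      qed
      have "NV (In m x - In n x) < e" if "k \<le> m" "k \<le> n" for m n
      proof (cases "n \<le> m")
        case True
        then show ?thesis using step[OF True] small[OF that(2)] by linarith
      next
        case False
        then show ?thesis using step[of m n] small[OF that(1)] NV_minus_commute[OF InV[OF x] InV[OF x], of m n] by linarith
      qed
      then show ?thesis by blast
    qed
    moreover have "(\<forall>n. In n x \<in> V) \<and> (\<forall>e>0. \<exists>M. \<forall>m\<ge>M. \<forall>n\<ge>M. NV (In m x - In n x) < e)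
        \<longrightarrow> (\<exists>v\<in>V. (\<lambda>n. NV (In n x - v)) \<longlonglongrightarrow> 0)"
      using V_complete unfolding complete_wrt_def by (rule spec)
    ultimately show ?thesis using InV[OF x] by blast
  qed
  have lim: "(\<lambda>n. In n x) \<longlonglongrightarrow> v" if "x \<in> V" "v \<in> V" "(\<lambda>n. NV (In n x - v)) \<longlonglongrightarrow> 0" for x v
  proof -
    have "(\<lambda>n. 1 / \<kappa> * NV (In n x - v)) \<longlonglongrightarrow> 0" using tendsto_mult_right_zero[OF that(3)] .
    then have "(\<lambda>n. In n x - v) \<longlonglongrightarrow> 0"
    proof (rule Lim_null_comparison[rotated])
      show "\<forall>\<^sub>F n in sequentially. norm (In n x - v) \<le> 1 / \<kappa> * NV (In n x - v)"
        using norm_le_NV[OF V_diff(1)[OF InV[OF that(1)] that(2)]] \<kappa>_pos by (simp add: field_simps)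
    qed
    then show ?thesis by (rule LIM_zero_cancel)
  qed
  have T: "T x \<in> V" "(\<lambda>n. NV (In n x - T x)) \<longlonglongrightarrow> 0" "(\<lambda>n. In n x) \<longlonglongrightarrow> T x" if "x \<in> V" for x
    using conv[OF that] lim[OF that] limI unfolding T_def by metis+
  have Tdiff: "NV (I a b x - T x) \<le> M * (a + 1 / (1 + b)) * NV x" if "0 < a" "a \<le> b" and x: "x \<in> V" for a b x
  proof -
    have IV: "I a b x \<in> V" using that by (rule I_V)
    obtain n1 where n1: "1 / a < real n1" using reals_Archimedean2 by blast
    obtain n2 where n2: "b < real n2" using reals_Archimedean2 by blast
    have "(\<lambda>n. M * (a + 1 / (1 + b)) * NV x + NV (In n x - T x)) \<longlonglongrightarrow> M * (a + 1 / (1 + b)) * NV x + 0"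
      by (intro tendsto_add tendsto_const T x)
    moreover have "NV (I a b x - T x) \<le> M * (a + 1 / (1 + b)) * NV x + NV (In n x - T x)" if n: "max n1 n2 \<le> n" for n
    proof -
      have "1 / a < real (Suc n)" using n1 n by (simp add: max_def split: if_splits)
      then have "1 / real (Suc n) \<le> a" using \<open>0 < a\<close> by (simp add: field_simps del: of_nat_Suc)
      moreover have "b \<le> real (Suc n)" using n2 n by (simp add: max_def split: if_splits)
      ultimately have "NV (In n x - I a b x) \<le> M * (a + 1 / (1 + b)) * NV x"
        unfolding In_def using \<open>a \<le> b\<close> by (intro I_nested x Suc_interval) auto
      moreover have "NV (I a b x - T x) \<le> NV (In n x - T x) + NV (In n x - I a b x)"
        using V_diff(2)[OF V_diff(1)[OF InV[OF x] T(1)[OF x]] V_diff(1)[OF InV[OF x] IV], of n n] by simp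
      ultimately show ?thesis by linarith
    qed
    ultimately have "NV (I a b x - T x) \<le> M * (a + 1 / (1 + b)) * NV x + 0"
      by (intro LIMSEQ_le_const) blast+
    then show ?thesis by simp
  qed
  have "bounded_operator V NV T"
    unfolding bounded_operator_def linear_operator_def subspace_scaleC_iff
  proof (intro conjI ballI allI exI)
    fix x y and k :: complex assume x: "x \<in> V"
    show "T (k *\<^sub>C x) = k *\<^sub>C T x"
    proof (rule LIMSEQ_unique[OF T(3)])
      show "(\<lambda>n. In n (k *\<^sub>C x)) \<longlonglongrightarrow> k *\<^sub>C T x"
        unfolding In_def I_linear(2)[OF Suc_interval(1)] using T(3)[OF x]
        by (intro tendsto_scaleC tendsto_const) (simp add: In_def)
    qed (rule V_scaleC(1)[OF x])
    show "T (x + y) = T x + T y" if y: "y \<in> V"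
    proof (rule LIMSEQ_unique[OF T(3)])
      show "(\<lambda>n. In n (x + y)) \<longlonglongrightarrow> T x + T y"
        unfolding In_def I_linear(1)[OF Suc_interval(1)] using T(3)[OF x] T(3)[OF y]
        by (intro tendsto_add) (simp_all add: In_def)
    qed (rule V_add(1)[OF x y])
    \<comment> \<open>\<open>I 1 1\<close> vanishes, so the rate at a = b = 1 bounds
      \<open>T\<close> itself.\<close>
    have "NV (T x) \<le> NV (I 1 1 x) + NV (I 1 1 x - T x)"
      using V_diff(2)[of "I 1 1 x" "I 1 1 x - T x"] V_diff(1) T(1)[OF x] I_V[of 1 1 x] x by simp
    also have "\<dots> \<le> 0 + M * (1 + 1 / (1 + 1)) * NV x"
      using Tdiff[of 1 1 x] x by (intro add_mono) (simp_all add: I_def V_zero)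
    finally show "NV (T x) \<le> M * (1 + 1 / (1 + 1)) * NV x" by simp
  qed (use T in \<open>auto simp: V_zero V_add V_scaleC\<close>)
  moreover have "\<exists>a0>0. \<exists>b0>a0. \<forall>a b. 0 < a \<and> a \<le> a0 \<and> b0 \<le> b \<longrightarrow> (\<forall>x\<in>V. NV (I a b x - T x) \<le> e * NV x)"
    if e: "0 < e" for e
  proof -
    \<comment> \<open>Both thresholds come from q: a \<le> q, while b \<ge> q + 1/q gives a \<le> b
      and 1/(1 + b) \<le> q.\<close>
    define q where "q = e / (2 * (M + 1))"
    have q: "0 < q" "M * q \<le> e / 2" using e M(1) by (simp_all add: q_def field_simps)
    have "NV (I a b x - T x) \<le> e * NV x" if ab: "0 < a" "a \<le> q" "q + 1 / q \<le> b" and x: "x \<in> V" for a b x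
    proof -
      have "1 / q \<le> 1 + b" using ab q(1) by linarith
      have "0 < 1 / q" using q(1) by simp
      then have "a \<le> b" "0 < 1 + b" using ab q(1) by linarith+
      then have b: "1 / (1 + b) \<le> q" using q(1) \<open>1 / q \<le> 1 + b\<close> by (simp add: field_simps)
      have "NV (I a b x - T x) \<le> M * (a + 1 / (1 + b)) * NV x" using \<open>a \<le> b\<close> Tdiff ab(1) x by blast
      also have "\<dots> \<le> M * (q + q) * NV x"
        using b ab M(1) NV_nonneg[OF x] by (intro mult_right_mono mult_left_mono add_mono) auto
      also have "\<dots> \<le> e * NV x"
        using q NV_nonneg[OF x] by (intro mult_right_mono) (auto simp: algebra_simps)
      finally show ?thesis .
    qed
    moreover have "q < q + 1 / q" using q by simp
    ultimately show ?thesis using q(1) by blast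
  qed
  ultimately show ?thesis
    unfolding has_improper_operator_integral_def using operator_integral by blast
qed

lemma improper_limit:
  assumes T: "has_improper_operator_integral V NV RV T" and x: "x \<in> V"
  shows "(\<lambda>n. I (1 / real (Suc n)) (real (Suc n)) x) \<longlonglongrightarrow> T x" "T x \<in> V"
proof -
  have "(\<lambda>n. integral (window n) (\<lambda>r. RV r x)) \<longlonglongrightarrow> T x"
    using has_improper_imp_lim[OF T x] G_eq G_V x by simp
  moreover have "integral (window n) (\<lambda>r. RV r x) = I (1 / real (Suc n)) (real (Suc n)) x" for n
    unfolding I_def
  proof (rule integral_cong)
    fix r assume "r \<in> window n"
    then have "0 < r" using less_le_trans[OF Suc_interval(1)[of n], of r] by simp
    then show "RV r x = G r x" using x by (rule G_eq)
  qed
  ultimately show "(\<lambda>n. I (1 / real (Suc n)) (real (Suc n)) x) \<longlonglongrightarrow> T x" by simp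
  show "T x \<in> V"
    using T x unfolding has_improper_operator_integral_def bounded_operator_def linear_operator_def by auto
qed

end

section \<open>The Hardy operator and its adjoint\<close>

lemma set_integrable_complex_of_realD:
  assumes "f = (\<lambda>t. complex_of_real (g t))" "set_integrable lebesgue S f"
  shows "g integrable_on S" "integral S g = Re (LINT t:S|lebesgue. f t)"
proof -
  have f: "f integrable_on S" "(LINT t:S|lebesgue. f t) = integral S f"
    using set_lebesgue_integral_eq_integral[OF assms(2)] by auto
  have "Re \<circ> f = g" using assms(1) by auto
  then show "g integrable_on S" "integral S g = Re (LINT t:S|lebesgue. f t)"
    using integrable_linear[OF f(1) bounded_linear_Re] integral_linear[OF f(1) bounded_linear_Re] f(2) by auto
qed

locale calderon_interp = interp_op D A \<Phi> N
  for D :: "'a::complex_banach set" and A and \<Phi> and N +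
  assumes calderon: "calderon_bounded \<Phi> N"
begin

abbreviation "PQ x t \<equiv> hardy (kq x) t + hardy_adj (kq x) t"

lemma hardy_integrable:
  assumes "x \<in> V" "0 < t"
  shows "(\<lambda>s. K s x / s) integrable_on {0..t}"
    "Re (hardy (kq x) t) = integral {0..t} (\<lambda>s. K s x / s) / t"
proof -
  have "set_integrable lebesgue {0..t} (kq x)"
    using calderon assms unfolding calderon_bounded_def hardy_dom_def V_iff by auto
  note * = set_integrable_complex_of_realD[of "kq x" "\<lambda>s. K s x / s", OF _ this]
  show "(\<lambda>s. K s x / s) integrable_on {0..t}" using * by (simp add: K_quotient_def)
  show "Re (hardy (kq x) t) = integral {0..t} (\<lambda>s. K s x / s) / t"
    using *(2) by (simp add: hardy_def K_quotient_def)
qed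

lemma hardy_adj_integrable:
  assumes "x \<in> V" "0 < t"
  shows "(\<lambda>s. K s x / s / s) integrable_on {t<..}"
    "Re (hardy_adj (kq x) t) = integral {t<..} (\<lambda>s. K s x / s / s)"
proof -
  have "set_integrable lebesgue {t<..} (\<lambda>s. kq x s / of_real s)"
    using calderon assms unfolding calderon_bounded_def hardy_adj_dom_def V_iff by auto
  note * = set_integrable_complex_of_realD[of "\<lambda>s. kq x s / of_real s" "\<lambda>s. K s x / s / s", OF _ this]
  show "(\<lambda>s. K s x / s / s) integrable_on {t<..}" using * by (simp add: K_quotient_def)
  show "Re (hardy_adj (kq x) t) = integral {t<..} (\<lambda>s. K s x / s / s)"
    using *(2) by (simp add: hardy_adj_def K_quotient_def)
qed

text \<open>K(s, x)/s is nonincreasing, so on (0, t] it is at least K(t, x)/t.\<close>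

lemma K_le_integral:
  assumes x: "x \<in> V" and t: "0 < t"
  shows "K t x \<le> integral {0..t} (\<lambda>s. K s x / s)"
proof -
  \<comment> \<open>\<open>K 0 x / 0\<close> is 0 by the convention on division, so the integrand is
    changed at s = 0 before it is compared.\<close>
  have i: "(\<lambda>s. if s = 0 then K t x / t else K s x / s) integrable_on {0..t}"
    by (rule integrable_spike[OF hardy_integrable(1)[OF x t] negligible_sing[of 0]]) auto
  have "K t x = integral {0..t} (\<lambda>s. K t x / t)" using t by simp
  also have "\<dots> \<le> integral {0..t} (\<lambda>s. if s = 0 then K t x / t else K s x / s)"
  proof (rule integral_le[OF _ i])
    fix s assume s: "s \<in> {0..t}"
    show "K t x / t \<le> (if s = 0 then K t x / t else K s x / s)"
      using K_slope[of s t x] s t by (auto simp: field_simps)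
  qed auto
  also have "\<dots> = integral {0..t} (\<lambda>s. K s x / s)"
    by (rule integral_spike[OF negligible_sing[of 0]]) auto
  finally show ?thesis .
qed

text \<open>P being defined on \<Phi> makes K(s, x)/s integrable at 0, so the bound of
  \<open>K_le_integral\<close> vanishes as t -> 0. In effect every x in \<open>V\<close> lies in the
  closure of \<open>D\<close>, which stands in for density.\<close>

lemma K_tendsto_0:
  assumes x: "x \<in> V"
  shows "(\<lambda>n. K (1 / real (Suc n)) x) \<longlonglongrightarrow> 0"
proof -
  let ?F = "\<lambda>t. integral {0..t} (\<lambda>s. K s x / s)"
  have c: "continuous_on {0..1} ?F"
    using indefinite_integral_continuous_1[OF hardy_integrable(1)[OF x, of 1]] by simp
  have F: "(\<lambda>n. ?F (1 / real (Suc n))) \<longlonglongrightarrow> ?F 0"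
    by (rule continuous_on_tendsto_compose[OF c inverse_Suc_tendsto_0]) (auto simp: divide_simps)
  show ?thesis
  proof (rule Lim_null_comparison)
    show "(\<lambda>n. ?F (1 / real (Suc n))) \<longlonglongrightarrow> 0" using F by simp
    show "\<forall>\<^sub>F n in sequentially. norm (K (1 / real (Suc n)) x) \<le> ?F (1 / real (Suc n))"
    proof (intro always_eventually allI)
      fix n
      show "norm (K (1 / real (Suc n)) x) \<le> ?F (1 / real (Suc n))"
        using K_le_integral[OF x Suc_interval(1)[of n]] K_nonneg[of "1 / real (Suc n)" x] Suc_interval(1)[of n]
        by (simp del: of_nat_Suc)
    qed
  qed
qed

text \<open>After \<open>r = 1/u\<close> the integrand is \<open>K(u)/u \<cdot> 1/(u + t)\<close>, and \<open>1/(u + t) \<le> min(1/t, 1/u)\<close>.\<close>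

lemma resolvent_integral_le_calderon:
  assumes x: "x \<in> V" and t: "0 < t" and ab: "0 < a" "a \<le> b"
  shows "integral {a..b} (\<lambda>r. K (1 / r) x / (1 + t * r)) \<le> cmod (PQ x t)"
proof -
  let ?f = "\<lambda>u. K u x / (u * (u + t))"
  let ?g = "\<lambda>r::real. 1 / r"
  have inv: "1 / b \<le> 1 / a" "0 < 1 / b" using ab by (simp_all add: frac_le)
  have pos: "0 < u" if "u \<in> {1 / b..1 / a}" for u using that less_le_trans[OF inv(2), of u] by auto
  have fc: "continuous_on {1 / b..1 / a} ?f"
  proof (intro continuous_on_divide continuous_on_subset[OF K_continuous_on] continuous_intros ballI)
    show "{1 / b..1 / a} \<subseteq> {0<..}" using pos by blast
    fix u assume "u \<in> {1 / b..1 / a}"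
    then have "0 < u" by (rule pos)
    then show "u * (u + t) \<noteq> 0" using t by simp
  qed
  have h: "((\<lambda>r. (- 1 / r^2) *\<^sub>R ?f (?g r)) has_integral (integral {?g a..?g b} ?f - integral {?g b..?g a} ?f)) {a..b}"
  proof (rule has_integral_substitution_general[of "{}"])
    show "?g ` {a..b} \<subseteq> {1 / b..1 / a}" using ab by (auto simp: frac_le)
    show "continuous_on {1 / b..1 / a} ?f" by (rule fc)
    show "continuous_on {a..b} ?g" using ab by (intro continuous_intros) auto
    show "(?g has_real_derivative - 1 / r\<^sup>2) (at r within {a..b})" if "r \<in> {a..b} - {}" for r
      using that ab by (auto intro!: derivative_eq_intros simp: power2_eq_square)
  qed (use ab in auto)
  \<comment> \<open>The substitution rule records both orientations; as 1/b \<le> 1/a, the integral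
    from 1/a up to 1/b is over an empty or one-point interval.\<close>
  have "integral {?g a..?g b} ?f = 0"
    using inv(1) by (cases "1 / a = 1 / b") auto
  then have eq: "- (integral {?g a..?g b} ?f - integral {?g b..?g a} ?f) = integral {1 / b..1 / a} ?f" by simp
  have "((\<lambda>r. - ((- 1 / r^2) *\<^sub>R ?f (?g r))) has_integral (integral {1 / b..1 / a} ?f)) {a..b}"
    using has_integral_neg[OF h] unfolding eq .
  then have "((\<lambda>r. K (1 / r) x / (1 + t * r)) has_integral (integral {1 / b..1 / a} ?f)) {a..b}"
  proof (rule has_integral_eq[rotated])
    fix r assume "r \<in> {a..b}"
    then have r: "0 < r" using ab by auto
    have "r^2 * (1 / r * (1 / r + t)) = 1 + t * r" using r by (simp add: power2_eq_square field_simps)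
    then show "- ((- 1 / r^2) *\<^sub>R ?f (?g r)) = K (1 / r) x / (1 + t * r)"
      by (simp only: real_scaleR_def divide_divide_eq_left minus_divide_left[symmetric] mult_minus_left minus_minus times_divide_times_eq mult_1)
  qed
  then have eq: "integral {a..b} (\<lambda>r. K (1 / r) x / (1 + t * r)) = integral {1 / b..1 / a} ?f"
    by (rule integral_unique)
  define F where "F u = (if u \<le> t then K u x / u / t else K u x / u / u)" for u
  have F1: "(F has_integral (integral {0..t} (\<lambda>s. K s x / s) / t)) {0..t}"
    by (rule has_integral_eq[OF _ has_integral_divide[OF integrable_integral[OF hardy_integrable(1)[OF x t]]]])
      (auto simp: F_def)
  have F2: "(F has_integral (integral {t<..} (\<lambda>s. K s x / s / s))) {t<..}"
    by (rule has_integral_eq[OF _ integrable_integral[OF hardy_adj_integrable(1)[OF x t]]])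
      (auto simp: F_def)
  have un: "{0..t} \<union> {t<..} = {0..}" "{0..t} \<inter> {t<..} = {}" using t by auto
  have F: "(F has_integral (Re (hardy (kq x) t) + Re (hardy_adj (kq x) t))) {0..}"
    using has_integral_Un[OF F1 F2 negligible_subset[OF negligible_empty]] un hardy_integrable(2)[OF x t] hardy_adj_integrable(2)[OF x t] by simp
  have Fnn: "0 \<le> F u" if "0 \<le> u" for u using K_nonneg[OF that, of x] that t by (auto simp: F_def)
  have sub: "{1 / b..1 / a} \<subseteq> {0..}" using pos by force
  have Fi: "F integrable_on {1 / b..1 / a}"
    using integrable_on_subinterval[OF has_integral_integrable[OF F] sub] .
  have "integral {1 / b..1 / a} ?f \<le> integral {1 / b..1 / a} F"
  proof (rule integral_le[OF integrable_continuous_real[OF fc] Fi])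
    fix u assume "u \<in> {1 / b..1 / a}"
    then have u: "0 < u" by (rule pos)
    have k: "0 \<le> K u x / u" using K_nonneg[of u x] u by simp
    have "?f u = K u x / u / (u + t)" using u by simp
    also have "\<dots> \<le> F u"
      unfolding F_def using k u t K_nonneg[of u x] by (auto intro!: divide_left_mono)
    finally show "?f u \<le> F u" .
  qed
  also have "\<dots> \<le> integral {0..} F"
    using Fi has_integral_integrable[OF F] sub Fnn by (intro integral_subset_le) auto
  also have "\<dots> = Re (PQ x t)" using integral_unique[OF F] by simp
  also have "\<dots> \<le> cmod (PQ x t)" by (rule complex_Re_le_cmod)
  finally show ?thesis using eq by simp
qed

end

section \<open>The functional calculus\<close>

text \<open>A strict inequality between continuous functions replaces the condition on the
  discontinuous \<open>Arg\<close>, so that openness can be read off.\<close>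

lemma sector_eq:
  assumes "0 < \<phi>" "\<phi> < pi"
  shows "sector \<phi> = {z. cmod z * cos \<phi> < Re z}"
proof (rule set_eqI)
  fix z
  show "z \<in> sector \<phi> \<longleftrightarrow> z \<in> {z. cmod z * cos \<phi> < Re z}"
  proof (cases "z = 0")
    case False
    have "z \<in> sector \<phi> \<longleftrightarrow> \<bar>Arg z\<bar> < \<phi>" using False by (simp add: sector_def)
    also have "\<dots> \<longleftrightarrow> cos \<phi> < cos \<bar>Arg z\<bar>"
      using assms Arg_bounded[of z] by (intro cos_mono_less_eq[symmetric]) (auto simp: abs_le_iff)
    also have "\<dots> \<longleftrightarrow> cmod z * cos \<phi> < cmod z * cos (Arg z)" using False by (simp add: cos_abs_real)
    also have "\<dots> \<longleftrightarrow> z \<in> {z. cmod z * cos \<phi> < Re z}" by (simp only: Re_eq_cos_Arg[of z, symmetric] mem_Collect_eq)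
    finally show ?thesis .
  qed (simp add: sector_def)
qed

lemma open_sector: "0 < \<phi> \<Longrightarrow> \<phi> < pi \<Longrightarrow> open (sector \<phi>)"
  by (simp add: sector_eq) (intro open_Collect_less continuous_intros)

lemma neg_real_far:
  assumes "0 < t" "\<psi> \<le> pi"
  shows "pole t \<in> far \<psi>"
  unfolding far_def mem_Collect_eq Arg_of_real of_real_eq_0_iff using assms by simp

lemma one_plus_mult_ge:
  assumes "0 < t" "0 \<le> r"
  shows "min 1 t * (1 + r) \<le> 1 + t * (r::real)"
proof -
  have "min 1 t * (1 + r) = min 1 t + min 1 t * r" by (simp add: algebra_simps)
  also have "\<dots> \<le> 1 + t * r" using assms by (intro add_mono mult_right_mono) auto
  finally show ?thesis .
qed

lemma H_inf_norm_bound: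
  assumes "f \<in> H_inf \<phi>" "z \<in> sector \<phi>"
  shows "cmod (f z) \<le> H_inf_norm \<phi> f"
  unfolding H_inf_norm_def
proof (rule cSUP_upper[OF assms(2)])
  have "bounded (f ` sector \<phi>)" using assms(1) by (simp add: H_inf_def)
  then obtain b where "\<forall>w\<in>f ` sector \<phi>. cmod w \<le> b" unfolding bounded_iff by blast
  then show "bdd_above ((\<lambda>z. cmod (f z)) ` sector \<phi>)" by (intro bdd_aboveI[of _ b]) auto
qed

text \<open>At angle pi/2 the rays are z = i r and z = - i r, where z^2 - 1 = - (1 + r^2) and arctan
  supplies a primitive. The value is 2 pi i times the residue 1 at z = 1.\<close>

lemma arctan_contour:
  fixes w :: "'a::complex_banach"
  shows "contour_limit (\<lambda>z. (2 / (z\<^sup>2 - 1)) *\<^sub>C w) (pi / 2) ((2 * of_real pi * \<i>) *\<^sub>C w)"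
proof -
  have part: "ray_part (\<lambda>z. (2 / (z\<^sup>2 - 1)) *\<^sub>C w) \<theta> n
      = (arctan (real (Suc n)) - arctan (1 / real (Suc n))) *\<^sub>R ((- 2 * cis \<theta>) *\<^sub>C w)"
    if \<theta>: "(cis \<theta>)\<^sup>2 = -1" for \<theta> n
    unfolding ray_part_def scaleR_left_diff_distrib
  proof (rule integral_unique, rule fundamental_theorem_of_calculus[OF Suc_interval(2)])
    fix r assume "r \<in> window n"
    have "(rcis r \<theta>)\<^sup>2 - 1 = - of_real (1 + r\<^sup>2)" using \<theta> by (simp add: rcis_def power_mult_distrib)
    then have e: "cis \<theta> * (2 / ((rcis r \<theta>)\<^sup>2 - 1)) = of_real (inverse (1 + r\<^sup>2)) * (- 2 * cis \<theta>)"
      by (simp only: divide_minus_right) (simp add: divide_inverse)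
    have "(arctan has_derivative (\<lambda>h. h * inverse (1 + r\<^sup>2))) (at r within (window n))"
      using has_field_derivative_at_within[OF DERIV_arctan] by (simp add: has_field_derivative_def mult.commute[of _ "inverse _"] del: of_nat_Suc)
    from has_derivative_scaleR_left[OF this, of "(- 2 * cis \<theta>) *\<^sub>C w"]
    have "((\<lambda>r. arctan r *\<^sub>R ((- 2 * cis \<theta>) *\<^sub>C w)) has_vector_derivative inverse (1 + r\<^sup>2) *\<^sub>R ((- 2 * cis \<theta>) *\<^sub>C w))
       (at r within (window n))"
      by (simp only: has_vector_derivative_def scaleR_scaleR)
    then show "((\<lambda>r. arctan r *\<^sub>R ((- 2 * cis \<theta>) *\<^sub>C w)) has_vector_derivative cis \<theta> *\<^sub>C (2 / ((rcis r \<theta>)\<^sup>2 - 1)) *\<^sub>C w)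
       (at r within (window n))"
      by (simp only: scaleC_scaleC e scaleR_eq_scaleC)
  qed
  have at: "(\<lambda>n. arctan (real (Suc n)) - arctan (1 / real (Suc n))) \<longlonglongrightarrow> pi / 2 - arctan 0"
  proof (intro tendsto_diff tendsto_arctan)
    show "(\<lambda>n. arctan (real (Suc n))) \<longlonglongrightarrow> pi / 2"
      by (rule filterlim_compose[OF tendsto_arctan_at_top filterlim_compose[OF filterlim_real_sequentially filterlim_Suc]])
  qed (rule inverse_Suc_tendsto_0)
  have cis: "cis (pi / 2) = \<i>" "cis (- (pi / 2)) = - \<i>" by (simp_all add: complex_eq_iff)
  have four: "(4 * \<i>) *\<^sub>C w = (2 * \<i>) *\<^sub>C w + (2 * \<i>) *\<^sub>C w"
    by (simp flip: scaleC_add_left)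
  have "ray_part (\<lambda>z. (2 / (z\<^sup>2 - 1)) *\<^sub>C w) (- (pi / 2)) n - ray_part (\<lambda>z. (2 / (z\<^sup>2 - 1)) *\<^sub>C w) (pi / 2) n
      = (arctan (real (Suc n)) - arctan (1 / real (Suc n))) *\<^sub>R ((4 * \<i>) *\<^sub>C w)" for n
    using part[of "pi / 2" n] part[of "- (pi / 2)" n]
    by (simp add: cis four scaleR_add_right)
  moreover have "(\<lambda>n. (arctan (real (Suc n)) - arctan (1 / real (Suc n))) *\<^sub>R ((4 * \<i>) *\<^sub>C w)) \<longlonglongrightarrow> (pi / 2 - arctan 0) *\<^sub>R ((4 * \<i>) *\<^sub>C w)"
    by (intro tendsto_scaleR at tendsto_const)
  moreover have "(pi / 2 - arctan 0) *\<^sub>R ((4 * \<i>) *\<^sub>C w) = (2 * of_real pi * \<i>) *\<^sub>C w"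
    by (simp add: scaleR_eq_scaleC scaleC_scaleC mult_ac)
  ultimately show ?thesis unfolding contour_limit_def by (simp del: of_nat_Suc)
qed

section \<open>Dunford integrals as contour limits in X\<close>

text \<open>\<psi> is the angle at which the calculus of the part is evaluated, \<psi>2 one at which
  z R(z) has the bound \<open>M2\<close> in X. On \<open>far \<psi>\<close> less is at hand:
  \<open>B\<close> bounds R(z) in X without the factor z, and \<open>C\<close> bounds z R(z) in
  \<open>NV\<close> only.\<close>

locale contour_calculus = calderon_interp D A \<Phi> N
  for D :: "'a::complex_banach set" and A and \<Phi> and N +
  fixes \<phi> \<psi> \<psi>2 B C M2 c :: real
  assumes \<psi>_eq: "\<psi> = contour_angle V NV DV A \<phi>"
    and angles: "0 < \<psi>" "\<psi> \<le> \<psi>2" "\<psi>2 < \<phi>" "\<phi> < pi"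
    and far: "far \<psi> \<subseteq> \<rho>"
    and B: "0 \<le> B" "\<And>z x. z \<in> far \<psi> \<Longrightarrow> norm (R z x) \<le> B * norm x"
    and C: "0 \<le> C" "\<And>z x. z \<in> far \<psi> \<Longrightarrow> x \<in> V \<Longrightarrow> NV (z *\<^sub>C R z x) \<le> C * NV x"
    and M2: "0 \<le> M2" "\<And>z x. z \<in> far \<psi>2 \<Longrightarrow> norm (z *\<^sub>C R z x) \<le> M2 * norm x"
    and c_pos: "0 < c"
    and c_lower: "\<And>z t. z \<in> sector \<phi> \<Longrightarrow> 0 \<le> t \<Longrightarrow> c * (1 + t * cmod z) \<le> cmod (1 + of_real t * z)"
begin

abbreviation "den t s z \<equiv> (1 + complex_of_real t * z) * (1 + complex_of_real s * z)"

lemma one_plus_nonzero: "1 + of_real t * z \<noteq> 0" if "z \<in> sector \<phi>" "0 \<le> t"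
proof
  assume "1 + complex_of_real t * z = 0"
  then have "c * (1 + t * cmod z) \<le> 0" using c_lower[OF that] by simp
  moreover have "0 < c * (1 + t * cmod z)" using c_pos that(2) by (simp add: add_pos_nonneg)
  ultimately show False by simp
qed

lemmas c = c_pos c_lower one_plus_nonzero

abbreviation "kk \<equiv> 2 * complex_of_real pi * \<i>"
abbreviation "d \<equiv> dunford V NV DV A \<phi>"
abbreviation "S2 \<equiv> sector \<phi> \<inter> far \<psi>2"

lemma kk_nonzero: "kk \<noteq> 0" by simp

lemma far2: "far \<psi>2 \<subseteq> far \<psi>" using angles by (auto simp: far_def)

lemma sector_open: "open (sector \<phi>)" using angles by (intro open_sector) auto

lemma neg_\<rho>: "0 < t \<Longrightarrow> pole t \<in> \<rho>"
  using neg_real_far[of t \<psi>] far angles by auto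

lemmas J_in' = J_in[OF _ neg_\<rho>]
lemmas A_J' = A_J[OF _ neg_\<rho>]

lemma ray_S2:
  assumes "0 < r"
  shows "rcis r \<psi>2 \<in> S2 \<and> rcis r (- \<psi>2) \<in> S2"
  using assms angles by (auto intro!: rcis_in_far rcis_in_sector)

lemma contour_cong:
  assumes "\<And>z. z \<in> S2 \<Longrightarrow> f z = g z" "contour_limit f \<psi>2 v"
  shows "contour_limit g \<psi>2 v"
  using assms(1) ray_S2 assms(2) by (rule contour_limit_cong)

lemma H_inf_norm_nonneg: "f \<in> H_inf \<phi> \<Longrightarrow> 0 \<le> H_inf_norm \<phi> f"
  using ray_S2[of 1] H_inf_norm_bound[of f \<phi> "rcis 1 \<psi>2"] by (auto intro: order_trans[OF norm_ge_zero])

lemma R_vholo_far: "vholo (\<lambda>z. R z x) (far \<psi>)"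
  by (rule R_vholo[OF far B])

lemma hR_vholo: "h holomorphic_on sector \<phi> \<Longrightarrow> vholo (\<lambda>z. h z *\<^sub>C R z x) (sector \<phi> \<inter> far \<psi>)"
  by (rule vholo_scaleC[OF _ sector_open]) (auto intro: vholo_subset[OF R_vholo_far])

lemma hR_continuous:
  assumes "h holomorphic_on sector \<phi>"
  shows "continuous_on S2 (\<lambda>z. h z *\<^sub>C R z x)"
  by (rule continuous_on_subset[OF vholo_continuous_on[OF hR_vholo[OF assms]]]) (use far2 in auto)

lemma h_vholo: "h holomorphic_on sector \<phi> \<Longrightarrow> vholo (\<lambda>z. h z *\<^sub>C (x::'a)) (sector \<phi>)"
  by (rule vholo_scaleC[OF _ sector_open _ vholo_const]) auto

lemma h_continuous: "h holomorphic_on sector \<phi> \<Longrightarrow> continuous_on S2 (\<lambda>z. h z *\<^sub>C (x::'a))"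
  by (rule continuous_on_subset[OF vholo_continuous_on[OF h_vholo]]) auto

lemma h_contour_zero:
  assumes h: "h holomorphic_on sector \<phi>" and M: "\<And>z. z \<in> sector \<phi> \<Longrightarrow> cmod (h z) \<le> M / (1 + cmod z)\<^sup>2"
  shows "contour_limit (\<lambda>z. h z *\<^sub>C (x::'a)) \<psi>2 0"
proof (rule contour_limit_inside[OF h_vholo[OF h]])
  show "small_ends (\<lambda>z. h z *\<^sub>C x) (sector \<phi>)"
  proof (rule small_endsI)
    fix z assume "z \<in> sector \<phi>"
    from mult_right_mono[OF M[OF this] norm_ge_zero[of x]]
    show "norm (h z *\<^sub>C x) \<le> (M * norm x) / (1 + cmod z)\<^sup>2" by (simp add: norm_scaleC)
  qed
qed (use angles in auto)

text \<open>Decay of order min(|z|, 1/|z|), the exponent 1 in the definition of H_0^\<infinity>. All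
  multipliers in use have it, and it survives division by 1 + tz.\<close>

definition adm :: "(complex \<Rightarrow> complex) \<Rightarrow> bool" where
  "adm h \<longleftrightarrow> h holomorphic_on sector \<phi> \<and>
    (\<exists>M\<ge>0. \<forall>z\<in>sector \<phi>. cmod (h z) \<le> M * cmod z / (1 + cmod z)\<^sup>2)"

lemma adm_holo: "adm h \<Longrightarrow> h holomorphic_on sector \<phi>" by (simp add: adm_def)

text \<open>|h| contributes M r/(1 + r)^2 and the resolvent C/r in \<open>NV\<close>; the factor r
  cancels, leaving the integrable majorant M C/(1 + r)^2 that \<open>contour_ray\<close> asks
  for.\<close>

lemma ray_integral_limit:
  assumes h: "adm h" and x: "x \<in> V" and \<theta>: "\<theta> = \<psi> \<or> \<theta> = - \<psi>"
  shows "(\<lambda>n. ray_part (\<lambda>z. h z *\<^sub>C R z x) \<theta> n) \<longlonglongrightarrow> ray_integral V NV DV A h \<theta> x"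
proof -
  obtain M where M: "0 \<le> M" "\<And>z. z \<in> sector \<phi> \<Longrightarrow> cmod (h z) \<le> M * cmod z / (1 + cmod z)\<^sup>2"
    using h unfolding adm_def by blast
  have rs: "rcis r \<theta> \<in> sector \<phi>" if "0 < r" for r
    using that \<theta> angles by (auto intro!: rcis_in_sector)
  have rf: "rcis r \<theta> \<in> far \<psi>" if "0 < r" for r
    using that \<theta> angles by (auto intro!: rcis_in_far)
  let ?c = "\<lambda>r. h (rcis r \<theta>) * cis \<theta>"
  have cr: "contour_ray D A \<Phi> N (far \<psi>) B \<theta> ?c (M * C)"
  proof (unfold_locales)
    show "continuous_on {0<..} ?c"
      by (intro continuous_on_mult continuous_on_const
          continuous_on_ray[OF holomorphic_on_imp_continuous_on[OF adm_holo[OF h]]]) (auto intro: rs)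
    show "0 \<le> M * C" using M(1) C(1) by simp
    fix r :: real and y assume r: "0 < r" and y: "y \<in> V"
    have RV: "R (rcis r \<theta>) y \<in> V"
      using V_R(1)[OF y subsetD[OF far rf[OF r]] B(1) B(2)[OF rf[OF r]]] .
    have "NV (?c r *\<^sub>C R (rcis r \<theta>) y) = cmod (h (rcis r \<theta>)) * NV (R (rcis r \<theta>) y)"
      using V_scaleC(2)[OF RV] by (simp add: norm_mult)
    also have "\<dots> \<le> (M * r / (1 + r)\<^sup>2) * NV (R (rcis r \<theta>) y)"
      using M(2)[OF rs[OF r]] r by (intro mult_right_mono NV_nonneg RV) simp
    also have "\<dots> = M / (1 + r)\<^sup>2 * (r * NV (R (rcis r \<theta>) y))" by simp
    also have "\<dots> \<le> M / (1 + r)\<^sup>2 * (C * NV y)"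
      using C(2)[OF rf[OF r] y] V_scaleC(2)[OF RV] M(1) r by (intro mult_left_mono) auto
    finally show "NV (?c r *\<^sub>C R (rcis r \<theta>) y) \<le> M * C / (1 + r)\<^sup>2 * NV y" by simp
  qed (use far B rf in auto)
  have "has_improper_operator_integral V NV (\<lambda>r x. (\<lambda>r x. ?c r *\<^sub>C resolvent DV A (rcis r \<theta>) x) r x) (ray_integral V NV DV A h \<theta>)"
    unfolding ray_integral_def by (rule someI_ex[OF contour_ray.exists_improper[OF cr]])
  from contour_ray.improper_limit(1)[OF cr this x]
  show ?thesis
    unfolding contour_ray.I_def[OF cr] contour_ray.G_def[OF cr] ray_part_def
    by (simp add: scaleC_scaleC mult.commute)
qed

lemma dunford_contour:
  assumes h: "adm h" and x: "x \<in> V"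
  shows "contour_limit (\<lambda>z. h z *\<^sub>C R z x) \<psi>2 (kk *\<^sub>C d h x)"
proof -
  let ?S = "sector \<phi> \<inter> far \<psi>"
  obtain M where M: "0 \<le> M" "\<And>z. z \<in> sector \<phi> \<Longrightarrow> cmod (h z) \<le> M * cmod z / (1 + cmod z)\<^sup>2"
    using h unfolding adm_def by blast
  have dd: "kk *\<^sub>C d h x = ray_integral V NV DV A h (- \<psi>) x - ray_integral V NV DV A h \<psi> x"
    using kk_nonzero by (simp add: dunford_def Let_def scaleC_scaleC flip: \<psi>_eq)
  have l: "contour_limit (\<lambda>z. h z *\<^sub>C R z x) \<psi> (kk *\<^sub>C d h x)"
    unfolding contour_limit_def dd by (intro tendsto_diff ray_integral_limit h x) auto
  have w: "wedge \<psi> \<psi>2 \<subseteq> ?S" "wedge (- \<psi>2) (- \<psi>) \<subseteq> ?S"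
    using angles wedge_subset_far[of \<psi> \<psi> \<psi>2] wedge_subset_sector[of \<phi> \<psi> \<psi>2] wedge_subset_sector[of \<phi> "- \<psi>2" "- \<psi>"] by auto
  have se: "small_ends (\<lambda>z. h z *\<^sub>C R z x) ?S"
  proof (rule small_endsI)
    fix z assume z: "z \<in> ?S"
    then have z0: "z \<noteq> 0" and zf: "z \<in> far \<psi>" by (auto simp: far_def)
    have RV: "R z x \<in> V" using V_R(1)[OF x subsetD[OF far zf] B(1) B(2)[OF zf]] .
    have "\<kappa> * norm (z *\<^sub>C R z x) \<le> C * NV x"
      using norm_le_NV[OF V_scaleC(1)[OF RV]] C(2)[OF zf x] by (rule order_trans)
    then have b: "cmod z * norm (R z x) \<le> C * NV x / \<kappa>"
      using \<kappa>_pos by (simp add: norm_scaleC pos_le_divide_eq mult.commute)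
    have "norm (h z *\<^sub>C R z x) \<le> (M * cmod z / (1 + cmod z)\<^sup>2) * norm (R z x)"
      unfolding norm_scaleC using M(2) z by (intro mult_right_mono) auto
    also have "\<dots> = M / (1 + cmod z)\<^sup>2 * (cmod z * norm (R z x))" by simp
    also have "\<dots> \<le> M / (1 + cmod z)\<^sup>2 * (C * NV x / \<kappa>)"
      using M(1) by (intro mult_left_mono b) auto
    finally show "norm (h z *\<^sub>C R z x) \<le> (M * (C * NV x / \<kappa>)) / (1 + cmod z)\<^sup>2"
      by (simp add: mult.commute)
  qed
  show ?thesis
    by (rule contour_limit_shift[OF hR_vholo[OF adm_holo[OF h]] se w _ _ _ _ l]) (use angles in auto)
qed

text \<open>Each factor 1 + tz supplies a power of 1 + |z| with constant c min(1, t). These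
  constants degenerate as s -> 0; they only make integrals converge and arcs vanish.\<close>

lemma adm_quotient:
  assumes f: "f holomorphic_on sector \<phi>" "\<And>z. z \<in> sector \<phi> \<Longrightarrow> cmod (f z) \<le> F" and ts: "0 < t" "0 < s"
  shows "adm (\<lambda>z. f z * z / den t s z)"
    and "\<exists>M. \<forall>z\<in>sector \<phi>. cmod (f z / den t s z) \<le> M / (1 + cmod z)\<^sup>2"
    and "(\<lambda>z. f z / den t s z) holomorphic_on sector \<phi>"
proof -
  define m where "m t = c * min 1 t" for t
  have m: "0 < m t" "z \<in> sector \<phi> \<Longrightarrow> m t * (1 + cmod z) \<le> cmod (1 + of_real t * z)" if "0 < t" for t z
  proof -
    show "0 < m t" using c(1) that by (simp add: m_def)
    assume z: "z \<in> sector \<phi>"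
    have "m t * (1 + cmod z) \<le> c * (1 + t * cmod z)"
      unfolding m_def mult.assoc using c(1) one_plus_mult_ge[OF that, of "cmod z"] by (intro mult_left_mono) auto
    also have "\<dots> \<le> cmod (1 + of_real t * z)" using c(2)[OF z, of t] that by simp
    finally show "m t * (1 + cmod z) \<le> cmod (1 + of_real t * z)" .
  qed
  let ?M = "\<bar>F\<bar> / (m t * m s)"
  have b: "cmod (f z / den t s z) \<le> ?M / (1 + cmod z)\<^sup>2" if z: "z \<in> sector \<phi>" for z
  proof -
    have p: "0 < 1 + cmod z" by (simp add: add_pos_nonneg)
    have "cmod (f z / den t s z)
        = cmod (f z) / (cmod (1 + of_real t * z) * cmod (1 + of_real s * z))" by (simp add: norm_divide norm_mult)
    also have "\<dots> \<le> \<bar>F\<bar> / ((m t * (1 + cmod z)) * (m s * (1 + cmod z)))"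
      using f(2)[OF z] m(1)[OF ts(1)] m(1)[OF ts(2)] p
      by (intro frac_le mult_mono m(2) z ts mult_pos_pos) auto
    finally show ?thesis by (simp add: power2_eq_square mult.assoc mult.left_commute)
  qed
  then show "\<exists>M. \<forall>z\<in>sector \<phi>. cmod (f z / den t s z) \<le> M / (1 + cmod z)\<^sup>2" by blast
  show holo: "(\<lambda>z. f z / den t s z) holomorphic_on sector \<phi>"
    using c(3) ts by (intro holomorphic_intros f) auto
  have eq: "(\<lambda>z. f z * z / den t s z) = (\<lambda>z. f z / den t s z * z)"
    by simp
  show "adm (\<lambda>z. f z * z / den t s z)"
    unfolding adm_def eq
  proof (intro conjI exI[of _ ?M] ballI)
    show "(\<lambda>z. f z / den t s z * z) holomorphic_on sector \<phi>"
      by (intro holomorphic_on_mult holo holomorphic_on_ident)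
    show "0 \<le> ?M" using m(1) ts by (intro divide_nonneg_nonneg mult_nonneg_nonneg) (auto simp: less_imp_le)
    fix z assume z: "z \<in> sector \<phi>"
    from mult_right_mono[OF b[OF z] norm_ge_zero[of z]]
    show "cmod (f z / den t s z * z) \<le> ?M * cmod z / (1 + cmod z)\<^sup>2"
      by (subst norm_mult) simp
  qed
qed

lemma adm_div:
  assumes h: "adm h" and t: "0 < t"
  shows "adm (\<lambda>z. h z / (1 + of_real t * z))"
    and "(\<lambda>z. h z * of_real t / (1 + of_real t * z)) holomorphic_on sector \<phi>"
    and "\<exists>M. \<forall>z\<in>sector \<phi>. cmod (h z * of_real t / (1 + of_real t * z)) \<le> M / (1 + cmod z)\<^sup>2"
proof -
  obtain M where M: "0 \<le> M" "\<And>z. z \<in> sector \<phi> \<Longrightarrow> cmod (h z) \<le> M * cmod z / (1 + cmod z)\<^sup>2"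
    using h unfolding adm_def by blast
  have b: "cmod (h z / (1 + of_real t * z)) \<le> (M * cmod z / (1 + cmod z)\<^sup>2) / (c * (1 + t * cmod z))" if z: "z \<in> sector \<phi>" for z
    unfolding norm_divide
    using M(2)[OF z] c(1) c(2)[OF z, of t] t M(1) by (intro frac_le) (auto intro!: mult_pos_pos add_pos_nonneg)
  show "adm (\<lambda>z. h z / (1 + of_real t * z))"
    unfolding adm_def
  proof (intro conjI exI[of _ "M / c"] ballI)
    show "(\<lambda>z. h z / (1 + of_real t * z)) holomorphic_on sector \<phi>"
      using c(3) t by (intro holomorphic_intros adm_holo h) auto
    show "0 \<le> M / c" using M c by simp
    fix z assume z: "z \<in> sector \<phi>"
    have "(M * cmod z / (1 + cmod z)\<^sup>2) / (c * (1 + t * cmod z)) \<le> (M * cmod z / (1 + cmod z)\<^sup>2) / (c * 1)"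
      using M(1) c(1) t by (intro divide_left_mono mult_left_mono) (auto intro!: mult_pos_pos add_pos_nonneg)
    then show "cmod (h z / (1 + of_real t * z)) \<le> M / c * cmod z / (1 + cmod z)\<^sup>2"
      using b[OF z] by (simp add: mult.commute)
  qed
  show "(\<lambda>z. h z * of_real t / (1 + of_real t * z)) holomorphic_on sector \<phi>"
    using c(3) t by (intro holomorphic_intros adm_holo h) auto
  have "cmod (h z * of_real t / (1 + of_real t * z)) \<le> (M / c) / (1 + cmod z)\<^sup>2" if z: "z \<in> sector \<phi>" for z
  proof -
    have p: "0 < 1 + t * cmod z" using t by (simp add: add_pos_nonneg)
    have "cmod (h z * of_real t / (1 + of_real t * z)) = cmod (h z / (1 + of_real t * z)) * t"
      using t by (simp add: norm_divide norm_mult)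
    also have "\<dots> \<le> (M * cmod z / (1 + cmod z)\<^sup>2) / (c * (1 + t * cmod z)) * t"
      using b[OF z] t by (intro mult_right_mono) auto
    also have "\<dots> = (M / c / (1 + cmod z)\<^sup>2) * (t * cmod z / (1 + t * cmod z))" by (simp add: mult_ac)
    also have "\<dots> \<le> (M / c / (1 + cmod z)\<^sup>2) * 1"
      using M(1) c(1) p by (intro mult_left_mono) auto
    finally show ?thesis by simp
  qed
  then show "\<exists>M. \<forall>z\<in>sector \<phi>. cmod (h z * of_real t / (1 + of_real t * z)) \<le> M / (1 + cmod z)\<^sup>2" by blast
qed

text \<open>By \<open>J_R\<close> the operator (1 + tA)^-1 multiplies the symbol by 1/(1 + tz), up
  to a scalar function times J t x. That function is holomorphic in the sector with quadratic decay,
  so its contour integral is 0.\<close>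

lemma J_dunford:
  assumes h: "adm h" and x: "x \<in> V" and t: "0 < t"
  shows "J t (d h x) = d (\<lambda>z. h z / (1 + of_real t * z)) x"
proof -
  let ?h = "\<lambda>z. h z / (1 + of_real t * z)"
  let ?q = "\<lambda>z. h z * of_real t / (1 + of_real t * z)"
  obtain M where M: "\<And>z. z \<in> sector \<phi> \<Longrightarrow> cmod (?q z) \<le> M / (1 + cmod z)\<^sup>2" using adm_div(3)[OF h t] by blast
  have nz: "1 + of_real t * z \<noteq> 0" if "z \<in> sector \<phi>" for z
    using one_plus_nonzero[OF that] t by simp
  have "contour_limit (\<lambda>z. J t (h z *\<^sub>C R z x)) \<psi>2 (J t (kk *\<^sub>C d h x))"
    by (rule contour_limit_linear[OF hR_continuous[OF adm_holo[OF h]] ray_S2 J_bounded_linear[OF t neg_\<rho>[OF t]] J_scaleC[OF t neg_\<rho>[OF t]]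
       dunford_contour[OF h x]])
  moreover have "contour_limit (\<lambda>z. ?h z *\<^sub>C R z x + ?q z *\<^sub>C J t x) \<psi>2 (kk *\<^sub>C d ?h x + 0)"
    by (rule contour_limit_add[OF hR_continuous[OF adm_holo[OF adm_div(1)[OF h t]]] h_continuous[OF adm_div(2)[OF h t]]
       ray_S2 dunford_contour[OF adm_div(1)[OF h t] x] h_contour_zero[OF adm_div(2)[OF h t] M]])
  then have "contour_limit (\<lambda>z. J t (h z *\<^sub>C R z x)) \<psi>2 (kk *\<^sub>C d ?h x + 0)"
  proof (rule contour_cong[rotated])
    fix z assume z: "z \<in> S2"
    then have "z \<in> \<rho>" using far far2 by auto
    then show "?h z *\<^sub>C R z x + ?q z *\<^sub>C J t x = J t (h z *\<^sub>C R z x)"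
      using J_scaleC[OF t neg_\<rho>[OF t]] J_R[OF t neg_\<rho>[OF t] _ nz] z by (simp add: scaleC_add_right scaleC_scaleC)
  qed
  ultimately have "J t (kk *\<^sub>C d h x) = kk *\<^sub>C d ?h x" using contour_limit_unique by fastforce
  then show ?thesis
    using scaleC_cancel[OF _ kk_nonzero] J_scaleC[OF t neg_\<rho>[OF t]] by metis
qed

text \<open>Shifts the computed case pi/2 to \<psi>2, which may lie on either side of it. In
  \<open>?S\<close> the condition \<alpha> > 0 keeps out the pole 1, and \<phi>' < pi keeps out the
  pole -1; no resolvent is involved, so \<phi>' may exceed \<phi>.\<close>

lemma scalar_contour: "contour_limit (\<lambda>z. (2 / (z\<^sup>2 - 1)) *\<^sub>C (w::'a)) \<psi>2 (kk *\<^sub>C w)"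
proof -
  define \<alpha> where "\<alpha> = min \<psi>2 (pi / 2)"
  define \<beta> where "\<beta> = max \<psi>2 (pi / 2)"
  define \<phi>' where "\<phi>' = (\<beta> + pi) / 2"
  have ab: "0 < \<alpha>" "\<alpha> \<le> \<beta>" "\<beta> < \<phi>'" "\<phi>' < pi" using angles by (auto simp: \<alpha>_def \<beta>_def \<phi>'_def)
  let ?S = "sector \<phi>' \<inter> far \<alpha>"
  let ?g = "\<lambda>z. (2 / (z\<^sup>2 - 1)) *\<^sub>C w"
  obtain c1 where c1: "0 < c1" "\<And>z t. z \<in> sector \<phi>' \<Longrightarrow> 0 \<le> t \<Longrightarrow> c1 * (1 + t * cmod z) \<le> cmod (1 + of_real t * z)"
    using one_plus_lower[of \<phi>'] ab by auto
  obtain c2 where c2: "0 < c2" "\<And>z. z \<in> far \<alpha> \<Longrightarrow> c2 * (1 + cmod z) \<le> cmod (z - 1)"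
    using minus_one_lower[of \<alpha>] ab by auto
  have lower: "(c1 * c2) * (1 + cmod z)\<^sup>2 \<le> cmod (z\<^sup>2 - 1)" if "z \<in> ?S" for z
  proof -
    have "(c1 * (1 + cmod z)) * (c2 * (1 + cmod z)) \<le> cmod (1 + z) * cmod (z - 1)"
      using c1(2)[of z 1] c2(2)[of z] that c1(1) c2(1) by (intro mult_mono) auto
    also have "\<dots> = cmod (z\<^sup>2 - 1)" by (simp add: norm_mult[symmetric] power2_eq_square algebra_simps)
    finally show ?thesis by (simp add: power2_eq_square mult_ac)
  qed
  have pos: "0 < (c1 * c2) * (1 + cmod z)\<^sup>2" for z using c1(1) c2(1) by (auto intro!: mult_pos_pos zero_less_power add_pos_nonneg)
  have nz: "z\<^sup>2 - 1 \<noteq> 0" if "z \<in> ?S" for z using lower[OF that] pos[of z] by auto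
  have v: "vholo ?g ?S"
  proof (rule vholo_scaleC[OF _ _ _ vholo_const])
    show "(\<lambda>z. 2 / (z\<^sup>2 - 1)) holomorphic_on {z. z\<^sup>2 - 1 \<noteq> 0}" by (intro holomorphic_intros) auto
    show "open {z::complex. z\<^sup>2 - 1 \<noteq> 0}" by (intro open_Collect_neq continuous_intros)
    show "?S \<subseteq> {z. z\<^sup>2 - 1 \<noteq> 0}" using nz by blast
  qed
  have se: "small_ends ?g ?S"
  proof (rule small_endsI)
    fix z assume z: "z \<in> ?S"
    have "norm (?g z) = 2 * norm w / cmod (z\<^sup>2 - 1)" by (simp add: norm_scaleC norm_divide)
    also have "\<dots> \<le> 2 * norm w / ((c1 * c2) * (1 + cmod z)\<^sup>2)"
      by (intro divide_left_mono lower z mult_pos_pos[OF less_le_trans[OF pos lower[OF z]] pos]) auto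
    finally show "norm (?g z) \<le> (2 * norm w / (c1 * c2)) / (1 + cmod z)\<^sup>2" by simp
  qed
  have w: "wedge \<alpha> \<beta> \<subseteq> ?S" "wedge (- \<beta>) (- \<alpha>) \<subseteq> ?S"
    using ab wedge_subset_far[of \<alpha> \<alpha> \<beta>] wedge_subset_sector[of \<phi>' \<alpha> \<beta>] wedge_subset_sector[of \<phi>' "- \<beta>" "- \<alpha>"] by auto
  show ?thesis
    by (rule contour_limit_shift[OF v se w _ _ _ _ arctan_contour]) (auto simp: \<alpha>_def \<beta>_def)
qed

lemma A_R_le: "z \<in> far \<psi>2 \<Longrightarrow> norm (A (R z y)) \<le> (M2 + 1) * K (1 / cmod z) y"
  using far far2 M2 by (intro A_R_le_K) (auto simp: far_def)

text \<open>Left of the contour the difference is holomorphic, the pole 1 lying to the right. It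
  equals (A R(z) y - R(z) y)/(z - 1), which is o(1/|z|) at infinity because K(1/|z|, y) -> 0. R(z) y
  alone behaves like y/z there, too large for the arcs.\<close>

lemma resolvent_contour_zero:
  assumes y: "y \<in> V"
  shows "contour_limit (\<lambda>z. R z y - (1 / (z - 1)) *\<^sub>C y) \<psi>2 0"
proof -
  let ?E = "\<lambda>z. (M2 + 1) * K (1 / cmod z) y + norm (R z y)"
  have \<psi>2: "0 < \<psi>2" "\<psi>2 \<le> pi" using angles by auto
  obtain q where q: "0 < q" "\<And>z. z \<in> far \<psi>2 \<Longrightarrow> q * (1 + cmod z) \<le> cmod (z - 1)"
    using minus_one_lower[OF \<psi>2] by blast
  have cp: "0 < q * (1 + cmod z)" for z using q(1) by (auto intro!: mult_pos_pos add_pos_nonneg)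
  have nz: "z - 1 \<noteq> 0" if "z \<in> far \<psi>2" for z using q(2)[OF that] cp[of z] by auto
  have "vholo (\<lambda>z. (1 / (z - 1)) *\<^sub>C y) (far \<psi>2)"
  proof (rule vholo_scaleC[OF _ _ _ vholo_const])
    show "(\<lambda>z. 1 / (z - 1)) holomorphic_on {z. z - 1 \<noteq> 0}" by (intro holomorphic_intros) auto
    show "open {z::complex. z - 1 \<noteq> 0}" by (intro open_Collect_neq continuous_intros)
    show "far \<psi>2 \<subseteq> {z. z - 1 \<noteq> 0}" using nz by blast
  qed
  then have v: "vholo (\<lambda>z. R z y - (1 / (z - 1)) *\<^sub>C y) (far \<psi>2)"
    by (intro vholo_diff vholo_subset[OF R_vholo_far far2])
  have b: "cmod z * norm (R z y - (1 / (z - 1)) *\<^sub>C y) \<le> cmod z / (q * (1 + cmod z)) * ?E z"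
    if z: "z \<in> far \<psi>2" for z
  proof -
    have \<rho>: "z \<in> \<rho>" using z far far2 by auto
    have "A (R z y) - R z y = (z - 1) *\<^sub>C R z y - y"
      by (simp add: A_R[OF \<rho>] scaleC.scale_left_diff_distrib)
    then have "(1 / (z - 1)) *\<^sub>C (A (R z y) - R z y) = R z y - (1 / (z - 1)) *\<^sub>C y"
      using nz[OF z] by (simp add: scaleC.scale_right_diff_distrib scaleC_scaleC)
    then have "norm (R z y - (1 / (z - 1)) *\<^sub>C y) = norm ((1 / (z - 1)) *\<^sub>C (A (R z y) - R z y))" by simp
    also have "\<dots> = norm (A (R z y) - R z y) / cmod (z - 1)"
      by (simp add: norm_scaleC norm_divide)
    also have "\<dots> \<le> ?E z / (q * (1 + cmod z))"
      using norm_triangle_ineq4[of "A (R z y)" "R z y"] A_R_le[OF z, of y] q(2)[OF z] cp[of z] M2(1) K_nonneg[of "1 / cmod z" y]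
      by (intro frac_le) (auto intro: order_trans[OF norm_ge_zero])
    finally have "cmod z * norm (R z y - (1 / (z - 1)) *\<^sub>C y) \<le> cmod z * (?E z / (q * (1 + cmod z)))"
      by (rule mult_left_mono) simp
    then show ?thesis by simp
  qed
  \<comment> \<open>\<alpha> bounds the small arcs, where \<open>B\<close> keeps R(z) y bounded;
    \<beta> bounds the large ones, where \<open>M2\<close> and \<open>K_tendsto_0\<close>
    apply.\<close>
  define \<alpha> where "\<alpha> n = (1 / real (Suc n)) * (((M2 + 1) * norm y + B * norm y) / q)" for n
  define \<beta> where "\<beta> n = (1 / q) * ((M2 + 1) * K (1 / real (Suc n)) y + M2 * norm y * (1 / real (Suc n)))" for n
  have "small_ends (\<lambda>z. R z y - (1 / (z - 1)) *\<^sub>C y) (far \<psi>2)"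
    unfolding small_ends_def
  proof (intro exI conjI allI impI)
    show "\<alpha> \<longlonglongrightarrow> 0" unfolding \<alpha>_def by (rule tendsto_mult_left_zero[OF inverse_Suc_tendsto_0])
    have "\<beta> \<longlonglongrightarrow> (1 / q) * ((M2 + 1) * 0 + M2 * norm y * 0)"
      unfolding \<beta>_def by (intro tendsto_mult tendsto_add tendsto_const inverse_Suc_tendsto_0 K_tendsto_0 y)
    then show "\<beta> \<longlonglongrightarrow> 0" by simp
    fix n z assume z: "z \<in> far \<psi>2"
    have zf: "z \<in> far \<psi>" using z far2 by auto
    { assume r: "cmod z = 1 / real (Suc n)"
      have "cmod z / (q * (1 + cmod z)) * ?E z \<le> cmod z / (q * 1) * ((M2 + 1) * norm y + B * norm y)"
      proof (rule mult_mono)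
        show "cmod z / (q * (1 + cmod z)) \<le> cmod z / (q * 1)"
          using q(1) cp[of z] by (intro divide_left_mono mult_left_mono) auto
        show "?E z \<le> (M2 + 1) * norm y + B * norm y"
          using M2(1) B(2)[OF zf] K_le_norm[of "1 / cmod z" y] by (intro add_mono mult_left_mono) auto
        show "0 \<le> ?E z"
          using M2(1) K_nonneg[of "1 / cmod z" y] by simp
      qed (use q(1) in auto)
      then show "cmod z * norm (R z y - (1 / (z - 1)) *\<^sub>C y) \<le> \<alpha> n"
        using b[OF z] r by (simp add: \<alpha>_def del: of_nat_Suc) }
    { assume r: "cmod z = real (Suc n)"
      have "cmod z / (q * (1 + cmod z)) * ?E z
         \<le> 1 / q * ((M2 + 1) * K (1 / cmod z) y + M2 * norm y * (1 / cmod z))"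
      proof (rule mult_mono)
        have "cmod z \<le> 1 + cmod z" by simp
        then show "cmod z / (q * (1 + cmod z)) \<le> 1 / q"
          using q(1) cp[of z] by (simp add: divide_le_eq)
        have "norm (R z y) \<le> M2 * norm y * (1 / cmod z)"
          using M2(2)[OF z, of y] r by (simp add: norm_scaleC field_simps del: of_nat_Suc)
        then show "?E z \<le> (M2 + 1) * K (1 / cmod z) y + M2 * norm y * (1 / cmod z)" by simp
        show "0 \<le> ?E z"
          using M2(1) K_nonneg[of "1 / cmod z" y] by simp
      qed (use q(1) in auto)
      then show "cmod z * norm (R z y - (1 / (z - 1)) *\<^sub>C y) \<le> \<beta> n"
        using b[OF z] r by (simp add: \<beta>_def del: of_nat_Suc) }
  qed
  then show ?thesis using \<psi>2 by (intro contour_limit_outside[OF v]) auto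
qed

end

section \<open>The regularizer applied to the part\<close>

context contour_calculus
begin

lemma adm_regularizer: "adm regularizer"
  and adm_f_regularizer: "f \<in> H_inf \<phi> \<Longrightarrow> adm (\<lambda>z. f z * regularizer z)"
proof -
  have e: "(\<lambda>z. f z * z / den 1 1 z) = (\<lambda>z. f z * regularizer z)" for f :: "complex \<Rightarrow> complex"
    by (simp add: regularizer_def power2_eq_square)
  show "adm regularizer"
    using adm_quotient(1)[of "\<lambda>z. 1" 1 1 1] e[of "\<lambda>z. 1"] by simp
  assume f: "f \<in> H_inf \<phi>"
  then have "f holomorphic_on sector \<phi>" by (simp add: H_inf_def)
  from adm_quotient(1)[OF this H_inf_norm_bound[OF f] zero_less_one zero_less_one]
  show "adm (\<lambda>z. f z * regularizer z)" unfolding e .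
qed

lemma S2_nonzero: "z \<in> S2 \<Longrightarrow> z - 1 \<noteq> 0" "z \<in> S2 \<Longrightarrow> 1 + z \<noteq> 0"
proof -
  assume z: "z \<in> S2"
  show "z - 1 \<noteq> 0" using z angles by (auto simp: far_def)
  show "1 + z \<noteq> 0"
    using one_plus_nonzero[of z 1] z by simp
qed

text \<open>The identity
  \<open>e(z) R(z) = A J\<^sup>2 (R(z) - 1/(z - 1)) + 2/(z\<^sup>2 - 1) A J\<^sup>2 + J/(1 + z)\<^sup>2\<close> with \<open>J = (1 + A)\<^sup>-\<^sup>1\<close> splits the
  integrand: the first summand is holomorphic to the left of the contour, the last one to the right, and only
  the scalar integral in the middle contributes.\<close>

lemma dunford_regularizer:
  assumes y: "y \<in> V"
  shows "d regularizer y = J 1 y - J 1 (J 1 y)"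
proof -
  \<comment> \<open>A J = 1 - J for J = \<open>J 1\<close>, so A J^2 equals J - J^2; in this form it
    is visibly bounded and everywhere defined and can be taken through the integral.\<close>
  let ?L = "\<lambda>u. J 1 u - J 1 (J 1 u)"
  have J: "bounded_linear (J 1)" "\<And>a x. J 1 (a *\<^sub>C x) = a *\<^sub>C J 1 x"
    using J_bounded_linear[OF _ neg_\<rho>, of 1] J_scaleC[OF _ neg_\<rho>, of 1] by auto
  interpret J: bounded_linear "J 1" by (rule J(1))
  have L: "bounded_linear ?L" by (intro bounded_linear_sub J(1) bounded_linear_compose[OF J(1) J(1)])
  have Lsc: "?L (a *\<^sub>C x) = a *\<^sub>C ?L x" for a x by (simp add: J(2) scaleC.scale_right_diff_distrib)
  let ?g0 = "\<lambda>z. R z y - (1 / (z - 1)) *\<^sub>C y"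
  let ?g2 = "\<lambda>z. (2 / (z\<^sup>2 - 1)) *\<^sub>C ?L y"
  let ?g3 = "\<lambda>z. (1 / den 1 1 z) *\<^sub>C J 1 y"
  have S2far: "S2 \<subseteq> far \<psi>" using far2 by auto
  have c0: "continuous_on S2 ?g0"
    using S2_nonzero(1) continuous_on_subset[OF vholo_continuous_on[OF R_vholo_far] S2far]
    by (intro continuous_on_diff continuous_on_scaleC continuous_on_const continuous_on_divide continuous_on_id) auto
  have c1: "continuous_on S2 (\<lambda>z. ?L (?g0 z))"
    by (rule bounded_linear.continuous_on[OF L c0])
  have sq: "z\<^sup>2 - 1 = (z - 1) * (1 + z)" for z :: complex by (simp add: power2_eq_square algebra_simps)
  have c2: "continuous_on S2 ?g2"
    unfolding sq using S2_nonzero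
    by (intro continuous_on_scaleC continuous_on_const continuous_on_divide continuous_on_mult continuous_on_diff
        continuous_on_add continuous_on_id) auto
  have h3: "(\<lambda>z. 1 / den 1 1 z) holomorphic_on sector \<phi>"
    using adm_quotient(3)[of "\<lambda>z. 1" 1 1 1] by simp
  obtain M where M: "\<And>z. z \<in> sector \<phi> \<Longrightarrow> cmod (1 / den 1 1 z) \<le> M / (1 + cmod z)\<^sup>2"
    using adm_quotient(2)[of "\<lambda>z. 1" 1 1 1] by auto
  have l1: "contour_limit (\<lambda>z. ?L (?g0 z)) \<psi>2 (?L 0)"
    by (rule contour_limit_linear[OF c0 ray_S2 L Lsc resolvent_contour_zero[OF y]])
  have l12: "contour_limit (\<lambda>z. ?L (?g0 z) + ?g2 z) \<psi>2 (?L 0 + kk *\<^sub>C ?L y)"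
    by (rule contour_limit_add[OF c1 c2 ray_S2 l1 scalar_contour])
  have "contour_limit (\<lambda>z. ?L (?g0 z) + ?g2 z + ?g3 z) \<psi>2 (?L 0 + kk *\<^sub>C ?L y + 0)"
    by (rule contour_limit_add[OF continuous_on_add[OF c1 c2] h_continuous[OF h3] ray_S2 l12 h_contour_zero[OF h3 M]])
  then have "contour_limit (\<lambda>z. regularizer z *\<^sub>C R z y) \<psi>2 (?L 0 + kk *\<^sub>C ?L y + 0)"
  proof (rule contour_cong[rotated])
    fix z assume z: "z \<in> S2"
    \<comment> \<open>With these names e(z) = a - a^2, 2/(z^2 - 1) = b - a and J r = a (r + p), and
      the identity becomes linear algebra.\<close>
    define a where "a = 1 / (1 + z)"
    define b where "b = 1 / (z - 1)"
    define r where "r = R z y"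
    define p where "p = J 1 y"
    define q where "q = J 1 p"
    have nz: "z - 1 \<noteq> 0" "1 + z \<noteq> 0" using S2_nonzero[OF z] .
    have \<rho>: "z \<in> \<rho>" using z S2far far by auto
    have c: "2 / (z\<^sup>2 - 1) = b - a" unfolding sq a_def b_def using nz by (simp add: field_simps)
    have "regularizer z = ((1 + z) - 1) / ((1 + z) * (1 + z))" by (simp add: regularizer_def power2_eq_square)
    also have "\<dots> = a - a * a" unfolding diff_divide_distrib using nz by (simp add: a_def)
    finally have e: "regularizer z = a - a * a" .
    have a2: "1 / den 1 1 z = a * a" by (simp add: a_def)
    have Jr: "J 1 r = a *\<^sub>C r + a *\<^sub>C p"
      using J_R[OF _ neg_\<rho>[of 1] \<rho>, of y] nz by (simp add: r_def p_def a_def)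
    have JJr: "J 1 (J 1 r) = a *\<^sub>C (a *\<^sub>C r + a *\<^sub>C p) + a *\<^sub>C q"
      by (simp add: Jr J.add J(2) q_def)
    have "?L (?g0 z) = ?L r - b *\<^sub>C (p - q)"
      by (simp add: J.diff J(2) r_def p_def q_def b_def scaleC.scale_right_diff_distrib)
    moreover have "?g2 z = (b - a) *\<^sub>C (p - q)" by (simp only: c p_def q_def)
    moreover have "?g3 z = (a * a) *\<^sub>C p" by (simp only: a2 p_def)
    ultimately have "?L (?g0 z) + ?g2 z + ?g3 z
        = (a *\<^sub>C r + a *\<^sub>C p - (a *\<^sub>C (a *\<^sub>C r + a *\<^sub>C p) + a *\<^sub>C q)) - b *\<^sub>C (p - q) + (b - a) *\<^sub>C (p - q) + (a * a) *\<^sub>C p"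
      by (simp only: JJr) (simp only: Jr)
    also have "\<dots> = regularizer z *\<^sub>C R z y"
      unfolding e r_def[symmetric]
      by (simp add: scaleC_add_right scaleC.scale_left_diff_distrib scaleC.scale_right_diff_distrib scaleC_scaleC)
    finally show "?L (?g0 z) + ?g2 z + ?g3 z = regularizer z *\<^sub>C R z y" .
  qed
  from contour_limit_unique[OF this dunford_contour[OF adm_regularizer y]]
  have "kk *\<^sub>C d regularizer y = kk *\<^sub>C ?L y" by (simp add: J.zero)
  then show ?thesis using scaleC_cancel[OF _ kk_nonzero] by blast
qed

section \<open>Pointwise estimate of the K-functional\<close>

lemma A_J_commute:
  assumes "0 < t" "v \<in> D"
  shows "A (J t v) = J t (A v)"
  unfolding J_def
  by (simp only: A_linear(2) R_in[OF neg_\<rho>[OF assms(1)]] A_R_commute[OF neg_\<rho>[OF assms(1)] assms(2)])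

text \<open>J t J s is applied to e(B) y = (f e)(B) x, where B is the part. With m(z) = f(z) z/((1 +
  tz)(1 + sz)) the symbol on the right becomes m(z)/(1 + z)^2, so both sides carry
  \<open>J 1\<close> twice and injectivity cancels it. This leaves A J t J s y = m(B) x, and t A J t
  = 1 - J t.\<close>

lemma J_twice_dunford:
  assumes f: "f \<in> H_inf \<phi>" and x: "x \<in> V" and y: "y \<in> V"
    and eq: "d regularizer y = d (\<lambda>z. f z * regularizer z) x" and ts: "0 < t" "0 < s"
  shows "J s y - J t (J s y) = of_real t *\<^sub>C d (\<lambda>z. f z * z / den t s z) x"
proof -
  let ?m = "\<lambda>z. f z * z / den t s z"
  have fh: "f holomorphic_on sector \<phi>" using f by (simp add: H_inf_def)
  have m: "adm ?m" by (rule adm_quotient(1)[OF fh H_inf_norm_bound[OF f] ts])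
  have fe: "adm (\<lambda>z. f z * regularizer z)" by (rule adm_f_regularizer[OF f])
  have bl: "bounded_linear (J r)" if "0 < r" for r by (rule J_bounded_linear[OF that neg_\<rho>[OF that]])
  define v where "v = J t (J s y)"
  have vD: "v \<in> D" unfolding v_def by (rule J_in'[OF ts(1) ts(1)])
  have one: "0 < (1::real)" by simp
  have "v - J 1 v = J 1 (A v)"
    using A_J'[OF one one, of v] A_J_commute[OF one vD] by simp
  then have "J 1 (J 1 (A v)) = J 1 v - J 1 (J 1 v)"
    using linear_diff[OF bounded_linear.linear[OF bl[OF one]], of v "J 1 v"] by simp
  also have "\<dots> = J t (J s (J 1 y)) - J t (J s (J 1 (J 1 y)))"
  proof -
    have "J 1 (J t (J s u)) = J t (J s (J 1 u))" for u
      using J_commute[OF neg_\<rho>[OF one] neg_\<rho>[OF ts(1)], of "J s u"] J_commute[OF neg_\<rho>[OF one] neg_\<rho>[OF ts(2)], of u]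
      by simp
    then show ?thesis unfolding v_def by simp
  qed
  also have "\<dots> = J t (J s (d regularizer y))"
    unfolding dunford_regularizer[OF y]
    using linear_diff[OF bounded_linear.linear[OF bl[OF ts(1)]]] linear_diff[OF bounded_linear.linear[OF bl[OF ts(2)]]] by simp
  also have "\<dots> = d (\<lambda>z. f z * regularizer z / (1 + of_real s * z) / (1 + of_real t * z)) x"
    unfolding eq J_dunford[OF fe x ts(2)] by (rule J_dunford[OF adm_div(1)[OF fe ts(2)] x ts(1)])
  also have "(\<lambda>z. f z * regularizer z / (1 + of_real s * z) / (1 + of_real t * z))
      = (\<lambda>z. ?m z / (1 + of_real 1 * z) / (1 + of_real 1 * z))"
    by (simp add: regularizer_def power2_eq_square mult_ac)
  also have "d \<dots> x = J 1 (J 1 (d ?m x))"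
    unfolding J_dunford[OF m x one] by (rule J_dunford[OF adm_div(1)[OF m one] x one, symmetric])
  finally have "J 1 (J 1 (A v - d ?m x)) = 0"
    using linear_diff[OF bounded_linear.linear[OF bl[OF one]]] by simp
  from J_inj[OF one neg_\<rho>[OF one] J_inj[OF one neg_\<rho>[OF one] this]] have "A v - d ?m x = 0" .
  then have "A v = d ?m x" by simp
  then show ?thesis
    using A_J'[OF ts(1) ts(1), of "J s y"] ts(1) by (simp add: v_def[symmetric] scaleC_scaleC)
qed

text \<open>Bounding |1 + sz| from below by c alone makes the estimate uniform in s. The factor 2 pi
  of the contour integral meets two rays with equal bounds, which leaves pi.\<close>

lemma norm_dunford_le:
  assumes f: "f \<in> H_inf \<phi>" and x: "x \<in> V" and ts: "0 < t" "0 < s"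
  shows "pi * norm (d (\<lambda>z. f z * z / den t s z) x)
    \<le> H_inf_norm \<phi> f * (M2 + 1) / c\<^sup>2 * cmod (PQ x t)"
proof -
  let ?m = "\<lambda>z. f z * z / den t s z"
  let ?q = "\<lambda>z. f z / den t s z"
  let ?g = "\<lambda>z. ?q z *\<^sub>C A (R z x)"
  let ?Q = "cmod (PQ x t)"
  let ?F = "H_inf_norm \<phi> f"
  define k where "k = ?F * (M2 + 1) / c\<^sup>2"
  have fh: "f holomorphic_on sector \<phi>" using f by (simp add: H_inf_def)
  have m: "adm ?m" by (rule adm_quotient(1)[OF fh H_inf_norm_bound[OF f] ts])
  have qh: "?q holomorphic_on sector \<phi>" by (rule adm_quotient(3)[OF fh H_inf_norm_bound[OF f] ts])
  obtain M where M: "\<And>z. z \<in> sector \<phi> \<Longrightarrow> cmod (?q z) \<le> M / (1 + cmod z)\<^sup>2"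
    using adm_quotient(2)[OF fh H_inf_norm_bound[OF f] ts] by blast
  have geq: "?m z *\<^sub>C R z x + ?q z *\<^sub>C (- x) = ?g z" if "z \<in> S2" for z
  proof -
    have "z \<in> \<rho>" using that far far2 by auto
    moreover have "?m z = ?q z * z" by simp
    ultimately show ?thesis
      by (simp add: A_R scaleC.scale_right_diff_distrib scaleC_scaleC)
  qed
  have "contour_limit (\<lambda>z. ?m z *\<^sub>C R z x + ?q z *\<^sub>C (- x)) \<psi>2 (kk *\<^sub>C d ?m x + 0)"
    by (rule contour_limit_add[OF hR_continuous[OF adm_holo[OF m]] h_continuous[OF qh] ray_S2 dunford_contour[OF m x]
       h_contour_zero[OF qh M]])
  then have l: "contour_limit ?g \<psi>2 (kk *\<^sub>C d ?m x + 0)"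
    by (rule contour_cong[rotated]) (rule geq)
  have "continuous_on S2 (\<lambda>z. ?m z *\<^sub>C R z x + ?q z *\<^sub>C (- x))"
    by (rule continuous_on_add[OF hR_continuous[OF adm_holo[OF m]] h_continuous[OF qh]])
  then have gc: "continuous_on S2 ?g" by (rule continuous_on_eq) (rule geq)
  have F0: "0 \<le> ?F" by (rule H_inf_norm_nonneg[OF f])
  then have k0: "0 \<le> k" using M2(1) by (simp add: k_def)
  have gn: "norm (?g z) \<le> k * (K (1 / cmod z) x / (1 + t * cmod z))" if z: "z \<in> S2" for z
  proof -
    have p: "0 < 1 + t * cmod z" "1 \<le> 1 + s * cmod z" using ts by (auto simp: add_pos_nonneg)
    have "cmod (?q z) = cmod (f z) / (cmod (1 + of_real t * z) * cmod (1 + of_real s * z))"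
      by (simp add: norm_divide norm_mult)
    also have "\<dots> \<le> ?F / ((c * (1 + t * cmod z)) * (c * 1))"
    proof (intro frac_le mult_mono mult_pos_pos)
      show "cmod (f z) \<le> ?F" using z by (intro H_inf_norm_bound[OF f]) auto
      show "c * (1 + t * cmod z) \<le> cmod (1 + of_real t * z)" using c(2)[of z t] z ts by auto
      have "c * 1 \<le> c * (1 + s * cmod z)" using c(1) p(2) by (intro mult_left_mono) auto
      also have "\<dots> \<le> cmod (1 + of_real s * z)" using c(2)[of z s] z ts by auto
      finally show "c * 1 \<le> cmod (1 + of_real s * z)" .
    qed (use F0 c(1) p(1) in auto)
    finally have "cmod (?q z) * norm (A (R z x)) \<le> ?F / ((c * (1 + t * cmod z)) * (c * 1)) * ((M2 + 1) * K (1 / cmod z) x)"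
      using A_R_le[of z x] z F0 c(1) p(1) by (intro mult_mono) auto
    also have "\<dots> = k * (K (1 / cmod z) x / (1 + t * cmod z))"
      by (simp add: k_def power2_eq_square mult_ac)
    finally show ?thesis by (simp only: norm_scaleC)
  qed
  have part: "norm (ray_part ?g \<theta> n) \<le> k * ?Q" if \<theta>: "\<theta> = \<psi>2 \<or> \<theta> = - \<psi>2" for \<theta> n
  proof -
    let ?I = "window n"
    have pos: "0 < r" if "r \<in> ?I" for r using less_le_trans[OF Suc_interval(1)[of n], of r] that by auto
    have ray: "rcis r \<theta> \<in> S2" if "0 < r" for r using ray_S2[OF that] \<theta> by auto
    have kc: "continuous_on ?I (\<lambda>r. K (1 / r) x / (1 + t * r))"
    proof (intro continuous_on_divide continuous_on_compose2[OF K_continuous_on, of _ "\<lambda>r. 1 / r"] continuous_intros)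
      show "(\<lambda>r. 1 / r) ` ?I \<subseteq> {0<..}" using pos by (auto simp del: of_nat_Suc)
      show "\<forall>r\<in>?I. 1 + t * r \<noteq> 0" using pos ts by (metis add_pos_pos less_irrefl mult_pos_pos zero_less_one)
      show "\<forall>r\<in>?I. r \<noteq> 0" using pos by blast
    qed
    have "norm (ray_part ?g \<theta> n) \<le> integral ?I (\<lambda>r. k * (K (1 / r) x / (1 + t * r)))"
      unfolding ray_part_def
    proof (rule integral_norm_bound_integral)
      show "(\<lambda>r. cis \<theta> *\<^sub>C ?g (rcis r \<theta>)) integrable_on ?I" by (rule ray_part_integrable[OF gc ray])
      show "(\<lambda>r. k * (K (1 / r) x / (1 + t * r))) integrable_on ?I"
        by (intro integrable_continuous_real continuous_on_mult continuous_on_const kc)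
      fix r assume "r \<in> ?I"
      then have r: "0 < r" by (rule pos)
      have "norm (cis \<theta> *\<^sub>C ?g (rcis r \<theta>)) = norm (?g (rcis r \<theta>))" by (simp only: norm_scaleC norm_cis mult_1)
      also have "\<dots> \<le> k * (K (1 / cmod (rcis r \<theta>)) x / (1 + t * cmod (rcis r \<theta>)))" by (rule gn[OF ray[OF r]])
      finally show "norm (cis \<theta> *\<^sub>C ?g (rcis r \<theta>)) \<le> k * (K (1 / r) x / (1 + t * r))" using r by simp
    qed
    also have "\<dots> = k * integral ?I (\<lambda>r. K (1 / r) x / (1 + t * r))" by (rule integral_mult_right)
    also have "\<dots> \<le> k * ?Q"
      by (intro mult_left_mono resolvent_integral_le_calderon x ts Suc_interval k0)
    finally show ?thesis .
  qed
  have "norm (kk *\<^sub>C d ?m x + 0) \<le> 2 * (k * ?Q)"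
  proof (rule LIMSEQ_le_const2[OF tendsto_norm[OF l[unfolded contour_limit_def]]], intro exI allI impI)
    fix n
    show "norm (ray_part ?g (- \<psi>2) n - ray_part ?g \<psi>2 n) \<le> 2 * (k * ?Q)"
      using norm_triangle_ineq4[of "ray_part ?g (- \<psi>2) n" "ray_part ?g \<psi>2 n"] part[of \<psi>2 n] part[of "- \<psi>2" n] by simp
  qed
  then show ?thesis by (simp add: norm_scaleC norm_mult k_def)
qed

text \<open>y is split at J s y. The rest y - J s y equals - A R(-1/s) y, has norm at most (M2 + 1)
  K(s, y), and vanishes as s -> 0 with t fixed.\<close>

lemma K_calculus_le:
  assumes f: "f \<in> H_inf \<phi>" and x: "x \<in> V" and y: "y \<in> V"
    and eq: "d regularizer y = d (\<lambda>z. f z * regularizer z) x" and t: "0 < t"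
  shows "K t y / t \<le> (2 + c0) * (M2 + 1) / (pi * c\<^sup>2) * H_inf_norm \<phi> f * cmod (PQ x t)"
proof -
  let ?Q = "cmod (PQ x t)"
  let ?a = "H_inf_norm \<phi> f * (M2 + 1) / c\<^sup>2 * ?Q / pi"
  let ?b = "(2 + c0) * (t * ?a)"
  have step: "K t y \<le> ?b + (M2 + 1) * K s y" if s: "0 < s" for s
  proof -
    let ?w = "pole s"
    let ?m = "\<lambda>z. f z * z / den t s z"
    have "norm (d ?m x) = pi * norm (d ?m x) / pi" by simp
    also have "\<dots> \<le> ?a"
      by (rule divide_right_mono[OF norm_dunford_le[OF f x t s]]) auto
    finally have "norm (d ?m x) \<le> ?a" .
    from mult_left_mono[OF this, of t]
    have "norm (J s y - J t (J s y)) \<le> t * ?a"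
      unfolding J_twice_dunford[OF f x y eq t s] norm_scaleC using t by simp
    from mult_left_mono[OF this, of "2 + c0"] have "K t (J s y) \<le> ?b"
      using K_le_J[OF t neg_\<rho>[OF t], of "J s y"] c0(1) by linarith
    moreover have "norm (y - J s y) = norm (A (R ?w y))"
      using A_R[OF neg_\<rho>[OF s], of y] by (simp add: J_def norm_minus_commute)
    moreover have "norm (A (R ?w y)) \<le> (M2 + 1) * K s y"
      using A_R_le[OF neg_real_far[OF s, of \<psi>2], of y] angles s by (simp add: norm_divide)
    ultimately show ?thesis
      using K_add[of t "J s y" "y - J s y"] K_le_norm[of t "y - J s y"] t by simp
  qed
  have "(\<lambda>n. ?b + (M2 + 1) * K (1 / real (Suc n)) y) \<longlonglongrightarrow> ?b + (M2 + 1) * 0"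
    by (intro tendsto_add tendsto_mult tendsto_const K_tendsto_0 y)
  from LIMSEQ_le_const[OF this, of "K t y"] have "K t y \<le> ?b" using step[OF Suc_interval(1)] by auto
  then have "K t y / t \<le> ?b / t" using t by (intro divide_right_mono) auto
  also have "\<dots> = (2 + c0) * (M2 + 1) / (pi * c\<^sup>2) * H_inf_norm \<phi> f * ?Q" using t by (simp add: mult_ac)
  finally show ?thesis .
qed

text \<open>The preimage chosen by \<open>calculus\<close> enters only through the equation it
  satisfies. \<open>max 0 k1\<close> is taken because the bound of P + Q comes without a
  sign.\<close>

lemma calculus_bounded:
  "\<exists>k\<ge>0. \<forall>f \<in> H_inf \<phi>. \<forall>x \<in> calculus_domain V NV DV A \<phi> f.
     NV (calculus V NV DV A \<phi> f x) \<le> k * H_inf_norm \<phi> f * NV x"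
proof -
  obtain k1 where k1: "\<And>h. h \<in> \<Phi> \<Longrightarrow> N (\<lambda>t. hardy h t + hardy_adj h t) \<le> k1 * N h"
    using calderon unfolding calderon_bounded_def by blast
  define k2 where "k2 = (2 + c0) * (M2 + 1) / (pi * c\<^sup>2)"
  have k2: "0 \<le> k2" using c0(1) M2(1) by (simp add: k2_def)
  have "NV (calculus V NV DV A \<phi> f x) \<le> (k2 * max 0 k1) * H_inf_norm \<phi> f * NV x"
    if f: "f \<in> H_inf \<phi>" and xd: "x \<in> calculus_domain V NV DV A \<phi> f" for f x
  proof -
    define y where "y = calculus V NV DV A \<phi> f x"
    have x: "x \<in> V" and im: "d (\<lambda>z. f z * regularizer z) x \<in> d regularizer ` V"
      using xd by (auto simp: calculus_domain_def)
    have y: "y \<in> V" "d regularizer y = d (\<lambda>z. f z * regularizer z) x"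
      unfolding y_def calculus_def using inv_into_into[OF im] f_inv_into_f[OF im] by auto
    have F0: "0 \<le> H_inf_norm \<phi> f" by (rule H_inf_norm_nonneg[OF f])
    have kx: "kq x \<in> \<Phi>" using x by (simp add: V_iff)
    let ?H = "\<lambda>t. PQ x t"
    let ?k = "complex_of_real (k2 * H_inf_norm \<phi> f)"
    have H: "?H \<in> \<Phi>" using calderon kx unfolding calderon_bounded_def by blast
    have "NV y \<le> N (\<lambda>t. ?k * ?H t)"
    proof (rule V_dom(2)[OF \<Phi>_cmult[OF H]])
      fix t :: real assume t: "0 < t"
      show "K t y / t \<le> cmod (?k * ?H t)"
        unfolding norm_mult[of ?k] norm_of_real abs_of_nonneg[OF mult_nonneg_nonneg[OF k2 F0]]
        using K_calculus_le[OF f x y t] by (simp only: k2_def)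
    qed
    also have "\<dots> = (k2 * H_inf_norm \<phi> f) * N ?H"
      unfolding N_cmult[OF H] norm_of_real using k2 F0 by simp
    also have "\<dots> \<le> (k2 * H_inf_norm \<phi> f) * (max 0 k1 * N (kq x))"
      using k1[OF kx] mult_right_mono[of k1 "max 0 k1" "N (kq x)"] N_nonneg[OF kx] k2 F0
      by (intro mult_left_mono) auto
    finally show ?thesis by (simp add: y_def NV_eq mult_ac)
  qed
  moreover have "0 \<le> k2 * max 0 k1" using k2 by simp
  ultimately show ?thesis by blast
qed

end

section \<open>Choice of the angles\<close>

lemma sectoriality_angle_le:
  "sectorial_of_angle V N D B \<theta> \<Longrightarrow> sectoriality_angle V N D B \<le> \<theta>"
  unfolding sectoriality_angle_def
  by (rule cInf_lower) (auto intro!: bdd_belowI[of _ 0] simp: sectorial_of_angle_def)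

lemma sectoriality_angle_less:
  assumes "sectorial V N D B" "sectoriality_angle V N D B < \<phi>"
  obtains \<theta> where "sectorial_of_angle V N D B \<theta>" "\<theta> < \<phi>"
  using cInf_lessD[of "{\<theta>. sectorial_of_angle V N D B \<theta>}" \<phi>] assms
  by (auto simp: sectorial_def sectoriality_angle_def)

theorem theorem3p6:
  fixes D :: "'a::complex_banach set" and A :: "'a \<Rightarrow> 'a"
    and \<Phi> :: "(real \<Rightarrow> complex) set" and N :: "(real \<Rightarrow> complex) \<Rightarrow> real" and \<phi> :: real
  assumes "sectorial UNIV norm D A"
    and "invertible_operator UNIV norm D A"
    and "banach_function_space \<Phi> N"
    and "(\<lambda>t. complex_of_real (min 1 (1 / t))) \<in> \<Phi>"
    and "calderon_bounded \<Phi> N"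
    and "sectoriality_angle UNIV norm D A < \<phi>" and "\<phi> < pi"
  shows "has_bounded_H_inf_calculus
           (interp_space D A \<Phi>) (interp_norm D A N) (part_domain D A \<Phi>) A \<phi>"
proof -
  obtain \<theta> where \<theta>: "sectorial_of_angle UNIV norm D A \<theta>" "\<theta> < \<phi>"
    using sectoriality_angle_less[OF assms(1,6)] .
  then have \<theta>0: "0 < \<theta>" by (simp add: sectorial_of_angle_def)
  interpret calderon_interp D A \<Phi> N
    using assms(2-5) \<theta>(1)
    by unfold_locales (auto simp: sectorial_of_angle_def invertible_operator_def)
  have sV: "sectorial_of_angle V NV DV A \<theta>" by (rule part_sectorial[OF \<theta>(1)])
  then have sectorial: "sectorial V NV DV A" unfolding sectorial_def by blast
  have angle: "sectoriality_angle V NV DV A < \<phi>" using sectoriality_angle_le[OF sV] \<theta>(2) by simp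
  define \<psi> where "\<psi> = contour_angle V NV DV A \<phi>"
  have "\<exists>\<psi>. sectoriality_angle V NV DV A < \<psi> \<and> \<psi> < \<phi>" using dense[OF angle] by blast
  then have \<psi>: "sectoriality_angle V NV DV A < \<psi>" "\<psi> < \<phi>"
    unfolding \<psi>_def contour_angle_def by (metis (mono_tags, lifting) someI_ex)+
  \<comment> \<open>\<psi> may lie below \<theta>, but the part is sectorial of some angle smaller
    than \<psi>, which gives its resolvent bounds on \<open>far \<psi>\<close>.\<close>
  obtain \<theta>' where \<theta>': "sectorial_of_angle V NV DV A \<theta>'" "\<theta>' < \<psi>"
    using sectoriality_angle_less[OF sectorial \<psi>(1)] .
  have \<psi>0: "0 < \<psi>" "\<psi> < pi" using \<theta>' \<psi>(2) assms(7) by (auto simp: sectorial_of_angle_def)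
  \<comment> \<open>Strictly above \<theta>, where the estimates for A are known, not below \<psi>,
    and still below \<phi>.\<close>
  define \<psi>2 where "\<psi>2 = max \<psi> ((\<theta> + \<phi>) / 2)"
  have \<psi>2: "\<psi> \<le> \<psi>2" "\<theta> < \<psi>2" "\<psi>2 < \<phi>" using \<theta>(2) \<psi>(2) by (auto simp: \<psi>2_def less_max_iff_disj)
  note far = sectorial_of_angle_far[OF \<theta>' \<psi>0(2)]
  obtain C0 where C0: "\<And>z x. z \<in> far \<psi> \<Longrightarrow> x \<in> V \<Longrightarrow> NV (z *\<^sub>C resolvent DV A z x) \<le> C0 * NV x"
    using far(2) by blast
  define C where "C = max 0 C0"
  have C: "0 \<le> C" "\<And>z x. z \<in> far \<psi> \<Longrightarrow> x \<in> V \<Longrightarrow> NV (z *\<^sub>C resolvent DV A z x) \<le> C * NV x"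
    using C0 mult_right_mono[of C0 C] NV_nonneg order_trans unfolding C_def by (simp, force)
  \<comment> \<open>The bound for R(z) on X is drawn from the part, since on
    \<open>far \<psi>\<close> the sectoriality of A at angle \<theta> may say nothing.\<close>
  have \<rho>: "z \<in> \<rho>" "norm (R z x) \<le> (C * (c0 + 1) + c0) * norm x" if "z \<in> far \<psi>" for z x
    using part_resolvent_converse[of z C] far(1) C that by auto
  obtain M where M: "\<And>z x. z \<in> far \<psi>2 \<Longrightarrow> norm (z *\<^sub>C R z x) \<le> M * norm x"
    using sectorial_of_angle_far(2)[OF \<theta>(1) \<psi>2(2)] \<psi>2(3) assms(7) by auto
  obtain c where c: "0 < c" "\<And>z t. z \<in> sector \<phi> \<Longrightarrow> 0 \<le> t \<Longrightarrow> c * (1 + t * cmod z) \<le> cmod (1 + of_real t * z)"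
    using one_plus_lower[of \<phi>] \<theta>0 \<theta>(2) assms(7) by auto
  interpret contour_calculus D A \<Phi> N \<phi> \<psi> \<psi>2 "C * (c0 + 1) + c0" C "max 0 M" c
  proof unfold_locales
    show "\<psi> = contour_angle V NV DV A \<phi>" by (rule \<psi>_def)
    show "far \<psi> \<subseteq> \<rho>" using \<rho>(1) by blast
    show "0 \<le> C * (c0 + 1) + c0" using C(1) c0(1) by simp
    show "NV (z *\<^sub>C R z x) \<le> C * NV x" if "z \<in> far \<psi>" "x \<in> V" for z x
      using C(2)[OF that] part_resolvent(2)[OF \<rho>(1)[OF that(1)] that(2)] by simp
    show "norm (z *\<^sub>C R z x) \<le> max 0 M * norm x" if "z \<in> far \<psi>2" for z x
      using M[OF that, of x] mult_right_mono[of M "max 0 M" "norm x"] by simp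
    show "norm (R z x) \<le> (C * (c0 + 1) + c0) * norm x" if "z \<in> far \<psi>" for z x by (rule \<rho>(2)[OF that])
  qed (use \<psi>0 \<psi>2 assms(7) C(1) c in simp_all)
  have "inj_on A DV"
  proof (rule inj_onI)
    fix u v assume uv: "u \<in> DV" "v \<in> DV" "A u = A v"
    then have "u \<in> D" "v \<in> D" by (simp_all add: DV_iff)
    then have "- u = - v" using uv(3) by (metis R0_A)
    then show "u = v" by simp
  qed
  then show ?thesis
    unfolding has_bounded_H_inf_calculus_def using sectorial angle assms(7) calculus_bounded by blast
qed

end
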